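(* Let $p$ be a prime with $p\equiv 1\pmod 4$, let $A\subseteq\mathbb{F}_p^*$, and define $\psi$ by $\mathrm{sf}(A)=|A|/3+\psi$. Then for every $\varepsilon>0$, $$\Big|\sum_{x\in A}\Big(\frac{x}{p}\Big)\Big|\ll_\varepsilon \psi\, p^{1/2+\varepsilon},$$ equivalently $\big||A\cap\mathcal{Q}|-|A\cap\mathcal{N}|\big|\ll_\varepsilon\psi\,p^{1/2+\varepsilon}$. Furthermore, if $p\equiv 3\pmod 4$, $A\subseteq\mathbb{F}_p^*$ and $\psi$ is defined by $\mathrm{sf}_3(A)=|A|/4+\psi$, then the same bound $\big|\sum_{x\in A}(\frac{x}{p})\big|\ll_\varepsilon\psi\,p^{1/2+\varepsilon}$ holds.
   Context: $(\frac{x}{p})$ is the Legendre symbol; $\mathcal{Q},\mathcal{N}\subseteq\mathbb{F}_p^*$ are the sets of quadratic residues and non-residues. $\mathrm{sf}(A)$ is the maximal size of a subset $S\subseteq A$ with no solution to $x+y=z$, $x,y,z\in S$; $\mathrm{sf}_3(A)$ is the maximal size of a subset $S\subseteq A$ with no solution to $x_1+x_2+x_3=y$, $x_1,x_2,x_3,y\in S$. $X\ll_\varepsilon Y$ means $X\le C_\varepsilon Y$ with $C_\varepsilon$ depending only on $\varepsilon$. *)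

theory Defs
  imports Complex_Main "HOL-Number_Theory.Number_Theory"
begin

definition sum_free :: "('a, 'b) ring_scheme \<Rightarrow> 'a set \<Rightarrow> bool"
  where "sum_free R S \<longleftrightarrow> (\<nexists>x y z. x \<in> S \<and> y \<in> S \<and> z \<in> S \<and> x \<oplus>\<^bsub>R\<^esub> y = z)"

definition sum_free3 :: "('a, 'b) ring_scheme \<Rightarrow> 'a set \<Rightarrow> bool"
  where "sum_free3 R S \<longleftrightarrow>
    (\<nexists>x1 x2 x3 y. x1 \<in> S \<and> x2 \<in> S \<and> x3 \<in> S \<and> y \<in> S \<and> x1 \<oplus>\<^bsub>R\<^esub> x2 \<oplus>\<^bsub>R\<^esub> x3 = y)"

text \<open>The two maxima below are meaningful for finite \<open>A\<close>; the empty set is always a candidate.\<close>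

definition sf :: "('a, 'b) ring_scheme \<Rightarrow> 'a set \<Rightarrow> nat"
  where "sf R A = Max (card ` {S. S \<subseteq> A \<and> sum_free R S})"

definition sf3 :: "('a, 'b) ring_scheme \<Rightarrow> 'a set \<Rightarrow> nat"
  where "sf3 R A = Max (card ` {S. S \<subseteq> A \<and> sum_free3 R S})"

text \<open>For prime \<open>p\<close>, the field with \<open>p\<close> elements is \<open>residue_ring p\<close>, with carrier
  \<open>{0..p - 1}\<close> and addition modulo \<open>p\<close>; its unit group is \<open>{1..p - 1}\<close>.\<close>

abbreviation Fp :: "nat \<Rightarrow> int ring"
  where "Fp p \<equiv> residue_ring (int p)"

definition residues_set :: "nat \<Rightarrow> int set"
  where "residues_set p = {x \<in> Units (Fp p). QuadRes (int p) x}"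

definition nonresidues_set :: "nat \<Rightarrow> int set"
  where "nonresidues_set p = {x \<in> Units (Fp p). \<not> QuadRes (int p) x}"

end

theory Submission
  imports Defs "HOL-Analysis.Analysis"
begin

text \<open>The open middle third of \<open>F_p\<close> is sum-free, and so is each of its dilates. Averaging the size of
  \<open>A \<inter> \<lambda>\<inverse> I\<close> over \<open>\<lambda>\<close> with weights \<open>1 \<plusminus> (\<lambda>/p)\<close> gives
  \<open>\<psi> (p - 1) \<ge> \<bar>\<Sum>\<^bsub>x \<in> A\<^esub> (x/p)\<bar> T\<close>, where \<open>T\<close> is the absolute value of the Legendre sum over the
  middle third \<open>I\<close>; for \<open>sf3\<close> one uses the interval \<open>(p/8, 3p/8)\<close> instead. By Fourier expansion
  and Gauss sums, \<open>T\<close> is a constant times \<open>p\<^sup>1\<^sup>/\<^sup>2 L(1, \<chi>)\<close>, where \<open>\<chi>\<close> is the Legendre symbol times the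
  character modulo 3 (respectively times the even character modulo 8). The lower bound
  \<open>L(1, \<chi>) \<ge> c p\<^sup>-\<^sup>\<epsilon>\<close> is Siegel's theorem. Its proof here is elementary and uses only real points:
  for \<open>\<beta>\<close> close to 1, the hyperbola method evaluates the partial sums of the nonnegative coefficients of
  \<open>\<zeta>(\<beta>) L(\<beta>, \<chi>)\<close>, and, once some character \<open>\<chi>\<close> has a real zero \<open>\<beta>\<close> near 1, of
  \<open>\<zeta>(\<beta>) L(\<beta>, \<chi>) L(\<beta>, \<chi>') L(\<beta>, \<chi>\<chi>')\<close> for all other characters \<open>\<chi>'\<close>.\<close>

unbundle no vec_syntax

text \<open>Parity dictates the two choices of interval. For p congruent to 1 modulo 4 the Legendre
  symbol is even, so a symmetric interval such as the middle third can have a nonzero sum. For p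
  congruent to 3 it is odd, every symmetric interval sums to 0, and an asymmetric one is required,
  which is available once sums of three elements are the forbidden ones. In both cases the auxiliary
  character has the opposite parity, so that \<chi> is odd and L(1,\<chi>) is a finite sum of
  sawtooth values, which combine to step functions. The obstacle is uniformity in p. For a single p,
  L(1,\<chi>) > 0 would be enough, but one constant must serve all primes, and the estimates do not
  exclude a zero very close to 1. Siegel's device lets one bad character, fixed once and for all,
  control all the others; hence the constant comes with no computable value. Distinct primes make
  the product of two characters nonprincipal, as this needs. A bad character betrays itself by
  L(1-\<delta>,\<chi>) < 0, and \<zeta>(s) < 0 for 0 < s < 1 makes the opposite sign
  favourable.\<close>

section \<open>Real characters and their series at real points\<close>

text \<open>The vanishing sum over a period excludes principal characters; primitivity is not required.\<close>
definition real_char :: "nat \<Rightarrow> (nat \<Rightarrow> real) \<Rightarrow> bool" where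
  "real_char q \<chi> \<longleftrightarrow> q > 0 \<and> \<chi> 1 = 1 \<and> (\<forall>m n. \<chi> (m * n) = \<chi> m * \<chi> n) \<and>
     (\<forall>n. \<chi> n \<in> {-1, 0, 1}) \<and> (\<forall>n. \<chi> (n + q) = \<chi> n) \<and> (\<Sum>n<q. \<chi> n) = 0"

lemma real_charD:
  assumes "real_char q \<chi>"
  shows "q > 0" "\<chi> (Suc 0) = 1" "\<chi> (m * n) = \<chi> m * \<chi> n" "\<chi> n \<in> {-1, 0, 1}"
    "\<chi> (n + q) = \<chi> n" "(\<Sum>n<q. \<chi> n) = 0" "\<bar>\<chi> n\<bar> \<le> 1"
proof -
  show "\<chi> n \<in> {-1, 0, 1}" using assms by (auto simp: real_char_def)
  then show "\<bar>\<chi> n\<bar> \<le> 1" by auto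
qed (use assms in \<open>auto simp: real_char_def\<close>)

text \<open>Whole periods can be stripped until fewer than q terms are left. Any bound polynomial in
  q would serve: x is later a fixed power of the modulus, raised to the small exponent 1 -
  s.\<close>

lemma real_char_sum_bound:
  assumes "real_char q \<chi>"
  shows "\<bar>\<Sum>i<n. \<chi> (a + i)\<bar> \<le> real q"
proof (induction n rule: less_induct)
  case (less n)
  note c = real_charD[OF assms]
  show ?case
  proof (cases "n < q")
    case True
    have "\<bar>\<Sum>i<n. \<chi> (a + i)\<bar> \<le> (\<Sum>i<n. \<bar>\<chi> (a + i)\<bar>)" by (rule sum_abs)
    also have "\<dots> \<le> (\<Sum>i<n. 1)" using c(7) by (intro sum_mono)
    finally show ?thesis using True by simp
  next
    case False
    \<comment> \<open>Moving the window by one exchanges two equal values, so the vanishing sum at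
      offset 0 spreads to all offsets.\<close>
    have *: "(\<Sum>i<q. \<chi> (b + i)) = 0" for b
    proof (induction b)
      case 0
      then show ?case using c(6) by simp
    next
      case (Suc b)
      have "(\<Sum>i<Suc q. \<chi> (b + i)) = \<chi> b + (\<Sum>i<q. \<chi> (Suc b + i))"
        by (subst sum.lessThan_Suc_shift) simp
      moreover have "(\<Sum>i<Suc q. \<chi> (b + i)) = (\<Sum>i<q. \<chi> (b + i)) + \<chi> (b + q)" by simp
      ultimately show ?case using c(5) Suc by simp
    qed
    define k where "k = n - q"
    have "n = k + q" using False by (simp add: k_def)
    have split: "(\<Sum>i<k + m. \<chi> (a + i)) = (\<Sum>i<k. \<chi> (a + i)) + (\<Sum>i<m. \<chi> ((a + k) + i))" for m
      by (induction m) (simp_all add: ac_simps)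
    have "(\<Sum>i<n. \<chi> (a + i)) = (\<Sum>i<k. \<chi> (a + i)) + (\<Sum>i<q. \<chi> ((a + k) + i))"
      unfolding \<open>n = k + q\<close> by (rule split)
    also have "\<dots> = (\<Sum>i<k. \<chi> (a + i))" using * by simp
    finally show ?thesis using less.IH[of k] c(1) \<open>n = k + q\<close> by simp
  qed
qed

text \<open>Summation by parts; the weights \<open>g i - g (Suc i)\<close> and \<open>g n\<close>
  are nonnegative and add up to \<open>g 0\<close>.\<close>

lemma abel_bound:
  fixes u g :: "nat \<Rightarrow> real"
  assumes U: "\<And>n. \<bar>\<Sum>i<n. u i\<bar> \<le> K" and g: "\<And>i. g (Suc i) \<le> g i" and g0: "\<And>i. g i \<ge> 0"
  shows "\<bar>\<Sum>i<n. u i * g i\<bar> \<le> K * g 0"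
proof -
  define U where "U = (\<lambda>n. \<Sum>i<n. u i)"
  have *: "(\<Sum>i<n. u i * g i) = U n * g n + (\<Sum>i<n. U (Suc i) * (g i - g (Suc i)))"
    by (induction n) (simp_all add: U_def algebra_simps)
  have "\<bar>\<Sum>i<n. U (Suc i) * (g i - g (Suc i))\<bar> \<le> (\<Sum>i<n. K * (g i - g (Suc i)))"
    by (rule order_trans[OF sum_abs])
       (use U g in \<open>auto intro!: sum_mono mult_right_mono simp: abs_mult U_def simp del: sum.lessThan_Suc\<close>)
  also have "\<dots> = K * (g 0 - g n)"
    by (simp add: sum_distrib_left[symmetric] sum_lessThan_telescope')
  finally have 1: "\<bar>\<Sum>i<n. U (Suc i) * (g i - g (Suc i))\<bar> \<le> K * (g 0 - g n)" .
  have "\<bar>U n * g n\<bar> \<le> K * g n" using U g0 by (auto simp: abs_mult U_def intro!: mult_right_mono)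
  with 1 show ?thesis unfolding * by (auto simp: algebra_simps)
qed

text \<open>Starting at 1 leaves out the degenerate index 0, where \<open>0 powr - s\<close> and
  \<open>1 / real 0\<close> are 0 and would spoil the monotonicity of the weights.\<close>

definition pos_series :: "(nat \<Rightarrow> real) \<Rightarrow> real" where
  "pos_series a = (\<Sum>n. a (Suc n))"

text \<open>\<open>abel_bound\<close> on a block that starts at N + 1 bounds it by q times its first
  weight, whatever its length; this gives the Cauchy property and, in the limit, the tail.\<close>

lemma char_series_tail:
  assumes "real_char q \<chi>" and g: "\<And>i. i > 0 \<Longrightarrow> g (Suc i) \<le> g i" and g0: "\<And>i. g i \<ge> 0"
    and lim: "g \<longlonglongrightarrow> 0"
  shows "(\<lambda>n. \<chi> (Suc n) * g (Suc n)) sums pos_series (\<lambda>n. \<chi> n * g n)"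
    and "\<bar>(\<Sum>n=1..N. \<chi> n * g n) - pos_series (\<lambda>n. \<chi> n * g n)\<bar> \<le> real q * g (Suc N)"
proof -
  have fin: "\<bar>\<Sum>i<n. \<chi> (Suc (N + i)) * g (Suc (N + i))\<bar> \<le> real q * g (Suc N)" for n N
    using abel_bound[of "\<lambda>i. \<chi> (Suc N + i)" "real q" "\<lambda>i. g (Suc N + i)" n]
      real_char_sum_bound[OF assms(1), where a = "Suc N"] g g0 by simp
  define s where "s = (\<lambda>N. \<Sum>i<N. \<chi> (Suc i) * g (Suc i))"
  have diff: "s (N + n) - s N = (\<Sum>i<n. \<chi> (Suc (N + i)) * g (Suc (N + i)))" for n N
    by (induction n) (simp_all add: s_def)
  have bd: "\<bar>s (N + n) - s N\<bar> \<le> real q * g (Suc N)" for n N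
    unfolding diff by (rule fin)
  have "Cauchy s"
  proof (rule metric_CauchyI)
    fix e :: real assume e: "e > 0"
    have "(\<lambda>N. real q * g (Suc N)) \<longlonglongrightarrow> real q * 0"
      by (intro tendsto_intros LIMSEQ_Suc[OF lim])
    then have "eventually (\<lambda>N. real q * g (Suc N) < e / 2) sequentially"
      using e by (intro order_tendstoD(2)) auto
    then obtain M where M: "\<And>N. N \<ge> M \<Longrightarrow> real q * g (Suc N) < e / 2"
      by (auto simp: eventually_sequentially)
    have "dist (s m) (s n) < e" if "m \<ge> M" "n \<ge> M" for m n
      using bd[of M "m - M"] bd[of M "n - M"] M[of M] that by (simp add: dist_real_def)
    then show "\<exists>M. \<forall>m\<ge>M. \<forall>n\<ge>M. dist (s m) (s n) < e" by blast
  qed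
  then have "convergent s" by (simp add: Cauchy_convergent_iff)
  then show sums: "(\<lambda>n. \<chi> (Suc n) * g (Suc n)) sums pos_series (\<lambda>n. \<chi> n * g n)"
    unfolding pos_series_def s_def by (intro summable_sums) (simp add: summable_iff_convergent)
  then have L: "s \<longlonglongrightarrow> pos_series (\<lambda>n. \<chi> n * g n)" by (simp add: sums_def s_def)
  have "\<bar>pos_series (\<lambda>n. \<chi> n * g n) - s N\<bar> \<le> real q * g (Suc N)"
  proof (rule LIMSEQ_le_const2)
    show "(\<lambda>n. \<bar>s (n + N) - s N\<bar>) \<longlonglongrightarrow> \<bar>pos_series (\<lambda>n. \<chi> n * g n) - s N\<bar>"
      by (intro tendsto_intros LIMSEQ_ignore_initial_segment[OF L])
    show "\<exists>M. \<forall>n\<ge>M. \<bar>s (n + N) - s N\<bar> \<le> real q * g (Suc N)"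
      using bd[of N] by (auto simp: add.commute)
  qed
  moreover have "(\<Sum>n=1..N. \<chi> n * g n) = s N"
    by (induction N) (simp_all add: s_def)
  ultimately show "\<bar>(\<Sum>n=1..N. \<chi> n * g n) - pos_series (\<lambda>n. \<chi> n * g n)\<bar> \<le> real q * g (Suc N)"
    by (simp add: abs_minus_commute)
qed

text \<open>The common majorant h makes the tail bound independent of t, so the continuous partial
  sums converge uniformly. Two families need this: n^(-s) as s varies, and r^n / n for r up to
  1.\<close>

lemma char_series_continuous:
  fixes g :: "real \<Rightarrow> nat \<Rightarrow> real"
  assumes "real_char q \<chi>" and g: "\<And>t i. t \<in> A \<Longrightarrow> i > 0 \<Longrightarrow> g t (Suc i) \<le> g t i"
    and g0: "\<And>t i. t \<in> A \<Longrightarrow> g t i \<ge> 0"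
    and h: "\<And>t i. t \<in> A \<Longrightarrow> i > 0 \<Longrightarrow> g t i \<le> h i" "h \<longlonglongrightarrow> 0"
    and cont: "\<And>n. n > 0 \<Longrightarrow> continuous_on A (\<lambda>t. g t n)"
  shows "continuous_on A (\<lambda>t. pos_series (\<lambda>n. \<chi> n * g t n))"
proof (rule uniform_limit_theorem)
  show "\<forall>\<^sub>F N in sequentially. continuous_on A (\<lambda>t. \<Sum>n=1..N. \<chi> n * g t n)"
    by (intro always_eventually allI continuous_intros cont) auto
  show "uniform_limit A (\<lambda>N t. \<Sum>n=1..N. \<chi> n * g t n) (\<lambda>t. pos_series (\<lambda>n. \<chi> n * g t n)) sequentially"
  proof (rule uniform_limitI)
    fix e :: real assume "e > 0"
    have "(\<lambda>N. real q * h (Suc N)) \<longlonglongrightarrow> real q * 0"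
      by (intro tendsto_intros LIMSEQ_Suc[OF h(2)])
    then have "eventually (\<lambda>N. real q * h (Suc N) < e) sequentially"
      using \<open>e > 0\<close> by (intro order_tendstoD(2)) auto
    then show "\<forall>\<^sub>F N in sequentially. \<forall>t\<in>A. dist (\<Sum>n=1..N. \<chi> n * g t n) (pos_series (\<lambda>n. \<chi> n * g t n)) < e"
    proof eventually_elim
      case (elim N)
      show ?case
      proof
        fix t assume t: "t \<in> A"
        have "g t \<longlonglongrightarrow> 0"
          by (rule tendsto_sandwich[OF _ _ tendsto_const h(2)])
             (use g0 h(1) t in \<open>auto intro!: eventually_sequentiallyI[of 1]\<close>)
        then have "\<bar>(\<Sum>n=1..N. \<chi> n * g t n) - pos_series (\<lambda>n. \<chi> n * g t n)\<bar> \<le> real q * g t (Suc N)"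
          using char_series_tail(2)[OF assms(1), of "g t"] g g0 t by blast
        also have "\<dots> \<le> real q * h (Suc N)" using h(1) t by (intro mult_left_mono) auto
        finally show "dist (\<Sum>n=1..N. \<chi> n * g t n) (pos_series (\<lambda>n. \<chi> n * g t n)) < e"
          using elim by (simp add: dist_real_def)
      qed
    qed
  qed
qed simp

section \<open>L-series at real points\<close>

definition Lser :: "real \<Rightarrow> (nat \<Rightarrow> real) \<Rightarrow> real" where
  "Lser s \<chi> = pos_series (\<lambda>n. \<chi> n * real n powr - s)"

text \<open>The cutoff is real because the hyperbola method evaluates such sums at x / n.\<close>

definition psum :: "real \<Rightarrow> (nat \<Rightarrow> real) \<Rightarrow> real \<Rightarrow> real" where
  "psum s a x = (\<Sum>n=1..nat \<lfloor>x\<rfloor>. a n * real n powr - s)"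

lemma le_nat_floor_iff: "n > 0 \<Longrightarrow> n \<le> nat \<lfloor>x\<rfloor> \<longleftrightarrow> real n \<le> x"
  by linarith

lemma powr_neg_tendsto_0: "s > 0 \<Longrightarrow> (\<lambda>n. real n powr - s) \<longlonglongrightarrow> 0"
  using tendsto_neg_powr[of "-s" real sequentially] filterlim_real_sequentially by auto

lemma powr_neg_mono: "s \<ge> 0 \<Longrightarrow> 0 < x \<Longrightarrow> x \<le> y \<Longrightarrow> y powr - s \<le> x powr - (s::real)"
  by (simp add: powr_mono2')

lemma Lser_approx:
  assumes "real_char q \<chi>" "s > 0" "x > 0"
  shows "\<bar>psum s \<chi> x - Lser s \<chi>\<bar> \<le> real q * x powr - s"
proof -
  have "\<bar>psum s \<chi> x - Lser s \<chi>\<bar> \<le> real q * real (Suc (nat \<lfloor>x\<rfloor>)) powr - s"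
    unfolding psum_def Lser_def
    using assms by (intro char_series_tail powr_neg_tendsto_0 powr_neg_mono) auto
  also have "\<dots> \<le> real q * x powr - s"
    using assms by (intro mult_left_mono powr_neg_mono) linarith+
  finally show ?thesis .
qed

text \<open>The tail estimate with an empty partial sum.\<close>

lemma Lser_abs_le:
  assumes "real_char q \<chi>" "s > 0"
  shows "\<bar>Lser s \<chi>\<bar> \<le> real q"
proof -
  have "\<bar>(\<Sum>n=1..0. \<chi> n * real n powr - s) - Lser s \<chi>\<bar> \<le> real q * real (Suc 0) powr - s"
    unfolding Lser_def
    using assms by (intro char_series_tail powr_neg_tendsto_0 powr_neg_mono) auto
  then show ?thesis by simp
qed

lemma Lser_continuous:
  assumes "real_char q \<chi>" "a > 0"
  shows "continuous_on {a..} (\<lambda>s. Lser s \<chi>)"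
  unfolding Lser_def
proof (rule char_series_continuous[OF assms(1), where h = "\<lambda>i. real i powr - a"])
  show "real i powr - t \<le> real i powr - a" if "t \<in> {a..}" "i > 0" for t i
    using that by (intro powr_mono) auto
  show "(\<lambda>i. real i powr - a) \<longlonglongrightarrow> 0" using assms by (intro powr_neg_tendsto_0)
  show "real (Suc i) powr - t \<le> real i powr - t" if "t \<in> {a..}" "i > 0" for t i
    using that assms by (intro powr_neg_mono) auto
qed (auto intro!: continuous_intros)

section \<open>Hyperbola method\<close>

text \<open>Dirichlet convolution, the coefficients of a product of two Dirichlet series. For n = 0
  the index set is infinite and the sum is 0.\<close>

definition dconv :: "(nat \<Rightarrow> real) \<Rightarrow> (nat \<Rightarrow> real) \<Rightarrow> nat \<Rightarrow> real" where
  "dconv a b n = (\<Sum>d | d dvd n. a d * b (n div d))"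

text \<open>n^(-s) is completely multiplicative, so it passes through the convolution; this reduces
  weighted partial sums to the plain hyperbola identity.\<close>

lemma dconv_powr:
  assumes "n > 0"
  shows "dconv (\<lambda>n. a n * real n powr - s) (\<lambda>n. b n * real n powr - s) n = dconv a b n * real n powr - s"
  unfolding dconv_def sum_distrib_right
proof (rule sum.cong)
  fix d assume d: "d \<in> {d. d dvd n}"
  then obtain e where n: "n = d * e" by auto
  with assms have "d > 0" "e > 0" by auto
  then show "a d * real d powr - s * (b (n div d) * real (n div d) powr - s) = a d * b (n div d) * real n powr - s"
    by (simp add: n powr_mult)
qed simp

text \<open>Pairs (m, n) with m n \<le> x are split according to n \<le> y or n > y; in the second
  class m \<le> x / y follows, which makes both outer sums short.\<close>

lemma dconv_sum_hyperbola:
  fixes a b :: "nat \<Rightarrow> real"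
  assumes "y > 0"
  shows "(\<Sum>n=1..nat \<lfloor>x\<rfloor>. dconv a b n) =
           (\<Sum>n=1..nat \<lfloor>y\<rfloor>. b n * (\<Sum>m=1..nat \<lfloor>x / real n\<rfloor>. a m)) +
           (\<Sum>m=1..nat \<lfloor>x / y\<rfloor>. a m * ((\<Sum>n=1..nat \<lfloor>x / real m\<rfloor>. b n) - (\<Sum>n=1..nat \<lfloor>y\<rfloor>. b n)))"
proof -
  define I where "I = (\<lambda>x::real. {1..nat \<lfloor>x\<rfloor>})"
  have I: "n \<in> I x \<longleftrightarrow> n > 0 \<and> real n \<le> x" for n x
    unfolding I_def using le_nat_floor_iff[of n x] by auto
  have [simp]: "finite (I x)" for x by (simp add: I_def)
  define P where "P = {(m, n). m > 0 \<and> n > 0 \<and> real m * real n \<le> x}"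
  define h where "h = (\<lambda>(m, n). a m * b n)"
  have "(\<Sum>n\<in>I x. dconv a b n) = (\<Sum>(n, d)\<in>Sigma (I x) (\<lambda>n. {d. d dvd n}). a d * b (n div d))"
    unfolding dconv_def by (rule sum.Sigma) (auto simp: I)
  also have "\<dots> = sum h P"
    by (rule sum.reindex_bij_witness[of _ "\<lambda>(m, n). (m * n, m)" "\<lambda>(n, d). (d, n div d)"])
       (auto simp: P_def h_def I real_of_nat_div intro: Nat.gr0I simp flip: of_nat_mult)
  also have "finite P"
  proof (rule finite_subset)
    show "P \<subseteq> I x \<times> I x"
    proof
      fix z assume "z \<in> P"
      then obtain m n where z: "z = (m, n)" "m > 0" "n > 0" "real m * real n \<le> x" by (auto simp: P_def)
      have "real m * 1 \<le> real m * real n" "1 * real n \<le> real m * real n"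
        using z by (intro mult_mono; simp)+
      then have "real m \<le> x" "real n \<le> x" using z by linarith+
      then show "z \<in> I x \<times> I x" using z by (auto simp: I)
    qed
  qed simp
  then have "sum h P = sum h {z\<in>P. real (snd z) \<le> y} + sum h {z\<in>P. \<not> real (snd z) \<le> y}"
    by (subst sum.union_disjoint[symmetric]) (auto intro!: sum.cong)
  also have "sum h {z\<in>P. real (snd z) \<le> y} = (\<Sum>(n, m)\<in>Sigma (I y) (\<lambda>n. I (x / real n)). b n * a m)"
    by (rule sum.reindex_bij_witness[of _ "\<lambda>(n, m). (m, n)" "\<lambda>(m, n). (n, m)"])
       (auto simp: P_def h_def I field_simps)
  also have "\<dots> = (\<Sum>n\<in>I y. b n * (\<Sum>m\<in>I (x / real n). a m))"
    by (subst sum.Sigma[symmetric]) (auto simp: sum_distrib_left)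
  also have "{z\<in>P. \<not> real (snd z) \<le> y} = Sigma (I (x / y)) (\<lambda>m. I (x / real m) - I y)"
  proof (intro Set.set_eqI iffI)
    fix z assume "z \<in> {z\<in>P. \<not> real (snd z) \<le> y}"
    then obtain m n where z: "z = (m, n)" "m > 0" "n > 0" "real m * real n \<le> x" "real n > y" by (auto simp: P_def)
    have "real m * y \<le> real m * real n" using z by (intro mult_left_mono) auto
    then have "real m * y \<le> x" using z by linarith
    then show "z \<in> Sigma (I (x / y)) (\<lambda>m. I (x / real m) - I y)" using z assms by (auto simp: I field_simps)
  qed (auto simp: P_def I field_simps)
  also have "sum h (Sigma (I (x / y)) (\<lambda>m. I (x / real m) - I y)) =
      (\<Sum>m\<in>I (x / y). \<Sum>n\<in>I (x / real m) - I y. a m * b n)"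
    unfolding h_def by (rule sum.Sigma[symmetric]) auto
  also have "\<dots> = (\<Sum>m\<in>I (x / y). a m * ((\<Sum>n\<in>I (x / real m). b n) - (\<Sum>n\<in>I y. b n)))"
  proof (rule sum.cong)
    fix m assume m: "m \<in> I (x / y)"
    then have "y \<le> x / real m" using assms by (auto simp: I field_simps)
    then have "I y \<subseteq> I (x / real m)" by (auto simp: I)
    then show "(\<Sum>n\<in>I (x / real m) - I y. a m * b n) = a m * ((\<Sum>n\<in>I (x / real m). b n) - (\<Sum>n\<in>I y. b n))"
      by (simp add: sum_diff sum_distrib_left[symmetric])
  qed simp
  finally show ?thesis by (simp add: I_def)
qed

lemma psum_dconv:
  assumes "y > 0"
  shows "psum s (dconv a b) x =
           (\<Sum>n=1..nat \<lfloor>y\<rfloor>. b n * real n powr - s * psum s a (x / real n)) +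
           (\<Sum>m=1..nat \<lfloor>x / y\<rfloor>. a m * real m powr - s * (psum s b (x / real m) - psum s b y))"
proof -
  have "psum s (dconv a b) x =
      (\<Sum>n=1..nat \<lfloor>x\<rfloor>. dconv (\<lambda>n. a n * real n powr - s) (\<lambda>n. b n * real n powr - s) n)"
    unfolding psum_def by (intro sum.cong refl dconv_powr[symmetric]) auto
  then show ?thesis unfolding dconv_sum_hyperbola[OF assms] psum_def .
qed

section \<open>Partial sums of the zeta series for 0 < s < 1\<close>

lemma powr_diff_bounds:
  fixes s :: real
  assumes "0 < s" "s < 1" "0 < a" "a \<le> b"
  shows "b powr - s * (b - a) \<le> (b powr (1 - s) - a powr (1 - s)) / (1 - s)"
    and "(b powr (1 - s) - a powr (1 - s)) / (1 - s) \<le> a powr - s * (b - a)"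
proof -
  have "b powr - s * (b - a) \<le> (b powr (1 - s) - a powr (1 - s)) / (1 - s) \<and>
     (b powr (1 - s) - a powr (1 - s)) / (1 - s) \<le> a powr - s * (b - a)"
  proof (cases "a = b")
    case False
    then have "a < b" using assms by simp
    moreover have "((\<lambda>t. t powr (1 - s) / (1 - s)) has_real_derivative t powr - s) (at t)" if "a \<le> t" for t
    proof -
      have "((\<lambda>t. t powr (1 - s) / (1 - s)) has_real_derivative ((1 - s) * t powr (1 - s - 1)) / (1 - s)) (at t)"
        using that assms by (intro DERIV_cdivide has_real_derivative_powr) auto
      then show ?thesis using assms by simp
    qed
    ultimately obtain t where t: "a < t" "t < b"
      "b powr (1 - s) / (1 - s) - a powr (1 - s) / (1 - s) = (b - a) * t powr - s"
      using MVT2[of a b "\<lambda>t. t powr (1 - s) / (1 - s)" "\<lambda>t. t powr - s"] by auto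
    have "b powr - s \<le> t powr - s" "t powr - s \<le> a powr - s"
      using t assms by (auto intro!: powr_neg_mono)
    then show ?thesis using t(3) \<open>a < b\<close>
      by (simp add: diff_divide_distrib mult.commute[of "b - a"] mult_right_mono)
  qed simp
  then show "b powr - s * (b - a) \<le> (b powr (1 - s) - a powr (1 - s)) / (1 - s)"
    "(b powr (1 - s) - a powr (1 - s)) / (1 - s) \<le> a powr - s * (b - a)" by auto
qed

text \<open>The constant Z is \<zeta>(s). The differences z N of sum and integral decrease, since
  N^(-s) is at most the integral over the preceding unit interval, while z N - N^(-s) increases; the
  limit lies between. Starting from z 0 = 0 yields both Z \<le> 0 and the upper bound without
  constant term.\<close>

lemma psum_one_asymp:
  assumes s: "0 < s" "s < 1"
  shows "\<exists>Z\<le>0. \<forall>x\<ge>1. \<bar>psum s (\<lambda>_. 1) x - x powr (1 - s) / (1 - s) - Z\<bar> \<le> 4 * x powr - s"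
    and "x > 0 \<Longrightarrow> psum s (\<lambda>_. 1) x \<le> x powr (1 - s) / (1 - s)"
proof -
  define z where "z = (\<lambda>N::nat. (\<Sum>n=1..N. real n powr - s) - real N powr (1 - s) / (1 - s))"
  have z0: "z 0 = 0" by (simp add: z_def)
  have z1: "z (Suc 0) \<le> 0" using s by (simp add: z_def field_simps)
  have zS: "z (Suc N) = z N + real (Suc N) powr - s - (real (Suc N) powr (1 - s) - real N powr (1 - s)) / (1 - s)" for N
    by (simp add: z_def diff_divide_distrib)
  have dec: "z (Suc N) \<le> z N" for N
  proof (cases "N = 0")
    case False
    then show ?thesis using zS[of N] powr_diff_bounds(1)[OF s, of "real N" "real (Suc N)"] by simp
  qed (use z0 z1 in auto)
  have inc: "z N - real N powr - s \<le> z (Suc N) - real (Suc N) powr - s" if "N > 0" for N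
    using that zS[of N] powr_diff_bounds(2)[OF s, of "real N" "real (Suc N)"] by simp
  have "decseq z" using dec by (rule decseq_SucI)
  have inc': "z N - real N powr - s \<le> z (N + k)" if "N > 0" for N k
  proof -
    have "z N - real N powr - s \<le> z (N + k) - real (N + k) powr - s"
    proof (induction k)
      case (Suc k)
      show ?case using Suc inc[of "N + k"] that by simp
    qed simp
    moreover have "real (N + k) powr - s \<ge> 0" by simp
    ultimately show ?thesis by linarith
  qed
  have "z 1 - 1 \<le> z n" for n
    using inc'[of 1 "n - 1"] z0 z1 by (cases "n = 0") auto
  then obtain Z where Z: "z \<longlonglongrightarrow> Z" "\<And>i. Z \<le> z i"
    using decseq_convergent[OF \<open>decseq z\<close>] by metis
  have Zlow: "z N - real N powr - s \<le> Z" if "N > 0" for N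
  proof (rule LIMSEQ_le_const)
    show "(\<lambda>k. z (k + N)) \<longlonglongrightarrow> Z" by (rule LIMSEQ_ignore_initial_segment[OF Z(1)])
    show "\<exists>M. \<forall>k\<ge>M. z N - real N powr - s \<le> z (k + N)" using inc'[OF that] by (auto simp: add.commute)
  qed
  have main: "\<bar>psum s (\<lambda>_. 1) x - x powr (1 - s) / (1 - s) - Z\<bar> \<le> 4 * x powr - s" if x: "x \<ge> 1" for x
  proof -
    define N where "N = nat \<lfloor>x\<rfloor>"
    have N: "N > 0" "real N \<le> x" "x < real N + 1" using x by (auto simp: N_def)
    have "psum s (\<lambda>_. 1) x = z N + real N powr (1 - s) / (1 - s)" by (simp add: psum_def z_def N_def)
    moreover have "z N - real N powr - s \<le> Z" "Z \<le> z N" using Zlow N Z by auto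
    moreover have "0 \<le> real N powr - s * (x - real N)" "real N powr - s * (x - real N) \<le> real N powr - s"
      using N by (auto intro!: mult_left_le)
    moreover have "0 \<le> x powr - s * (x - real N)" using N by simp
    moreover note powr_diff_bounds[OF s, of "real N" x, unfolded diff_divide_distrib]
    ultimately have "\<bar>psum s (\<lambda>_. 1) x - x powr (1 - s) / (1 - s) - Z\<bar> \<le> real N powr - s"
      using N by linarith
    \<comment> \<open>N \<ge> x / 2 because N \<ge> 1 and x < N + 1; the resulting factor 2^s is at
      most 2, hence below 4.\<close>
    also have "\<dots> \<le> (x / 2) powr - s" using N s by (intro powr_neg_mono) auto
    also have "\<dots> = 2 powr s * x powr - s" using x by (simp add: powr_divide powr_minus field_simps)
    also have "\<dots> \<le> 4 * x powr - s"
      using powr_mono[of s 1 2] s by (intro mult_right_mono) auto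
    finally show ?thesis .
  qed
  have "Z \<le> 0" using Z(2)[of 0] z0 by simp
  then show "\<exists>Z\<le>0. \<forall>x\<ge>1. \<bar>psum s (\<lambda>_. 1) x - x powr (1 - s) / (1 - s) - Z\<bar> \<le> 4 * x powr - s"
    using main by blast
  show "psum s (\<lambda>_. 1) x \<le> x powr (1 - s) / (1 - s)" if "x > 0"
  proof -
    have "z (nat \<lfloor>x\<rfloor>) \<le> z 0" using \<open>decseq z\<close> by (simp add: decseq_def)
    then have "psum s (\<lambda>_. 1) x \<le> real (nat \<lfloor>x\<rfloor>) powr (1 - s) / (1 - s)" by (simp add: psum_def z_def)
    also have "\<dots> \<le> x powr (1 - s) / (1 - s)"
      using s that by (intro divide_right_mono powr_mono2) auto
    finally show ?thesis .
  qed
qed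

text \<open>The summatory function of \<open>a\<close> has the shape \<open>P x^(1-s) + Q\<close> (with \<open>P = 1/(1-s)\<close>,
  \<open>Q = \<zeta>(s)\<close> for \<open>a = 1\<close>, and \<open>P = 0\<close> for a character); the hyperbola is cut at \<open>y = sqrt x\<close>.\<close>
lemma psum_dconv_char:
  assumes rc: "real_char q \<chi>" and s: "s > 0" and a: "\<And>m. \<bar>a m\<bar> \<le> 1"
    and S: "\<And>x. x \<ge> 1 \<Longrightarrow> \<bar>psum s a x - P * x powr (1 - s) - Q\<bar> \<le> K * x powr - s"
    and W: "\<And>z. z \<ge> 1 \<Longrightarrow> psum s (\<lambda>_. 1) z \<le> w * z powr k" and k: "1 - s \<le> k" "0 \<le> k" and K: "K \<ge> 0"
    and x: "x \<ge> 1"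
  shows "\<bar>psum s (dconv a \<chi>) x - P * Lser 1 \<chi> * x powr (1 - s) - Q * Lser s \<chi>\<bar>
           \<le> ((\<bar>P\<bar> + \<bar>Q\<bar> + 2 * w) * real q + K) * x powr ((k - s) / 2)"
proof -
  note c = real_charD[OF rc]
  define y where "y = x powr (1/2)"
  have y: "y \<ge> 1" unfolding y_def using x by (intro ge_one_powr_ge_zero) auto
  have yx: "y * y = x" using x by (simp add: y_def powr_add[symmetric])
  have yp: "y powr t = x powr (t / 2)" for t by (simp add: y_def powr_powr)
  have xy: "x / y = y" using yx y by (simp add: field_simps)
  define E where "E = (\<lambda>x. psum s a x - P * x powr (1 - s) - Q)"
  \<comment> \<open>T is the largest of the error sizes: k \<ge> 1 - s puts x^(1/2 - s) below it and
    k \<ge> 0 puts x^(-s/2) below it.\<close>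
  define T where "T = x powr ((k - s) / 2)"
  have T: "x powr t \<le> T" if "t \<le> (k - s) / 2" for t
    unfolding T_def using x that by (intro powr_mono) auto
  define F where "F = (\<Sum>n=1..nat \<lfloor>y\<rfloor>. \<chi> n * real n powr - s * psum s a (x / real n))"
  define G where "G = (\<Sum>m=1..nat \<lfloor>y\<rfloor>. a m * real m powr - s * (psum s \<chi> (x / real m) - psum s \<chi> y))"
  have FG: "psum s (dconv a \<chi>) x = F + G"
    using psum_dconv[of y s a \<chi> x] y unfolding xy F_def G_def by simp
  have ny: "real n \<le> y" "1 \<le> real n" if "n \<in> {1..nat \<lfloor>y\<rfloor>}" for n
    using that le_nat_floor_iff[of n y] by auto
  have nx: "x / real n \<ge> y" if "n \<in> {1..nat \<lfloor>y\<rfloor>}" for n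
  proof -
    have "y * real n \<le> y * y" using ny[OF that] y by (intro mult_left_mono) auto
    then show ?thesis using ny[OF that] yx by (simp add: field_simps)
  qed
  define R where "R = (\<Sum>n=1..nat \<lfloor>y\<rfloor>. \<chi> n * real n powr - s * E (x / real n))"
  have "F = (\<Sum>n=1..nat \<lfloor>y\<rfloor>. P * x powr (1 - s) * (\<chi> n * real n powr - 1) + Q * (\<chi> n * real n powr - s)
      + \<chi> n * real n powr - s * E (x / real n))"
    unfolding F_def
  proof (rule sum.cong)
    fix n assume n: "n \<in> {1..nat \<lfloor>y\<rfloor>}"
    \<comment> \<open>This is how the value at 1 enters a computation at s: the main term of the
      inner sum leaves 1 / n behind.\<close>
    have "real n powr - s * (x / real n) powr (1 - s) = x powr (1 - s) * real n powr - 1"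
      using ny[OF n] x by (simp add: powr_divide powr_diff powr_minus field_simps)
    then show "\<chi> n * real n powr - s * psum s a (x / real n) = P * x powr (1 - s) * (\<chi> n * real n powr - 1) +
      Q * (\<chi> n * real n powr - s) + \<chi> n * real n powr - s * E (x / real n)"
      by (simp add: E_def algebra_simps)
  qed simp
  also have "\<dots> = P * x powr (1 - s) * psum 1 \<chi> y + Q * psum s \<chi> y + R"
    by (simp add: sum.distrib sum_distrib_left psum_def R_def)
  finally have F: "F = P * x powr (1 - s) * psum 1 \<chi> y + Q * psum s \<chi> y + R" .
  have "\<bar>R\<bar> \<le> (\<Sum>n=1..nat \<lfloor>y\<rfloor>. \<bar>\<chi> n * real n powr - s * E (x / real n)\<bar>)"
    unfolding R_def by (rule sum_abs)
  also have "\<dots> \<le> (\<Sum>n=1..nat \<lfloor>y\<rfloor>. K * x powr - s)"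
  proof (rule sum_mono)
    fix n assume n: "n \<in> {1..nat \<lfloor>y\<rfloor>}"
    have "\<bar>\<chi> n * real n powr - s * E (x / real n)\<bar> = \<bar>\<chi> n\<bar> * (real n powr - s * \<bar>E (x / real n)\<bar>)"
      by (simp add: abs_mult)
    also have "\<dots> \<le> 1 * (real n powr - s * (K * (x / real n) powr - s))"
      using c(7) S[of "x / real n"] nx[OF n] y unfolding E_def by (intro mult_mono) auto
    also have "\<dots> = K * x powr - s"
      using ny[OF n] x by (simp add: powr_divide powr_minus field_simps)
    finally show "\<bar>\<chi> n * real n powr - s * E (x / real n)\<bar> \<le> K * x powr - s" .
  qed
  also have "\<dots> \<le> y * (K * x powr - s)"
  proof -
    have "real (nat \<lfloor>y\<rfloor>) * (K * x powr - s) \<le> y * (K * x powr - s)"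
      using y K by (intro mult_right_mono) auto
    then show ?thesis by simp
  qed
  also have "\<dots> = K * (x powr (1/2) * x powr - s)" by (simp add: y_def)
  also have "\<dots> = K * x powr (1/2 - s)" by (simp only: powr_add[symmetric] add_uminus_conv_diff)
  also have "\<dots> \<le> K * T" using K k by (intro mult_left_mono T) auto
  finally have R: "\<bar>R\<bar> \<le> K * T" .
  have "\<bar>G\<bar> \<le> (\<Sum>m=1..nat \<lfloor>y\<rfloor>. \<bar>a m * real m powr - s * (psum s \<chi> (x / real m) - psum s \<chi> y)\<bar>)"
    unfolding G_def by (rule sum_abs)
  also have "\<dots> \<le> (\<Sum>m=1..nat \<lfloor>y\<rfloor>. 2 * real q * y powr - s * (1 * real m powr - s))"
  proof (rule sum_mono)
    fix n assume n: "n \<in> {1..nat \<lfloor>y\<rfloor>}"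
    \<comment> \<open>Both cutoffs x / n and y are at least y, so both partial sums are within q
      y^(-s) of the same value L(s,\<chi>).\<close>
    have "\<bar>psum s \<chi> (x / real n) - Lser s \<chi>\<bar> \<le> real q * (x / real n) powr - s"
      using nx[OF n] y by (intro Lser_approx rc s) auto
    also have "\<dots> \<le> real q * y powr - s"
      using nx[OF n] y s by (intro mult_left_mono powr_neg_mono) auto
    finally have 1: "\<bar>psum s \<chi> (x / real n) - Lser s \<chi>\<bar> \<le> real q * y powr - s" .
    have 2: "\<bar>psum s \<chi> y - Lser s \<chi>\<bar> \<le> real q * y powr - s"
      using y by (intro Lser_approx rc s) auto
    have "\<bar>a n * real n powr - s * (psum s \<chi> (x / real n) - psum s \<chi> y)\<bar> =
      \<bar>a n\<bar> * (real n powr - s * \<bar>psum s \<chi> (x / real n) - psum s \<chi> y\<bar>)" by (simp add: abs_mult)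
    also have "\<dots> \<le> 1 * (real n powr - s * (2 * real q * y powr - s))"
      using 1 2 a by (intro mult_mono) auto
    finally show "\<bar>a n * real n powr - s * (psum s \<chi> (x / real n) - psum s \<chi> y)\<bar> \<le>
      2 * real q * y powr - s * (1 * real n powr - s)" by (simp add: algebra_simps)
  qed
  also have "\<dots> = 2 * real q * y powr - s * psum s (\<lambda>_. 1) y"
    by (simp add: psum_def sum_distrib_left)
  also have "\<dots> \<le> 2 * real q * y powr - s * (w * y powr k)"
    using W[OF y] by (intro mult_left_mono) auto
  also have "\<dots> = 2 * w * real q * T"
  proof -
    have "T = y powr - s * y powr k"
      unfolding powr_add[symmetric] yp T_def by (simp add: diff_divide_distrib)
    then show ?thesis by simp
  qed
  finally have G: "\<bar>G\<bar> \<le> 2 * w * real q * T" .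
  have "\<bar>P * x powr (1 - s) * (psum 1 \<chi> y - Lser 1 \<chi>)\<bar> \<le> \<bar>P\<bar> * x powr (1 - s) * (real q * y powr - 1)"
    using mult_left_mono[OF Lser_approx[OF rc, of 1 y], of "\<bar>P\<bar> * x powr (1 - s)"] y by (simp add: abs_mult)
  also have "\<dots> = \<bar>P\<bar> * real q * x powr (1/2 - s)"
  proof -
    have "x powr (1 - s) * y powr - 1 = x powr (1/2 - s)"
      unfolding yp powr_add[symmetric] by simp
    then show ?thesis by (metis mult.assoc mult.left_commute)
  qed
  also have "\<dots> \<le> \<bar>P\<bar> * real q * T" using k by (intro mult_left_mono T) auto
  finally have e1: "\<bar>P * x powr (1 - s) * (psum 1 \<chi> y - Lser 1 \<chi>)\<bar> \<le> \<bar>P\<bar> * real q * T" .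
  have "\<bar>Q * (psum s \<chi> y - Lser s \<chi>)\<bar> \<le> \<bar>Q\<bar> * (real q * y powr - s)"
    using Lser_approx[OF rc s, of y] y by (simp add: abs_mult mult_left_mono)
  also have "\<dots> \<le> \<bar>Q\<bar> * (real q * T)" unfolding yp using k s by (intro mult_left_mono T) auto
  finally have e2: "\<bar>Q * (psum s \<chi> y - Lser s \<chi>)\<bar> \<le> \<bar>Q\<bar> * real q * T" by simp
  have "psum s (dconv a \<chi>) x - P * Lser 1 \<chi> * x powr (1 - s) - Q * Lser s \<chi> =
    P * x powr (1 - s) * (psum 1 \<chi> y - Lser 1 \<chi>) + Q * (psum s \<chi> y - Lser s \<chi>) + R + G"
    unfolding FG F by (simp add: algebra_simps)
  also have "\<bar>\<dots>\<bar> \<le> \<bar>P\<bar> * real q * T + \<bar>Q\<bar> * real q * T + K * T + 2 * w * real q * T"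
    using e1 e2 R G by linarith
  also have "\<dots> = ((\<bar>P\<bar> + \<bar>Q\<bar> + 2 * w) * real q + K) * T" by (simp add: algebra_simps)
  finally show ?thesis unfolding T_def .
qed

section \<open>Nonnegativity of convolutions\<close>

definition multiplicative :: "(nat \<Rightarrow> real) \<Rightarrow> bool" where
  "multiplicative f \<longleftrightarrow> f 1 = 1 \<and> (\<forall>m n. coprime m n \<longrightarrow> f (m * n) = f m * f n)"

text \<open>Recovers d and e from the divisor d e of m n; this inverts the map behind the
  multiplicativity of convolutions.\<close>

lemma gcd_mult_of_coprime_divisors:
  fixes m n :: nat
  assumes "coprime m n" "d dvd m" "e dvd n"
  shows "gcd (d * e) m = d" "gcd (d * e) n = e"
proof -
  from assms(2) obtain d' where d': "m = d * d'" by (rule dvdE)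
  from assms(3) obtain e' where e': "n = e * e'" by (rule dvdE)
  have "coprime e d'" "coprime d e'"
    using assms(1) d' e' by (auto simp: coprime_commute)
  then show "gcd (d * e) m = d" "gcd (d * e) n = e"
    using gcd_mult_distrib_nat[of d e d'] gcd_mult_distrib_nat[of e d e']
    by (simp_all add: d' e' mult.commute[of d e])
qed

text \<open>For coprime positive m and n, multiplication is a bijection from pairs of divisors of m
  and n to divisors of m n.\<close>

lemma multiplicative_dconv:
  assumes "multiplicative a" "multiplicative b"
  shows "multiplicative (dconv a b)"
proof -
  have "dconv a b (m * n) = dconv a b m * dconv a b n" if "coprime m n" for m n
  proof (cases "m = 0 \<or> n = 0")
    case True
    \<comment> \<open>A number coprime to 0 is 1, so this case is settled by the value at 1, away
      from the infinite divisor set of 0.\<close>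
    have "m = 1 \<and> n = 0 \<or> m = 0 \<and> n = 1" using True \<open>coprime m n\<close> by auto
    moreover have "dconv a b 1 = 1" using assms by (simp add: dconv_def multiplicative_def)
    ultimately show ?thesis by auto
  next
    case False
    then have pos: "m > 0" "n > 0" by auto
    have "dconv a b m * dconv a b n =
        (\<Sum>(d, e)\<in>{d. d dvd m} \<times> {e. e dvd n}. a d * b (m div d) * (a e * b (n div e)))"
      by (simp add: dconv_def sum_product sum.cartesian_product)
    also have "\<dots> = dconv a b (m * n)"
      unfolding dconv_def
    proof (rule sum.reindex_bij_witness[of _ "\<lambda>k. (gcd k m, gcd k n)" "\<lambda>(d, e). d * e"])
      fix z assume "z \<in> {d. d dvd m} \<times> {e. e dvd n}"
      then obtain d e where z: "z = (d, e)" "d dvd m" "e dvd n" by auto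
      from z(2) obtain d' where d': "m = d * d'" by (rule dvdE)
      from z(3) obtain e' where e': "n = e * e'" by (rule dvdE)
      note de = d' e'
      have cop: "coprime d e" "coprime d' e'"
        using \<open>coprime m n\<close> z de by (auto simp: coprime_commute)
      have "gcd (d * e) m = d" "gcd (d * e) n = e"
        using gcd_mult_of_coprime_divisors[OF \<open>coprime m n\<close>] z by auto
      then show "(gcd (case z of (d, e) \<Rightarrow> d * e) m, gcd (case z of (d, e) \<Rightarrow> d * e) n) = z" using z by simp
      show "(case z of (d, e) \<Rightarrow> d * e) \<in> {d. d dvd m * n}" using z by (auto intro: mult_dvd_mono)
      have "m * n div (d * e) = d' * e'" using pos by (simp add: de)
      then show "a (case z of (d, e) \<Rightarrow> d * e) * b (m * n div (case z of (d, e) \<Rightarrow> d * e)) =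
        (case z of (d, e) \<Rightarrow> a d * b (m div d) * (a e * b (n div e)))"
        using assms cop pos by (simp add: z multiplicative_def de)
    next
      fix k assume k: "k \<in> {d. d dvd m * n}"
      then obtain d e where "k = d * e" "d dvd m" "e dvd n" using division_decomp[of k m n] by auto
      then show "(case (gcd k m, gcd k n) of (d, e) \<Rightarrow> d * e) = k"
        using gcd_mult_of_coprime_divisors[OF \<open>coprime m n\<close>] by simp
    qed auto
    finally show ?thesis by simp
  qed
  moreover have "dconv a b 1 = 1" using assms by (simp add: dconv_def multiplicative_def)
  ultimately show ?thesis by (simp add: multiplicative_def)
qed

text \<open>At each step the full power of one prime is split off, so that the remaining cofactor is
  coprime to it and smaller.\<close>

lemma prime_power_coprime_induct [consumes 1, case_names one step]:
  fixes n :: nat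
  assumes "n > 0" and one: "P 1"
    and step: "\<And>p k m. prime p \<Longrightarrow> m > 0 \<Longrightarrow> coprime (p ^ k) m \<Longrightarrow> P m \<Longrightarrow> P (p ^ k * m)"
  shows "P n"
  using assms(1)
proof (induction n rule: less_induct)
  case (less n)
  show ?case
  proof (cases "n = 1")
    case False
    then obtain p where p: "prime p" "p dvd n" by (meson prime_factor_nat)
    have "p \<noteq> Suc 0" using p(1) by auto
    with less.prems p obtain m where m: "n = p ^ multiplicity p n * m" "\<not> p dvd m"
      using multiplicity_decompose'[of n p] by auto
    have "multiplicity p n > 0" using p less.prems by (simp add: prime_multiplicity_gt_zero_iff)
    then have "p ^ multiplicity p n > 1" using p prime_gt_1_nat one_less_power by blast
    moreover have "m > 0" using m less.prems by (intro Nat.gr0I) auto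
    ultimately have "m < n" by (subst m(1)) simp
    have "coprime (p ^ multiplicity p n) m" using p m by (simp add: prime_imp_coprime)
    then show ?thesis using step[OF p(1) \<open>m > 0\<close>] less.IH[OF \<open>m < n\<close> \<open>m > 0\<close>] m(1) by metis
  qed (use one in simp)
qed

lemma multiplicative_nonneg:
  assumes "multiplicative f" "\<And>p k. prime p \<Longrightarrow> f (p ^ k) \<ge> 0" "n > 0"
  shows "f n \<ge> 0"
  using assms(3)
proof (induction n rule: prime_power_coprime_induct)
  case one then show ?case using assms(1) by (simp add: multiplicative_def)
next
  case (step p k m) then show ?case using assms(1,2) by (simp add: multiplicative_def)
qed

lemma multiplicative_square_ge_one:
  assumes "multiplicative f" "\<And>p k. prime p \<Longrightarrow> f (p ^ (2 * k)) \<ge> 1" "n > 0"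
  shows "f (n ^ 2) \<ge> 1"
  using assms(3)
proof (induction n rule: prime_power_coprime_induct)
  case one then show ?case using assms(1) by (simp add: multiplicative_def)
next
  case (step p k m)
  have "f ((p ^ k * m) ^ 2) = f (p ^ (2 * k)) * f (m ^ 2)"
  proof -
    have "coprime ((p ^ k) ^ 2) (m ^ 2)" using step(3) by simp
    then have "f ((p ^ k) ^ 2 * m ^ 2) = f ((p ^ k) ^ 2) * f (m ^ 2)"
      using assms(1) unfolding multiplicative_def by blast
    then show ?thesis by (simp add: power_mult_distrib power_mult[symmetric] mult.commute)
  qed
  moreover have "1 * 1 \<le> f (p ^ (2 * k)) * f (m ^ 2)"
    using assms(2)[OF step(1), of k] step(4) by (intro mult_mono) auto
  ultimately show ?case by simp
qed

section \<open>Local factors at prime powers\<close>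

lemma dconv_prime_power:
  assumes "prime p"
  shows "dconv a b (p ^ k) = (\<Sum>i\<le>k. a (p ^ i) * b (p ^ (k - i)))"
proof -
  have "{d. d dvd p ^ k} = (\<lambda>i. p ^ i) ` {..k}"
    using divides_primepow_nat[OF assms] by auto
  moreover have "inj_on (\<lambda>i. p ^ i) {..k}"
    using prime_gt_1_nat[OF assms] by (auto intro!: inj_onI simp: power_inject_exp)
  ultimately have "dconv a b (p ^ k) = (\<Sum>i\<le>k. a (p ^ i) * b (p ^ k div p ^ i))"
    by (simp add: dconv_def sum.reindex)
  also have "\<dots> = (\<Sum>i\<le>k. a (p ^ i) * b (p ^ (k - i)))"
    using prime_gt_0_nat[OF assms] by (intro sum.cong) (auto simp: power_diff)
  finally show ?thesis .
qed

lemma real_char_power: "real_char q \<chi> \<Longrightarrow> \<chi> (n ^ k) = \<chi> n ^ k"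
  by (induction k) (auto simp: real_charD)

lemma real_char_multiplicative: "real_char q \<chi> \<Longrightarrow> multiplicative \<chi>"
  by (simp add: multiplicative_def real_charD)

lemma multiplicative_dconv_one_char: "real_char q \<chi> \<Longrightarrow> multiplicative (dconv (\<lambda>_. 1) \<chi>)"
  using multiplicative_dconv[of "\<lambda>_. 1" \<chi>] real_char_multiplicative[of q \<chi>]
  by (simp add: multiplicative_def)

lemma dconv_one_char_prime_power:
  assumes "real_char q \<chi>" "prime p"
  shows "dconv (\<lambda>_. 1) \<chi> (p ^ k) = (\<Sum>i\<le>k. \<chi> p ^ i)"
proof -
  have "dconv (\<lambda>_. 1) \<chi> (p ^ k) = (\<Sum>i\<le>k. \<chi> p ^ (k - i))"
    by (simp add: dconv_prime_power[OF assms(2)] real_char_power[OF assms(1)])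
  also have "\<dots> = (\<Sum>i\<le>k. \<chi> p ^ i)"
    by (rule sum.reindex_bij_witness[of _ "\<lambda>i. k - i" "\<lambda>i. k - i"]) auto
  finally show ?thesis .
qed

lemma sum_minus_one_power: "(\<Sum>i\<le>k. (-1::real) ^ i) = (if even k then 1 else 0)"
  by (induction k) auto

text \<open>For c = 1, 0, -1 the sum is k + 1, or 1 (as 0^0 = 1), or alternately 1 and 0.\<close>

lemma sum_sign_power:
  fixes c :: real assumes "c \<in> {-1, 0, 1}"
  shows "(\<Sum>i\<le>k. c ^ i) \<ge> 0" "even k \<Longrightarrow> (\<Sum>i\<le>k. c ^ i) \<ge> 1"
proof -
  have "(\<Sum>i\<le>k. (0::real) ^ i) = 1" by (induction k) auto
  then show "(\<Sum>i\<le>k. c ^ i) \<ge> 0" "even k \<Longrightarrow> (\<Sum>i\<le>k. c ^ i) \<ge> 1"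
    using assms by (auto simp: sum_minus_one_power)
qed

lemma dconv_one_char_nonneg:
  assumes "real_char q \<chi>" "n > 0"
  shows "dconv (\<lambda>_. 1) \<chi> n \<ge> 0"
  using assms multiplicative_nonneg[OF multiplicative_dconv_one_char[OF assms(1)]]
    sum_sign_power(1) real_charD(4)[OF assms(1)] dconv_one_char_prime_power[OF assms(1)] by metis

lemma dconv_one_char_square_ge_one:
  assumes "real_char q \<chi>" "n > 0"
  shows "dconv (\<lambda>_. 1) \<chi> (n ^ 2) \<ge> 1"
  using assms multiplicative_square_ge_one[OF multiplicative_dconv_one_char[OF assms(1)]]
    sum_sign_power(2) real_charD(4)[OF assms(1)] dconv_one_char_prime_power[OF assms(1)] by (metis dvd_triv_left)

text \<open>This is the coefficient of X^k in 1/((1-X)^2 (1+X)^2) = 1/(1-X^2)^2, which is k/2 + 1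
  for even k and 0 for odd k.\<close>

lemma alternating_linear_conv_nonneg:
  "(\<Sum>i\<le>k. (real i + 1) * ((-1) ^ (k - i) * (real (k - i) + 1))) \<ge> 0"
proof -
  define t where "t = (\<lambda>k. \<Sum>i\<le>k. (-1) ^ i * (real i + 1))"
  have t: "t k = (if even k then real k / 2 + 1 else - (real k + 1) / 2)" for k
    by (induction k) (auto simp: t_def field_simps)
  define s where "s = (\<lambda>k. \<Sum>i\<le>k. (-1) ^ i * (real i + 1) * (real k - real i + 1))"
  have "s (Suc k) = s k + t (Suc k)" for k
    by (simp add: s_def t_def sum.distrib[symmetric] algebra_simps)
  then have s: "s k = (if even k then real k / 2 + 1 else 0)" for k
    by (induction k) (auto simp: t field_simps s_def)
  have "(\<Sum>i\<le>k. (real i + 1) * ((-1) ^ (k - i) * (real (k - i) + 1))) = s k"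
    unfolding s_def by (rule sum.reindex_bij_witness[of _ "\<lambda>i. k - i" "\<lambda>i. k - i"]) (auto simp: of_nat_diff)
  then show ?thesis by (simp add: s)
qed

text \<open>With b = \<psi>(p) and c = \<chi>(p), the sum is the coefficient of X^k in the local
  factor 1/((1-X)(1-cX)(1-bX)(1-bcX)). Signs matter only for b = -1: if c = -1 then G vanishes at
  odd indices, c = 0 gives 1/(1-X^2), and c = 1 gives 1/(1-X^2)^2.\<close>

lemma sign_conv_nonneg:
  fixes b c :: real
  assumes "b \<in> {-1, 0, 1}" "c \<in> {-1, 0, 1}"
  defines "G \<equiv> \<lambda>k. \<Sum>i\<le>k. c ^ i"
  shows "(\<Sum>i\<le>k. G i * (b ^ (k - i) * G (k - i))) \<ge> 0"
proof -
  have G: "G i \<ge> 0" for i unfolding G_def by (rule sum_sign_power(1)[OF assms(2)])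
  consider "b \<ge> 0" | "b = -1" "c = -1" | "b = -1" "c = 0" | "b = -1" "c = 1" using assms by auto
  then show ?thesis
  proof cases
    case 1
    then show ?thesis using G by (intro sum_nonneg mult_nonneg_nonneg zero_le_power)
  next
    case 2
    then have "b ^ j * G j \<ge> 0" for j by (simp add: G_def sum_minus_one_power)
    then show ?thesis by (intro sum_nonneg mult_nonneg_nonneg[OF G])
  next
    case 3
    have "G j = 1" for j unfolding G_def 3 by (induction j) auto
    then have "(\<Sum>i\<le>k. G i * (b ^ (k - i) * G (k - i))) = (\<Sum>i\<le>k. (-1) ^ (k - i))" using 3 by simp
    also have "\<dots> = (\<Sum>i\<le>k. (-1) ^ i)"
      by (rule sum.reindex_bij_witness[of _ "\<lambda>i. k - i" "\<lambda>i. k - i"]) auto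
    finally show ?thesis by (simp add: sum_minus_one_power)
  next
    case 4
    then show ?thesis using alternating_linear_conv_nonneg[of k] by (simp add: G_def add.commute)
  qed
qed

text \<open>A completely multiplicative \<psi> factors out of the sum, so L(s,\<psi>)
  L(s,\<chi>\<psi>) has the coefficients of \<zeta>(s) L(s,\<chi>) twisted by \<psi>.\<close>

lemma dconv_twisted:
  assumes "real_char q \<psi>"
  shows "dconv \<psi> (\<lambda>n. \<chi> n * \<psi> n) n = \<psi> n * dconv (\<lambda>_. 1) \<chi> n"
  unfolding dconv_def sum_distrib_left
proof (rule sum.cong)
  fix d assume "d \<in> {d. d dvd n}"
  then have "\<psi> n = \<psi> d * \<psi> (n div d)" using real_charD(3)[OF assms, of d "n div d"] by simp
  then show "\<psi> d * (\<chi> (n div d) * \<psi> (n div d)) = \<psi> n * (1 * \<chi> (n div d))" by simp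
qed simp

text \<open>The coefficients of \<open>\<zeta>(s) L(s,\<chi>) L(s,\<psi>) L(s,\<chi>\<psi>)\<close>.\<close>
lemma dconv_four_nonneg:
  assumes "real_char q \<chi>" "real_char q' \<psi>" "n > 0"
  shows "dconv (dconv (\<lambda>_. 1) \<chi>) (dconv \<psi> (\<lambda>n. \<chi> n * \<psi> n)) n \<ge> 0"
proof (rule multiplicative_nonneg[OF _ _ assms(3)])
  have "multiplicative (\<lambda>n. \<chi> n * \<psi> n)"
    using assms by (simp add: multiplicative_def real_charD)
  then show "multiplicative (dconv (dconv (\<lambda>_. 1) \<chi>) (dconv \<psi> (\<lambda>n. \<chi> n * \<psi> n)))"
    using multiplicative_dconv[OF multiplicative_dconv_one_char[OF assms(1)]
      multiplicative_dconv[OF real_char_multiplicative[OF assms(2)]]] by simp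
  fix p k :: nat assume p: "prime p"
  have "dconv (dconv (\<lambda>_. 1) \<chi>) (dconv \<psi> (\<lambda>n. \<chi> n * \<psi> n)) (p ^ k) =
    (\<Sum>i\<le>k. (\<Sum>j\<le>i. \<chi> p ^ j) * (\<psi> p ^ (k - i) * (\<Sum>j\<le>k - i. \<chi> p ^ j)))"
    by (simp only: dconv_prime_power[OF p, of "dconv (\<lambda>_. 1) \<chi>" "dconv \<psi> (\<lambda>n. \<chi> n * \<psi> n)"] dconv_twisted[OF assms(2)] dconv_one_char_prime_power[OF assms(1) p]
       real_char_power[OF assms(2)])
  also have "\<dots> \<ge> 0"
    by (rule sign_conv_nonneg[OF real_charD(4)[OF assms(2)] real_charD(4)[OF assms(1)]])
  finally show "dconv (dconv (\<lambda>_. 1) \<chi>) (dconv \<psi> (\<lambda>n. \<chi> n * \<psi> n)) (p ^ k) \<ge> 0" .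
qed

section \<open>Siegel's theorem\<close>

lemma psum_ge_one:
  assumes "\<And>n. n > 0 \<Longrightarrow> f n \<ge> 0" "f 1 = 1" "x \<ge> 1"
  shows "psum s f x \<ge> 1"
proof -
  have "1 \<in> {1..nat \<lfloor>x\<rfloor>}" using assms(3) le_nat_floor_iff[of 1 x] by auto
  then have "f 1 * real 1 powr - s \<le> psum s f x"
    unfolding psum_def using assms(1) by (intro member_le_sum) auto
  then show ?thesis using assms(2) by simp
qed

text \<open>\<open>psum_dconv_char\<close> with a = 1, P = w = 1/(1-s), Q = Z and k = 1 - s, which
  is the source of 3/(1-s) and of the exponent 1/2 - s.\<close>

lemma psum_dconv_one_char:
  assumes rc: "real_char q \<chi>" and s: "0 < s" "s < 1" and x: "x \<ge> 1"
    and Z: "\<And>x. x \<ge> 1 \<Longrightarrow> \<bar>psum s (\<lambda>_. 1) x - x powr (1 - s) / (1 - s) - Z\<bar> \<le> 4 * x powr - s"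
  shows "\<bar>psum s (dconv (\<lambda>_. 1) \<chi>) x - Lser 1 \<chi> / (1 - s) * x powr (1 - s) - Z * Lser s \<chi>\<bar>
           \<le> (3 / (1 - s) + \<bar>Z\<bar> + 4) * real q * x powr (1/2 - s)"
proof -
  have "\<bar>psum s (dconv (\<lambda>_. 1) \<chi>) x - 1 / (1 - s) * Lser 1 \<chi> * x powr (1 - s) - Z * Lser s \<chi>\<bar>
      \<le> ((\<bar>1 / (1 - s)\<bar> + \<bar>Z\<bar> + 2 * (1 / (1 - s))) * real q + 4) * x powr ((1 - s - s) / 2)"
    using psum_one_asymp(2)[OF s] Z s x by (intro psum_dconv_char rc) auto
  also have "\<dots> \<le> (3 / (1 - s) + \<bar>Z\<bar> + 4) * real q * x powr (1/2 - s)"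
  proof (rule mult_mono)
    have "((\<bar>1 / (1 - s)\<bar> + \<bar>Z\<bar> + 2 * (1 / (1 - s))) * real q + 4) = (3 / (1 - s) + \<bar>Z\<bar>) * real q + 4 * 1"
      using s by (simp add: algebra_simps)
    also have "\<dots> \<le> (3 / (1 - s) + \<bar>Z\<bar>) * real q + 4 * real q"
      using real_charD(1)[OF rc] by simp
    also have "\<dots> = (3 / (1 - s) + \<bar>Z\<bar> + 4) * real q" by (simp add: algebra_simps)
    finally show "((\<bar>1 / (1 - s)\<bar> + \<bar>Z\<bar> + 2 * (1 / (1 - s))) * real q + 4) \<le> (3 / (1 - s) + \<bar>Z\<bar> + 4) * real q" .
  qed (use s in \<open>auto simp: diff_divide_distrib\<close>)
  finally show ?thesis by simp
qed

lemma dconv_one: "dconv a b (Suc 0) = a 1 * b 1"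
  by (simp add: dconv_def)

text \<open>At \<open>s = 1/2\<close> the partial sums of \<open>1 * \<chi>\<close> are unbounded, because every square contributes,
  whereas \<open>L(1,\<chi>) \<le> 0\<close> would bound them.\<close>
lemma Lser_one_pos:
  assumes rc: "real_char q \<chi>"
  shows "Lser 1 \<chi> > 0"
proof (rule ccontr)
  assume "\<not> Lser 1 \<chi> > 0"
  then have L: "Lser 1 \<chi> \<le> 0" by simp
  define f where "f = dconv (\<lambda>_. 1) \<chi>"
  obtain Z where Z: "\<And>x. x \<ge> 1 \<Longrightarrow> \<bar>psum (1/2) (\<lambda>_. 1) x - x powr (1 - 1/2) / (1 - 1/2) - Z\<bar> \<le> 4 * x powr - (1/2)"
    using psum_one_asymp(1)[of "1/2"] by auto
  define B where "B = (3 / (1 - 1/2) + \<bar>Z\<bar> + 4) * real q + \<bar>Z * Lser (1/2) \<chi>\<bar>"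
  have up: "psum (1/2) f x \<le> B" if "x \<ge> 1" for x
  proof -
    \<comment> \<open>At s = 1/2 the error exponent 1/2 - s is 0, so the error stays
      bounded.\<close>
    have "\<bar>psum (1/2) f x - Lser 1 \<chi> / (1 - 1/2) * x powr (1 - 1/2) - Z * Lser (1/2) \<chi>\<bar>
           \<le> (3 / (1 - 1/2) + \<bar>Z\<bar> + 4) * real q * x powr (1/2 - 1/2)"
      unfolding f_def by (rule psum_dconv_one_char[OF rc _ _ that Z]) auto
    moreover have "Lser 1 \<chi> / (1 - 1/2) * x powr (1 - 1/2) \<le> 0"
      using L by (intro mult_nonpos_nonneg) auto
    ultimately show ?thesis using that unfolding B_def by auto
  qed
  \<comment> \<open>The square m^2 has coefficient at least 1 and weight (m^2)^(-1/2) = 1/m, so the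
    squares alone contribute a harmonic sum.\<close>
  have low: "harm N \<le> psum (1/2) f (real (N ^ 2))" for N :: nat
  proof -
    have inj: "inj_on (\<lambda>m::nat. m ^ 2) {1..N}" by (auto intro!: inj_onI)
    have "harm N = (\<Sum>m=1..N. inverse (real m))" by (simp add: harm_def)
    also have "\<dots> \<le> (\<Sum>m=1..N. f (m ^ 2) * real (m ^ 2) powr - (1/2))"
    proof (rule sum_mono)
      fix m assume m: "m \<in> {1..N}"
      have "real (m ^ 2) powr - (1/2) = inverse (real m)"
        using m by (simp add: powr_minus powr_half_sqrt)
      then show "inverse (real m) \<le> f (m ^ 2) * real (m ^ 2) powr - (1/2)"
        using dconv_one_char_square_ge_one[OF rc, of m] m unfolding f_def
        by (simp add: mult_left_le_one_le divide_right_mono inverse_eq_divide)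
    qed
    also have "\<dots> = (\<Sum>n\<in>(\<lambda>m. m ^ 2) ` {1..N}. f n * real n powr - (1/2))"
      using inj by (simp add: sum.reindex)
    also have "\<dots> \<le> psum (1/2) f (real (N ^ 2))"
      unfolding psum_def
    proof (rule sum_mono2)
      show "(\<lambda>m. m ^ 2) ` {1..N} \<subseteq> {1..nat \<lfloor>real (N ^ 2)\<rfloor>}"
      proof -
        have "nat \<lfloor>real (N ^ 2)\<rfloor> = N ^ 2" by (metis floor_of_nat nat_int)
        then show ?thesis by (auto simp: power_mono)
      qed
      show "0 \<le> f b * real b powr - (1/2)" if "b \<in> {1..nat \<lfloor>real (N ^ 2)\<rfloor>} - (\<lambda>m. m ^ 2) ` {1..N}" for b
        using that dconv_one_char_nonneg[OF rc, of b] by (auto simp: f_def)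
    qed simp
    finally show ?thesis .
  qed
  obtain N :: nat where "N > 0" "ln (real N) > B"
  proof -
    have "eventually (\<lambda>n. ln (real n) > B) sequentially"
      using filterlim_compose[OF ln_at_top filterlim_real_sequentially] by (simp add: filterlim_at_top_dense)
    moreover have "eventually (\<lambda>n::nat. n > 0) sequentially" by (rule eventually_gt_at_top)
    ultimately have "eventually (\<lambda>n. n > 0 \<and> ln (real n) > B) sequentially" by eventually_elim auto
    then show ?thesis using that by (auto simp: eventually_sequentially)
  qed
  moreover have "ln (real N) \<le> ln (real N + 1)" using \<open>N > 0\<close> by simp
  moreover have "ln (real N + 1) \<le> harm N" by (rule ln_le_harm)
  moreover have "real (N ^ 2) \<ge> 1" using \<open>N > 0\<close> by (simp add: one_le_power)
  ultimately show False using low[of N] up[of "real (N ^ 2)"] by linarith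
qed

text \<open>Since Z = \<zeta>(s) \<le> 0, the hypothesis L(s,\<chi>) \<ge> 0 makes the constant term
  nonpositive. The partial sum is at least its first coefficient 1, so once the error is down to
  1/2, the term with L(1,\<chi>) has to supply the other half.\<close>

lemma Lser_one_lower_of_nonneg:
  assumes s: "3/4 \<le> s" "s < 1"
  shows "\<exists>c>0. \<forall>q \<chi>. real_char q \<chi> \<longrightarrow> Lser s \<chi> \<ge> 0 \<longrightarrow> Lser 1 \<chi> \<ge> c * real q powr - (4 * (1 - s))"
proof -
  obtain Z where Z: "Z \<le> 0" "\<And>x. x \<ge> 1 \<Longrightarrow> \<bar>psum s (\<lambda>_. 1) x - x powr (1 - s) / (1 - s) - Z\<bar> \<le> 4 * x powr - s"
    using psum_one_asymp(1)[of s] s by auto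
  define E where "E = 3 / (1 - s) + \<bar>Z\<bar> + 4"
  have E: "E \<ge> 4" using s by (simp add: E_def)
  define c where "c = (1 - s) / 2 * (2 * E) powr - (4 * (1 - s))"
  have "c > 0" using s E by (simp add: c_def)
  moreover have "Lser 1 \<chi> \<ge> c * real q powr - (4 * (1 - s))" if rc: "real_char q \<chi>" and L: "Lser s \<chi> \<ge> 0" for q \<chi>
  proof -
    have q: "real q \<ge> 1" using real_charD(1)[OF rc] by simp
    \<comment> \<open>Chosen so that E q / t = 1/2: with x = t^4 this bounds the error, as E q
      x^(-1/4) = E q / t, and x^(-(1-s)) produces the exponent 4 (1-s).\<close>
    define t where "t = 2 * E * real q"
    have t: "t \<ge> 1" using mult_mono[of 1 "2 * E" 1 "real q"] E q by (simp add: t_def)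
    define x where "x = t powr 4"
    have x: "x \<ge> 1" unfolding x_def using t by (intro ge_one_powr_ge_zero) auto
    have "1 \<le> psum s (dconv (\<lambda>_. 1) \<chi>) x"
      using x dconv_one_char_nonneg[OF rc] real_charD(2)[OF rc] by (intro psum_ge_one) (auto simp: dconv_one)
    also have "\<dots> \<le> Lser 1 \<chi> / (1 - s) * x powr (1 - s) + Z * Lser s \<chi> + E * real q * x powr (1/2 - s)"
      using psum_dconv_one_char[OF rc _ s(2) x Z(2)] s unfolding E_def by linarith
    also have "\<dots> \<le> Lser 1 \<chi> / (1 - s) * x powr (1 - s) + 0 + E * real q * x powr (-1/4)"
      using Z(1) L x s E by (intro add_mono mult_left_mono powr_mono order_refl mult_nonpos_nonneg) auto
    also have "x powr (-1/4) = t powr -1" unfolding x_def powr_powr by simp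
    also have "\<dots> = 1 / t" using t by (simp add: powr_minus_divide)
    also have "E * real q * (1 / t) = 1/2" using E q by (simp add: t_def)
    finally have "1/2 \<le> Lser 1 \<chi> / (1 - s) * x powr (1 - s)" by linarith
    then have "(1 - s) / 2 \<le> Lser 1 \<chi> * x powr (1 - s)" using s by (simp add: field_simps)
    then have "(1 - s) / 2 * x powr - (1 - s) \<le> Lser 1 \<chi> * x powr (1 - s) * x powr - (1 - s)"
      by (intro mult_right_mono) auto
    also have "\<dots> = Lser 1 \<chi>" using x by (simp add: mult.assoc powr_add[symmetric])
    also have "x powr - (1 - s) = (2 * E) powr - (4 * (1 - s)) * real q powr - (4 * (1 - s))"
    proof -
      have "x powr - (1 - s) = t powr - (4 * (1 - s))" unfolding x_def powr_powr by simp
      also have "\<dots> = (2 * E) powr - (4 * (1 - s)) * real q powr - (4 * (1 - s))"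
        unfolding t_def by (rule powr_mult)
      finally show ?thesis .
    qed
    finally show ?thesis by (simp add: c_def mult.assoc)
  qed
  ultimately show ?thesis by blast
qed

text \<open>Cut at n = q: the tail is at most q / q = 1, and in the head 1/n is enlarged to
  n^(-(1-\<eta>)), trading the usual log q for q^\<eta> / \<eta>. It serves to divide out the
  L-value of a product of two characters.\<close>

lemma Lser_one_upper:
  assumes "0 < \<eta>" "\<eta> < 1" "real_char q \<chi>"
  shows "Lser 1 \<chi> \<le> (1 / \<eta> + 1) * real q powr \<eta>"
proof -
  have q: "real q \<ge> 1" using real_charD(1)[OF assms(3)] by simp
  have "psum 1 \<chi> (real q) \<le> psum (1 - \<eta>) (\<lambda>_. 1) (real q)"
    unfolding psum_def
  proof (rule sum_mono)
    fix n assume n: "n \<in> {1..nat \<lfloor>real q\<rfloor>}"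
    have "\<chi> n * real n powr - 1 \<le> 1 * real n powr - (1 - \<eta>)"
      using real_charD(7)[OF assms(3), of n] n assms by (intro mult_mono powr_mono) auto
    then show "\<chi> n * real n powr - 1 \<le> 1 * real n powr - (1 - \<eta>)" .
  qed
  also have "\<dots> \<le> real q powr \<eta> / \<eta>"
    using psum_one_asymp(2)[of "1 - \<eta>" "real q"] assms q by simp
  finally have "psum 1 \<chi> (real q) \<le> real q powr \<eta> / \<eta>" .
  moreover have "\<bar>psum 1 \<chi> (real q) - Lser 1 \<chi>\<bar> \<le> real q * real q powr - 1"
    using q by (intro Lser_approx assms) auto
  moreover have "real q * real q powr - 1 = 1" using q by (simp add: powr_minus_divide)
  moreover have "1 \<le> real q powr \<eta>" using q assms by (intro ge_one_powr_ge_zero) auto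
  ultimately have "Lser 1 \<chi> \<le> real q powr \<eta> / \<eta> + real q powr \<eta>" by linarith
  then show ?thesis by (simp add: algebra_simps)
qed

text \<open>\<open>psum_dconv_char\<close> with P = 0 and Q = L(s,\<chi>). Taking k = 1/4 and w = 4
  from the zeta sum at 3/4 avoids the factor 1/(1-s), so the bound also holds at s = 1, where it is
  used as well as at \<beta>. The constant is 1 + 8 + 1, with |L(s,\<chi>)| \<le> q.\<close>

lemma psum_dconv_two_chars:
  assumes rc: "real_char q \<chi>" "real_char q' \<psi>" and s: "3/4 \<le> s" and x: "x \<ge> 1"
  shows "\<bar>psum s (dconv \<chi> \<psi>) x - Lser s \<chi> * Lser s \<psi>\<bar> \<le> 10 * real q * real q' * x powr (-1/4)"
proof -
  have q: "real q \<ge> 1" "real q' \<ge> 1" using real_charD(1)[OF rc(1)] real_charD(1)[OF rc(2)] by auto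
  have "\<bar>psum s (dconv \<chi> \<psi>) x - 0 * Lser 1 \<psi> * x powr (1 - s) - Lser s \<chi> * Lser s \<psi>\<bar>
      \<le> ((\<bar>0\<bar> + \<bar>Lser s \<chi>\<bar> + 2 * 4) * real q' + real q) * x powr ((1/4 - s) / 2)"
  proof (rule psum_dconv_char[OF rc(2)])
    fix z :: real assume z: "z \<ge> 1"
    have "psum s (\<lambda>_. 1) z \<le> psum (3/4) (\<lambda>_. 1) z"
      unfolding psum_def using s by (intro sum_mono mult_left_mono powr_mono) auto
    also have "\<dots> \<le> 4 * z powr (1/4)" using psum_one_asymp(2)[of "3/4" z] z by simp
    finally show "psum s (\<lambda>_. 1) z \<le> 4 * z powr (1/4)" .
    show "\<bar>psum s \<chi> z - 0 * z powr (1 - s) - Lser s \<chi>\<bar> \<le> real q * z powr - s"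
      using Lser_approx[OF rc(1), of s z] s z by simp
  qed (use real_charD(7)[OF rc(1)] s x in auto)
  also have "\<dots> \<le> (10 * real q * real q') * x powr (-1/4)"
  proof (rule mult_mono)
    have "(\<bar>0\<bar> + \<bar>Lser s \<chi>\<bar> + 2 * 4) * real q' + real q \<le> (real q + 8 * real q) * real q' + real q * real q'"
      using Lser_abs_le[OF rc(1), of s] s q mult_left_mono[of 1 "real q'" "real q"]
      by (intro add_mono mult_right_mono) auto
    then show "(\<bar>0\<bar> + \<bar>Lser s \<chi>\<bar> + 2 * 4) * real q' + real q \<le> 10 * real q * real q'"
      by (simp add: algebra_simps)
    show "x powr ((1/4 - s) / 2) \<le> x powr (-1/4)" using s x by (intro powr_mono) auto
  qed (use q in auto)
  finally show ?thesis by simp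
qed

text \<open>The trivial divisor count; affordable because it is applied only to n up to
  x^(1/16).\<close>

lemma dconv_chars_abs_le:
  assumes "real_char q \<chi>" "real_char q' \<psi>" "n > 0"
  shows "\<bar>dconv \<chi> \<psi> n\<bar> \<le> real n"
proof -
  have "\<bar>dconv \<chi> \<psi> n\<bar> \<le> (\<Sum>d | d dvd n. \<bar>\<chi> d * \<psi> (n div d)\<bar>)"
    unfolding dconv_def by (rule sum_abs)
  also have "\<dots> \<le> (\<Sum>d | d dvd n. 1)"
    using real_charD(7)[OF assms(1)] real_charD(7)[OF assms(2)]
    by (intro sum_mono) (auto simp: abs_mult intro!: mult_le_one)
  also have "\<dots> = real (card {d. d dvd n})" by simp
  also have "\<dots> \<le> real (card {1..n})"
    using assms(3) by (intro of_nat_mono card_mono) (auto dest: dvd_imp_le intro: Nat.gr0I)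
  finally show ?thesis by simp
qed


text \<open>With \<open>L(\<beta>,\<chi>) = 0\<close> the summatory function of \<open>f = 1 * \<chi>\<close> at \<open>\<beta>\<close> has no constant term, so that
  of \<open>f * (\<psi> * \<chi>\<psi>)\<close> has main term \<open>D x^(1-\<beta>) L(1,\<psi>) L(1,\<chi>\<psi>)\<close>, while it is at least 1. The
  hyperbola is cut at \<open>y = x^(1/16)\<close>, and \<open>x\<close> is a power of \<open>q'\<close> large enough to absorb the error.\<close>
lemma Lser_one_product_lower:
  assumes rc: "real_char q \<chi>" and \<beta>: "127/128 \<le> \<beta>" "\<beta> < 1" and zero: "Lser \<beta> \<chi> = 0"
  shows "\<exists>c>0. \<forall>q' \<psi>. real_char q' \<psi> \<longrightarrow> real_char (q * q') (\<lambda>n. \<chi> n * \<psi> n) \<longrightarrow>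
           Lser 1 \<psi> * Lser 1 (\<lambda>n. \<chi> n * \<psi> n) \<ge> c * real q' powr - (256 * (1 - \<beta>))"
proof -
  obtain Z where Z: "\<And>x. x \<ge> 1 \<Longrightarrow> \<bar>psum \<beta> (\<lambda>_. 1) x - x powr (1 - \<beta>) / (1 - \<beta>) - Z\<bar> \<le> 4 * x powr - \<beta>"
    using psum_one_asymp(1)[of \<beta>] \<beta> by auto
  define f where "f = dconv (\<lambda>_. 1) \<chi>"
  define D where "D = Lser 1 \<chi> / (1 - \<beta>)"
  define K where "K = (3 / (1 - \<beta>) + \<bar>Z\<bar> + 4) * real q"
  have D: "D > 0" using Lser_one_pos[OF rc] \<beta> by (simp add: D_def)
  have K: "K \<ge> 0" using \<beta> by (simp add: K_def)
  have q: "real q \<ge> 1" using real_charD(1)[OF rc] by simp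
  have f0: "f n \<ge> 0" if "n > 0" for n using dconv_one_char_nonneg[OF rc that] by (simp add: f_def)
  have Sf: "\<bar>psum \<beta> f x - D * x powr (1 - \<beta>)\<bar> \<le> K * x powr (-1/4)" if x: "x \<ge> 1" for x
  proof -
    have "\<bar>psum \<beta> f x - D * x powr (1 - \<beta>)\<bar> \<le> K * x powr (1/2 - \<beta>)"
      using psum_dconv_one_char[OF rc _ \<beta>(2) x Z] \<beta> zero by (simp add: f_def D_def K_def)
    also have "\<dots> \<le> K * x powr (-1/4)" using K \<beta> x by (intro mult_left_mono powr_mono) auto
    finally show ?thesis .
  qed
  \<comment> \<open>H M bounds D M + K + 2 M (D + K), the sum of the error coefficients below,
    because M \<ge> 1.\<close>
  define H where "H = 3 * D + 3 * K + 1"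
  have H: "H \<ge> 1" using D K by (simp add: H_def)
  define c where "c = 1 / (2 * D) * (20 * H * real q) powr - (128 * (1 - \<beta>))"
  have "c > 0" using D H q by (simp add: c_def)
  moreover have "Lser 1 \<psi> * Lser 1 (\<lambda>n. \<chi> n * \<psi> n) \<ge> c * real q' powr - (256 * (1 - \<beta>))"
    if rc': "real_char q' \<psi>" and rc'': "real_char (q * q') (\<lambda>n. \<chi> n * \<psi> n)" for q' \<psi>
  proof -
    have q': "real q' \<ge> 1" using real_charD(1)[OF rc'] by simp
    define g where "g = dconv \<psi> (\<lambda>n. \<chi> n * \<psi> n)"
    \<comment> \<open>The two moduli are q' and q q', whence 10 q' (q q').\<close>
    define M where "M = 10 * real q * real q' ^ 2"
    have M: "M \<ge> 1"
    proof -
      have "1 * 1 \<le> real q * real q' ^ 2" using q q' by (intro mult_mono) (auto simp: one_le_power)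
      then show ?thesis by (simp add: M_def)
    qed
    define \<Lambda> where "\<Lambda> = Lser 1 \<psi> * Lser 1 (\<lambda>n. \<chi> n * \<psi> n)"
    have Sg: "\<bar>psum s g x - Lser s \<psi> * Lser s (\<lambda>n. \<chi> n * \<psi> n)\<bar> \<le> M * x powr (-1/4)"
      if "3/4 \<le> s" "x \<ge> 1" for s x
      using psum_dconv_two_chars[OF rc' rc'' that] by (simp add: g_def M_def power2_eq_square mult_ac)
    have gn: "\<bar>g n\<bar> \<le> real n" if "n > 0" for n
      unfolding g_def by (rule dconv_chars_abs_le[OF rc' rc'' that])
    \<comment> \<open>With x = t^128 the error size T = x^(-1/128) is 1 / t, so that H M T =
      1/2.\<close>
    define t where "t = 2 * H * M"
    have t: "t \<ge> 1" using mult_mono[of 1 "2 * H" 1 M] H M by (simp add: t_def)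
    define x where "x = t powr 128"
    have x: "x \<ge> 1" unfolding x_def using t by (intro ge_one_powr_ge_zero) auto
    define y where "y = x powr (1/16)"
    have y: "y \<ge> 1" unfolding y_def using x by (intro ge_one_powr_ge_zero) auto
    have yx: "y \<le> x" unfolding y_def using x powr_mono[of "1/16" 1 x] by simp
    have y4: "y powr (-1/4) = x powr (-1/64)" by (simp add: y_def powr_powr)
    define T where "T = x powr (-1/128)"
    have T0: "T \<ge> 0" by (simp add: T_def)
    \<comment> \<open>Here \<beta> \<ge> 127/128 enters: 1 - \<beta> - 1/64 \<le> -1/128.\<close>
    have xT: "x powr (1 - \<beta>) * x powr (-1/64) \<le> T"
      unfolding T_def powr_add[symmetric] using x \<beta> by (intro powr_mono) auto
    define F where "F = (\<Sum>n=1..nat \<lfloor>y\<rfloor>. g n * real n powr - \<beta> * psum \<beta> f (x / real n))"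
    define G where "G = (\<Sum>m=1..nat \<lfloor>x / y\<rfloor>. f m * real m powr - \<beta> * (psum \<beta> g (x / real m) - psum \<beta> g y))"
    define R where "R = (\<Sum>n=1..nat \<lfloor>y\<rfloor>. g n * real n powr - \<beta> * (psum \<beta> f (x / real n) - D * (x / real n) powr (1 - \<beta>)))"
    have FG: "psum \<beta> (dconv f g) x = F + G"
      using psum_dconv[of y \<beta> f g x] y unfolding F_def G_def by simp
    have ny: "real n \<le> y" "1 \<le> real n" if "n \<in> {1..nat \<lfloor>y\<rfloor>}" for n
      using that le_nat_floor_iff[of n y] by auto
    have "F = (\<Sum>n=1..nat \<lfloor>y\<rfloor>. D * x powr (1 - \<beta>) * (g n * real n powr - 1) +
        g n * real n powr - \<beta> * (psum \<beta> f (x / real n) - D * (x / real n) powr (1 - \<beta>)))"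
      unfolding F_def
    proof (rule sum.cong)
      fix n assume n: "n \<in> {1..nat \<lfloor>y\<rfloor>}"
      have "real n powr - \<beta> * (x / real n) powr (1 - \<beta>) = x powr (1 - \<beta>) * real n powr - 1"
        using ny[OF n] x by (simp add: powr_divide powr_diff powr_minus field_simps)
      then show "g n * real n powr - \<beta> * psum \<beta> f (x / real n) = D * x powr (1 - \<beta>) * (g n * real n powr - 1) +
        g n * real n powr - \<beta> * (psum \<beta> f (x / real n) - D * (x / real n) powr (1 - \<beta>))"
        by (simp add: algebra_simps)
    qed simp
    also have "\<dots> = D * x powr (1 - \<beta>) * psum 1 g y + R"
      by (simp add: sum.distrib sum_distrib_left psum_def R_def)
    finally have F: "F = D * x powr (1 - \<beta>) * psum 1 g y + R" .
    \<comment> \<open>There are at most y terms and each has |g n| \<le> y, so the error is at most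
      K y^2 x^(-1/4) = K x^(-1/8): the cut at x^(1/16) is low enough for the trivial bound on
      g.\<close>
    have "\<bar>R\<bar> \<le> (\<Sum>n=1..nat \<lfloor>y\<rfloor>. \<bar>g n * real n powr - \<beta> * (psum \<beta> f (x / real n) - D * (x / real n) powr (1 - \<beta>))\<bar>)"
      unfolding R_def by (rule sum_abs)
    also have "\<dots> \<le> (\<Sum>n=1..nat \<lfloor>y\<rfloor>. y * (K * x powr (-1/4)))"
    proof (rule sum_mono)
      fix n assume n: "n \<in> {1..nat \<lfloor>y\<rfloor>}"
      have xn: "x / real n \<ge> 1" using ny[OF n] yx by (simp add: field_simps)
      have "\<bar>g n * real n powr - \<beta> * (psum \<beta> f (x / real n) - D * (x / real n) powr (1 - \<beta>))\<bar>
        = \<bar>g n\<bar> * (real n powr - \<beta> * \<bar>psum \<beta> f (x / real n) - D * (x / real n) powr (1 - \<beta>)\<bar>)"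
        by (simp add: abs_mult)
      also have "\<dots> \<le> real n * (real n powr - \<beta> * (K * (x / real n) powr (-1/4)))"
        using gn[of n] Sf[OF xn] n by (intro mult_mono) auto
      also have "\<dots> = real n * (real n powr (1/4 - \<beta>) * (K * x powr (-1/4)))"
      proof -
        have "(x / real n) powr (-1/4) = x powr (-1/4) * real n powr (1/4)"
          using ny[OF n] x by (simp add: powr_divide powr_minus field_simps)
        moreover have "real n powr - \<beta> * real n powr (1/4) = real n powr (1/4 - \<beta>)"
          by (simp add: powr_add[symmetric])
        moreover have "real n powr - \<beta> * (K * (x powr (-1/4) * real n powr (1/4))) =
          (real n powr - \<beta> * real n powr (1/4)) * (K * x powr (-1/4))"
          by (simp only: mult_ac)
        ultimately show ?thesis by simp
      qed
      also have "\<dots> \<le> y * (1 * (K * x powr (-1/4)))"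
      proof -
        have "real n powr (1/4 - \<beta>) \<le> real n powr 0" using ny[OF n] \<beta> by (intro powr_mono) auto
        also have "\<dots> = 1" using ny[OF n] by simp
        finally show ?thesis using ny[OF n] K by (intro mult_mono) auto
      qed
      finally show "\<bar>g n * real n powr - \<beta> * (psum \<beta> f (x / real n) - D * (x / real n) powr (1 - \<beta>))\<bar>
        \<le> y * (K * x powr (-1/4))" by simp
    qed
    also have "\<dots> \<le> y * (y * (K * x powr (-1/4)))"
    proof -
      have "real (nat \<lfloor>y\<rfloor>) * (y * (K * x powr (-1/4))) \<le> y * (y * (K * x powr (-1/4)))"
        using y K by (intro mult_right_mono) auto
      then show ?thesis by simp
    qed
    also have "\<dots> = K * (y * y * x powr (-1/4))" by simp
    also have "y * y * x powr (-1/4) = x powr (-1/8)"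
      unfolding y_def powr_add[symmetric] by simp
    also have "K * x powr (-1/8) \<le> K * T"
      unfolding T_def using K x by (intro mult_left_mono powr_mono) auto
    finally have R: "\<bar>R\<bar> \<le> K * T" .
    have "psum 1 g y \<le> \<Lambda> + M * x powr (-1/64)"
      using Sg[of 1 y] y unfolding \<Lambda>_def y4 by linarith
    then have "D * x powr (1 - \<beta>) * psum 1 g y \<le> D * x powr (1 - \<beta>) * (\<Lambda> + M * x powr (-1/64))"
      using D by (intro mult_left_mono) auto
    also have "\<dots> = D * x powr (1 - \<beta>) * \<Lambda> + D * M * (x powr (1 - \<beta>) * x powr (-1/64))"
      by (simp add: algebra_simps)
    also have "\<dots> \<le> D * x powr (1 - \<beta>) * \<Lambda> + D * M * T"
      using xT D M by (intro add_left_mono mult_left_mono) auto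
    finally have e1: "D * x powr (1 - \<beta>) * psum 1 g y \<le> D * x powr (1 - \<beta>) * \<Lambda> + D * M * T" .
    \<comment> \<open>Only an upper bound is wanted; as f is nonnegative, each difference of g-sums
      can be replaced by its bound 2 M y^(-1/4).\<close>
    have "G \<le> (\<Sum>m=1..nat \<lfloor>x / y\<rfloor>. 2 * M * x powr (-1/64) * (f m * real m powr - \<beta>))"
      unfolding G_def
    proof (rule sum_mono)
      fix m assume m: "m \<in> {1..nat \<lfloor>x / y\<rfloor>}"
      then have "m > 0" "real m \<le> x / y" using le_nat_floor_iff[of m "x / y"] by auto
      then have xm: "x / real m \<ge> y" using y by (simp add: field_simps)
      have "\<bar>psum \<beta> g (x / real m) - Lser \<beta> \<psi> * Lser \<beta> (\<lambda>n. \<chi> n * \<psi> n)\<bar> \<le> M * (x / real m) powr (-1/4)"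
        using xm y \<beta> by (intro Sg) auto
      also have "\<dots> \<le> M * y powr (-1/4)"
        using powr_neg_mono[of "1/4" y "x / real m"] xm y M by (intro mult_left_mono) auto
      finally have 1: "\<bar>psum \<beta> g (x / real m) - Lser \<beta> \<psi> * Lser \<beta> (\<lambda>n. \<chi> n * \<psi> n)\<bar> \<le> M * y powr (-1/4)" .
      have 2: "\<bar>psum \<beta> g y - Lser \<beta> \<psi> * Lser \<beta> (\<lambda>n. \<chi> n * \<psi> n)\<bar> \<le> M * y powr (-1/4)"
        using y \<beta> by (intro Sg) auto
      have "psum \<beta> g (x / real m) - psum \<beta> g y \<le> 2 * M * x powr (-1/64)"
        using 1 2 unfolding y4 by linarith
      then have "f m * real m powr - \<beta> * (psum \<beta> g (x / real m) - psum \<beta> g y) \<le>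
        f m * real m powr - \<beta> * (2 * M * x powr (-1/64))"
        using f0[OF \<open>m > 0\<close>] by (intro mult_left_mono) auto
      then show "f m * real m powr - \<beta> * (psum \<beta> g (x / real m) - psum \<beta> g y) \<le>
        2 * M * x powr (-1/64) * (f m * real m powr - \<beta>)" by (simp add: mult_ac)
    qed
    also have "\<dots> = 2 * M * x powr (-1/64) * psum \<beta> f (x / y)"
      by (simp add: psum_def sum_distrib_left)
    also have "\<dots> \<le> 2 * M * x powr (-1/64) * ((D + K) * x powr (1 - \<beta>))"
    proof (rule mult_left_mono)
      have xy: "x / y \<ge> 1" "x / y \<le> x" using yx y x by (auto simp: field_simps)
      have "psum \<beta> f (x / y) \<le> D * (x / y) powr (1 - \<beta>) + K * (x / y) powr (-1/4)"
        using Sf[OF xy(1)] by linarith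
      also have "\<dots> \<le> D * x powr (1 - \<beta>) + K * x powr (1 - \<beta>)"
      proof (intro add_mono mult_left_mono)
        show "(x / y) powr (1 - \<beta>) \<le> x powr (1 - \<beta>)" using xy \<beta> by (intro powr_mono2) auto
        have "(x / y) powr (-1/4) \<le> (x / y) powr 0" using xy by (intro powr_mono) auto
        also have "\<dots> \<le> x powr (1 - \<beta>)" using xy x \<beta> ge_one_powr_ge_zero[of x "1 - \<beta>"] by auto
        finally show "(x / y) powr (-1/4) \<le> x powr (1 - \<beta>)" .
      qed (use D K in auto)
      finally show "psum \<beta> f (x / y) \<le> (D + K) * x powr (1 - \<beta>)" by (simp add: algebra_simps)
    qed (use M in auto)
    also have "\<dots> = 2 * M * (D + K) * (x powr (1 - \<beta>) * x powr (-1/64))" by (simp add: mult_ac)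
    also have "\<dots> \<le> 2 * M * (D + K) * T" using xT D K M by (intro mult_left_mono) auto
    finally have G: "G \<le> 2 * M * (D + K) * T" .
    have "1 \<le> psum \<beta> (dconv f g) x"
    proof (rule psum_ge_one[OF _ _ x])
      show "dconv f g n \<ge> 0" if "n > 0" for n
        unfolding f_def g_def by (rule dconv_four_nonneg[OF rc rc' that])
      show "dconv f g 1 = 1" by (simp add: f_def g_def dconv_one real_charD[OF rc] real_charD[OF rc'])
    qed
    also have "\<dots> \<le> D * x powr (1 - \<beta>) * \<Lambda> + (D * M * T + K * T + 2 * M * (D + K) * T)"
      using e1 R G unfolding FG F by linarith
    also have "\<dots> \<le> D * x powr (1 - \<beta>) * \<Lambda> + H * M * T"
    proof -
      have "K * 1 \<le> K * M" using K M by (intro mult_left_mono)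
      then have "(D * M + K + 2 * M * (D + K)) * T \<le> (H * M) * T"
        using T0 M by (intro mult_right_mono) (auto simp: H_def algebra_simps)
      then show ?thesis by (simp add: algebra_simps)
    qed
    also have "T = t powr -1" unfolding T_def x_def powr_powr by simp
    also have "\<dots> = 1 / t" using t by (simp add: powr_minus_divide)
    also have "H * M * (1 / t) = 1/2" using H M by (simp add: t_def)
    finally have "1/2 \<le> D * x powr (1 - \<beta>) * \<Lambda>" by simp
    then have "1 / (2 * D) \<le> \<Lambda> * x powr (1 - \<beta>)" using D by (simp add: field_simps)
    then have "1 / (2 * D) * x powr - (1 - \<beta>) \<le> \<Lambda> * x powr (1 - \<beta>) * x powr - (1 - \<beta>)"
      by (intro mult_right_mono) auto
    also have "\<dots> = \<Lambda>" using x by (simp add: mult.assoc powr_add[symmetric])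
    \<comment> \<open>M contains q'^2, which doubles the exponent 128 to 256.\<close>
    also have "x powr - (1 - \<beta>) = (20 * H * real q) powr - (128 * (1 - \<beta>)) * real q' powr - (256 * (1 - \<beta>))"
    proof -
      have "x powr - (1 - \<beta>) = (20 * H * real q * (real q' powr 2)) powr - (128 * (1 - \<beta>))"
        using q' by (simp add: x_def powr_powr t_def M_def mult_ac)
      also have "\<dots> = (20 * H * real q) powr - (128 * (1 - \<beta>)) * (real q' powr 2) powr - (128 * (1 - \<beta>))"
        by (rule powr_mult)
      also have "(real q' powr 2) powr - (128 * (1 - \<beta>)) = real q' powr - (256 * (1 - \<beta>))"
        unfolding powr_powr by simp
      finally show ?thesis .
    qed
    finally show ?thesis by (simp add: c_def mult.assoc \<Lambda>_def)
  qed
  ultimately show ?thesis by blast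
qed

text \<open>One test point 1 - \<delta> serves all characters. If none is negative there,
  \<open>Lser_one_lower_of_nonneg\<close> applies to each; otherwise some \<chi> k has a zero
  \<beta> between 1 - \<delta> and 1 and controls every other index. The constant then depends on k
  and \<beta>, which are merely known to exist.\<close>

theorem siegel:
  fixes \<chi> :: "'i \<Rightarrow> nat \<Rightarrow> real" and q :: "'i \<Rightarrow> nat"
  assumes rc: "\<And>i. i \<in> I \<Longrightarrow> real_char (q i) (\<chi> i)"
    and rc2: "\<And>i j. i \<in> I \<Longrightarrow> j \<in> I \<Longrightarrow> i \<noteq> j \<Longrightarrow> real_char (q i * q j) (\<lambda>n. \<chi> i n * \<chi> j n)"
    and \<epsilon>: "\<epsilon> > 0"
  shows "\<exists>c>0. \<forall>i\<in>I. Lser 1 (\<chi> i) \<ge> c * real (q i) powr - \<epsilon>"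
proof -
  \<comment> \<open>This gives 4 \<delta> \<le> \<epsilon> in the first case and 256 (1-\<beta>)
    \<le> 256 \<delta> \<le> \<epsilon>/2 in the second; the bound 1/128 gives \<beta> \<ge>
    127/128.\<close>
  define \<delta> where "\<delta> = min (1/128) (\<epsilon> / 512)"
  have \<delta>: "0 < \<delta>" "\<delta> \<le> 1/128" "\<delta> \<le> \<epsilon> / 512" using \<epsilon> by (auto simp: \<delta>_def)
  have q: "real (q i) \<ge> 1" if "i \<in> I" for i using real_charD(1)[OF rc[OF that]] by simp
  obtain c1 where c1: "c1 > 0" "\<And>i. i \<in> I \<Longrightarrow> Lser (1 - \<delta>) (\<chi> i) \<ge> 0 \<Longrightarrow>
      Lser 1 (\<chi> i) \<ge> c1 * real (q i) powr - (4 * \<delta>)"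
    using Lser_one_lower_of_nonneg[of "1 - \<delta>"] \<delta> rc by auto
  show ?thesis
  proof (cases "\<forall>i\<in>I. Lser (1 - \<delta>) (\<chi> i) \<ge> 0")
    case True
    have "Lser 1 (\<chi> i) \<ge> c1 * real (q i) powr - \<epsilon>" if i: "i \<in> I" for i
    proof -
      have "c1 * real (q i) powr - \<epsilon> \<le> c1 * real (q i) powr - (4 * \<delta>)"
        using q[OF i] c1(1) \<delta> by (intro mult_left_mono powr_mono) auto
      also have "\<dots> \<le> Lser 1 (\<chi> i)" using c1(2) i True by blast
      finally show ?thesis .
    qed
    then show ?thesis using c1(1) by blast
  next
    case False
    then obtain k where k: "k \<in> I" "Lser (1 - \<delta>) (\<chi> k) < 0" by force
    have "continuous_on {1 - \<delta>..1} (\<lambda>s. Lser s (\<chi> k))"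
      by (rule continuous_on_subset[OF Lser_continuous[OF rc[OF k(1)], of "1 - \<delta>"]]) (use \<delta> in auto)
    moreover note L1 = Lser_one_pos[OF rc[OF k(1)]]
    ultimately obtain \<beta> where \<beta>: "1 - \<delta> \<le> \<beta>" "\<beta> \<le> 1" "Lser \<beta> (\<chi> k) = 0"
      using IVT'[of "\<lambda>s. Lser s (\<chi> k)" "1 - \<delta>" 0 1] k \<delta> by auto
    have "\<beta> \<noteq> 1" using \<beta>(3) L1 by auto
    then have "\<beta> < 1" using \<beta>(2) by simp
    then obtain c2 where c2: "c2 > 0" "\<And>q' \<psi>. real_char q' \<psi> \<Longrightarrow> real_char (q k * q') (\<lambda>n. \<chi> k n * \<psi> n) \<Longrightarrow>
           Lser 1 \<psi> * Lser 1 (\<lambda>n. \<chi> k n * \<psi> n) \<ge> c2 * real q' powr - (256 * (1 - \<beta>))"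
      using Lser_one_product_lower[OF rc[OF k(1)], of \<beta>] \<beta> \<delta> by auto
    define \<eta> where "\<eta> = min (\<epsilon> / 2) (1/2)"
    have \<eta>: "0 < \<eta>" "\<eta> < 1" "\<eta> \<le> \<epsilon> / 2" using \<epsilon> by (auto simp: \<eta>_def)
    define B where "B = (1 / \<eta> + 1) * real (q k) powr \<eta>"
    have B: "B > 0" using \<eta> q[OF k(1)] by (auto simp: B_def add_pos_pos)
    \<comment> \<open>The index k is covered by its own positive value, since the square of \<chi> k
      is principal and thus no admissible product.\<close>
    define c where "c = min (Lser 1 (\<chi> k)) (c2 / B)"
    have "c > 0" using L1 c2 B by (simp add: c_def)
    moreover have "Lser 1 (\<chi> i) \<ge> c * real (q i) powr - \<epsilon>" if i: "i \<in> I" for i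
    proof (cases "i = k")
      case True
      have "real (q i) powr - \<epsilon> \<le> real (q i) powr 0" using q[OF i] \<epsilon> by (intro powr_mono) auto
      also have "\<dots> = 1" using q[OF i] by simp
      finally have "c * real (q i) powr - \<epsilon> \<le> c * 1" using \<open>c > 0\<close> by (intro mult_left_mono) auto
      then show ?thesis using True by (simp add: c_def)
    next
      case False
      have rck: "real_char (q k * q i) (\<lambda>n. \<chi> k n * \<chi> i n)" using rc2 k i False by blast
      have pos: "Lser 1 (\<chi> i) > 0" using Lser_one_pos[OF rc[OF i]] .
      have "c2 * real (q i) powr - (\<epsilon> / 2) \<le> c2 * real (q i) powr - (256 * (1 - \<beta>))"
        using q[OF i] c2(1) \<delta> \<beta> by (intro mult_left_mono powr_mono) auto
      also have "\<dots> \<le> Lser 1 (\<chi> i) * Lser 1 (\<lambda>n. \<chi> k n * \<chi> i n)"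
        using c2(2)[OF rc[OF i] rck] .
      \<comment> \<open>The unwanted factor is bounded from above, at the cost of the second half of
        \<epsilon>.\<close>
      also have "\<dots> \<le> Lser 1 (\<chi> i) * ((1 / \<eta> + 1) * real (q k * q i) powr \<eta>)"
        using pos Lser_one_upper[OF \<eta>(1,2) rck] by (intro mult_left_mono) auto
      also have "\<dots> = Lser 1 (\<chi> i) * (B * real (q i) powr \<eta>)"
        by (simp add: B_def powr_mult mult_ac)
      also have "\<dots> \<le> Lser 1 (\<chi> i) * (B * real (q i) powr (\<epsilon> / 2))"
        using pos B q[OF i] \<eta> by (intro mult_left_mono powr_mono) auto
      finally have "c2 * real (q i) powr - (\<epsilon> / 2) * real (q i) powr - (\<epsilon> / 2) \<le>
        Lser 1 (\<chi> i) * (B * real (q i) powr (\<epsilon> / 2)) * real (q i) powr - (\<epsilon> / 2)"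
        by (intro mult_right_mono) auto
      also have "\<dots> = Lser 1 (\<chi> i) * B"
        using q[OF i] by (simp add: mult.assoc powr_add[symmetric])
      finally have "c2 * real (q i) powr - \<epsilon> \<le> Lser 1 (\<chi> i) * B"
        by (simp add: mult.assoc powr_add[symmetric])
      then have "c2 / B * real (q i) powr - \<epsilon> \<le> Lser 1 (\<chi> i)" using B by (simp add: field_simps)
      moreover have "c * real (q i) powr - \<epsilon> \<le> c2 / B * real (q i) powr - \<epsilon>"
        by (intro mult_right_mono) (auto simp: c_def)
      ultimately show ?thesis by linarith
    qed
    ultimately show ?thesis by blast
  qed
qed

section \<open>Legendre symbol and Gauss sums\<close>

definition leg :: "nat \<Rightarrow> nat \<Rightarrow> real" where
  "leg p n = of_int (Legendre (int n) (int p))"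

lemma Legendre_range: "Legendre a p \<in> {-1, 0, 1}"
  by (simp add: Legendre_def)

lemma Legendre_cong: "[a = b] (mod p) \<Longrightarrow> Legendre a p = Legendre b p"
proof -
  assume ab: "[a = b] (mod p)"
  then have "QuadRes p a = QuadRes p b"
    unfolding QuadRes_def by (meson cong_sym cong_trans)
  moreover have "[a = 0] (mod p) = [b = 0] (mod p)" using ab by (meson cong_sym cong_trans)
  ultimately show ?thesis by (simp add: Legendre_def)
qed

text \<open>The difference is at most 2 < p in absolute value, so the congruences of Euler's
  criterion become equalities of signs.\<close>

lemma sign_cong_imp_eq:
  fixes a b :: int
  assumes "a \<in> {-1, 0, 1}" "b \<in> {-1, 0, 1}" "[a = b] (mod int p)" "p > 2"
  shows "a = b"
proof -
  have "int p dvd a - b" using assms(3) by (simp add: cong_iff_dvd_diff)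
  moreover have "\<bar>a - b\<bar> < int p" using assms by auto
  ultimately show ?thesis by (metis abs_of_nat dvd_imp_le_int eq_iff_diff_eq_0 linorder_not_le)
qed

lemma Legendre_mult:
  assumes "prime p" "p > 2"
  shows "Legendre (a * b) (int p) = Legendre a (int p) * Legendre b (int p)"
proof (rule sign_cong_imp_eq[OF _ _ _ assms(2)])
  have "[Legendre a (int p) * Legendre b (int p) = a ^ ((p - 1) div 2) * b ^ ((p - 1) div 2)] (mod int p)"
    using assms by (intro cong_mult euler_criterion)
  moreover have "[Legendre (a * b) (int p) = (a * b) ^ ((p - 1) div 2)] (mod int p)"
    using assms by (intro euler_criterion)
  ultimately show "[Legendre (a * b) (int p) = Legendre a (int p) * Legendre b (int p)] (mod int p)"
    by (metis cong_sym cong_trans power_mult_distrib)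
  show "Legendre a (int p) * Legendre b (int p) \<in> {-1, 0, 1}"
    using Legendre_range[of a "int p"] Legendre_range[of b "int p"] by auto
qed (rule Legendre_range)

lemma Legendre_minus_one:
  assumes "prime p" "p > 2"
  shows "Legendre (- 1) (int p) = (- 1) ^ ((p - 1) div 2)"
proof (rule sign_cong_imp_eq[OF _ _ _ assms(2)])
  show "[Legendre (- 1) (int p) = (- 1) ^ ((p - 1) div 2)] (mod int p)"
    using assms by (rule euler_criterion)
  show "(- 1 :: int) ^ ((p - 1) div 2) \<in> {- 1, 0, 1}" by (cases "even ((p - 1) div 2)") auto
qed (rule Legendre_range)

lemma leg_mod: "leg p (n mod p) = leg p n"
  unfolding leg_def by (rule arg_cong[OF Legendre_cong]) (simp add: Cong.cong_def of_nat_mod)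

lemma leg_zero: "p > 0 \<Longrightarrow> leg p n = 0 \<longleftrightarrow> p dvd n"
  by (auto simp: leg_def Legendre_def cong_0_iff)

lemma leg_one: "p > 1 \<Longrightarrow> leg p (Suc 0) = 1"
proof -
  assume "p > 1"
  then have "\<not> [1 = 0] (mod int p)" by (simp add: cong_0_iff)
  moreover have "QuadRes (int p) 1" unfolding QuadRes_def by (rule exI[of _ 1]) simp
  ultimately show ?thesis by (simp add: leg_def Legendre_def)
qed

lemma leg_square: "p > 0 \<Longrightarrow> \<not> p dvd n \<Longrightarrow> leg p n * leg p n = 1"
  by (auto simp: leg_def Legendre_def cong_0_iff)

lemma leg_mult: "prime p \<Longrightarrow> p > 2 \<Longrightarrow> leg p (m * n) = leg p m * leg p n"
  by (simp add: leg_def Legendre_mult)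

lemma bij_betw_mult_mod:
  fixes p n :: nat
  assumes "prime p" "\<not> p dvd n"
  shows "bij_betw (\<lambda>t. n * t mod p) {..<p} {..<p}"
proof -
  have "inj_on (\<lambda>t. n * t mod p) {..<p}"
  proof (rule inj_onI)
    fix x y assume xy: "x \<in> {..<p}" "y \<in> {..<p}" "n * x mod p = n * y mod p"
    have "coprime n p" using assms by (metis coprime_commute prime_imp_coprime)
    with xy(3) have "[x = y] (mod p)" using cong_mult_lcancel_nat[of n p x y] by (simp add: Cong.cong_def)
    then show "x = y" using xy by (simp add: Cong.cong_def)
  qed
  moreover have "(\<lambda>t. n * t mod p) ` {..<p} \<subseteq> {..<p}" using prime_gt_0_nat[OF assms(1)] by auto
  ultimately show ?thesis by (metis bij_betw_def card_image card_subset_eq finite_lessThan)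
qed

text \<open>If every unit were a square, squaring would be onto and hence injective on 1, ..., p -
  1, yet 1 and p - 1 have the same square.\<close>

lemma exists_nonresidue:
  assumes "prime p" "p > 2"
  shows "\<exists>a. leg p a = -1"
proof (rule ccontr)
  assume no: "\<not> ?thesis"
  have "{1..<p} \<subseteq> (\<lambda>x. x ^ 2 mod p) ` {1..<p}"
  proof
    fix a assume a: "a \<in> {1..<p}"
    then have na: "\<not> p dvd a" by (auto dest: dvd_imp_le)
    have "leg p a \<noteq> -1" using no by blast
    then have "QuadRes (int p) (int a)" using na by (auto simp: leg_def Legendre_def cong_0_iff split: if_splits)
    then obtain y where y: "[y ^ 2 = int a] (mod int p)" by (auto simp: QuadRes_def)
    define z where "z = nat (y mod int p)"
    have z: "int z = y mod int p" "z < p" using assms by (auto simp: z_def nat_less_iff)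
    have "[int z ^ 2 = int a] (mod int p)" using y unfolding z(1) by (metis Cong.cong_def power_mod)
    then have "[z ^ 2 = a] (mod p)" by (metis cong_int_iff of_nat_power)
    then have "z ^ 2 mod p = a" using a by (simp add: Cong.cong_def)
    moreover have "z \<noteq> 0" using calculation a by (intro notI) auto
    ultimately show "a \<in> (\<lambda>x. x ^ 2 mod p) ` {1..<p}" using z by force
  qed
  then have "(\<lambda>x. x ^ 2 mod p) ` {1..<p} = {1..<p}"
    by (metis card_image_le card_seteq finite_atLeastLessThan finite_imageI)
  then have inj: "inj_on (\<lambda>x. x ^ 2 mod p) {1..<p}"
    by (simp add: eq_card_imp_inj_on)
  have eq: "1 ^ 2 mod p = (p - 1) ^ 2 mod p"
  proof -
    have "(p - 1) ^ 2 = 1 + p * (p - 2)"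
    proof -
      obtain k where k: "p = 2 + k" using assms(2) le_Suc_ex[of 2 p] by auto
      have "p - 1 = Suc k" "p - 2 = k" using k by auto
      then show ?thesis unfolding k by (simp add: power2_eq_square)
    qed
    then show ?thesis by (simp only: mod_mult_self2 power_one)
  qed
  have "1 = p - 1" by (rule inj_onD[OF inj eq]) (use assms(2) in simp_all)
  then show False using assms(2) by simp
qed

text \<open>Multiplication by a nonresidue permutes the residues and changes the sign of the
  sum.\<close>

lemma sum_leg:
  assumes "prime p" "p > 2"
  shows "(\<Sum>n<p. leg p n) = 0"
proof -
  obtain a where a: "leg p a = -1" using exists_nonresidue[OF assms] by blast
  then have "\<not> p dvd a" using leg_zero[of p a] assms by auto
  then have "(\<Sum>n<p. leg p n) = (\<Sum>n<p. leg p (a * n mod p))"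
    using sum.reindex_bij_betw[OF bij_betw_mult_mod[OF assms(1)], of a "leg p"] by simp
  also have "\<dots> = - (\<Sum>n<p. leg p n)"
    using assms a by (simp add: leg_mod leg_mult sum_negf)
  finally show ?thesis by simp
qed

lemma leg_reflect:
  assumes "prime p" "p > 2" "n \<le> p"
  shows "leg p (p - n) = (-1) ^ ((p - 1) div 2) * leg p n"
proof -
  have "Legendre (int (p - n)) (int p) = Legendre (- 1 * int n) (int p)"
    using assms by (intro Legendre_cong) (simp add: cong_iff_dvd_diff of_nat_diff)
  also have "\<dots> = (-1) ^ ((p - 1) div 2) * Legendre (int n) (int p)"
    unfolding Legendre_mult[OF assms(1,2)] Legendre_minus_one[OF assms(1,2)] ..
  finally show ?thesis by (simp add: leg_def)
qed

section \<open>Gauss sums\<close>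

definition gauss :: "nat \<Rightarrow> nat \<Rightarrow> complex" where
  "gauss p n = (\<Sum>t<p. of_real (leg p t) * cis (2 * pi * real n * real t / real p))"

lemma cis_mod:
  assumes "p > 0"
  shows "cis (2 * pi * real (k mod p) / real p) = cis (2 * pi * real k / real p)"
proof -
  have "real k = real p * real (k div p) + real (k mod p)"
    by (metis of_nat_add of_nat_mult mult_div_mod_eq)
  then have "2 * pi * real k / real p = 2 * pi * real (k mod p) / real p + 2 * pi * real (k div p)"
    using assms by (simp add: field_simps)
  then have "cis (2 * pi * real k / real p) = cis (2 * pi * real (k mod p) / real p) * cis (2 * pi * real (k div p))"
    by (simp only: cis_mult)
  also have "cis (2 * pi * real (k div p)) = 1"
    by (metis cis_multiple_2pi Ints_of_nat)
  finally show ?thesis by simp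
qed

text \<open>For n prime to p substitute n t for t; for p dividing n every exponential is 1 and
  \<open>sum_leg\<close> makes both sides vanish.\<close>

lemma gauss_eq:
  assumes "prime p" "p > 2"
  shows "gauss p n = of_real (leg p n) * gauss p 1"
proof (cases "p dvd n")
  case True
  then have "cis (2 * pi * real n * real t / real p) = 1" for t
  proof -
    have "cis (2 * pi * real (n * t) / real p) = cis (2 * pi * real (n * t mod p) / real p)"
      using assms by (subst cis_mod) auto
    then show ?thesis using True by (simp add: mult.assoc)
  qed
  then have "gauss p n = of_real (\<Sum>t<p. leg p t)" by (simp add: gauss_def)
  then show ?thesis using True assms sum_leg[OF assms] leg_zero[of p n] by simp
next
  case False
  have "gauss p 1 = (\<Sum>t<p. of_real (leg p (n * t mod p)) * cis (2 * pi * real (n * t mod p) / real p))"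
    using sum.reindex_bij_betw[OF bij_betw_mult_mod[OF assms(1) False],
      of "\<lambda>t. of_real (leg p t) * cis (2 * pi * real t / real p)"] by (simp add: gauss_def)
  also have "\<dots> = (\<Sum>t<p. of_real (leg p n * leg p t) * cis (2 * pi * real (n * t) / real p))"
    using assms by (simp only: cis_mod[OF prime_gt_0_nat[OF assms(1)]] leg_mod leg_mult[OF assms])
  also have "\<dots> = of_real (leg p n) * gauss p n"
    by (simp add: gauss_def sum_distrib_left mult.assoc)
  finally have "of_real (leg p n) * gauss p 1 = of_real (leg p n * leg p n) * gauss p n" by simp
  then show ?thesis using leg_square[of p n] False assms by simp
qed

lemma sum_cis_diff:
  assumes "p > 0" "t < p" "u < p"
  shows "(\<Sum>n<p. cis (2 * pi * real n * real t / real p) * cis (- (2 * pi * real n * real u / real p)))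
     = (if t = u then of_nat p else 0)"
proof -
  define z where "z = cis (2 * pi * (real t - real u) / real p)"
  have zn: "cis (2 * pi * real n * real t / real p) * cis (- (2 * pi * real n * real u / real p)) = z ^ n" for n
    unfolding z_def Complex.DeMoivre cis_mult by (rule arg_cong[of _ _ cis]) (simp add: field_simps diff_divide_distrib)
  have zp: "z ^ p = 1"
  proof -
    have "z ^ p = cis (2 * pi * of_int (int t - int u))"
      unfolding z_def Complex.DeMoivre using assms by (intro arg_cong[of _ _ cis]) simp
    then show ?thesis by (metis cis_multiple_2pi Ints_of_int)
  qed
  have "z \<noteq> 1" if "t \<noteq> u"
  proof
    assume "z = 1"
    then have "cos (2 * pi * (real t - real u) / real p) = 1" by (metis z_def cis.sel(1) one_complex.sel(1))
    then obtain k :: int where k: "2 * pi * (real t - real u) / real p = of_int k * 2 * pi"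
      by (auto simp: cos_one_2pi_int)
    then have "2 * pi * ((real t - real u) / real p) = 2 * pi * of_int k" by (simp add: mult_ac)
    then have "(real t - real u) / real p = of_int k"
      using mult_left_cancel[of "2 * pi" "(real t - real u) / real p" "of_int k"] by simp
    then have "real t - real u = real_of_int k * real p" using assms by (simp add: field_simps)
    then have "int t - int u = k * int p" by (metis of_int_diff of_int_eq_iff of_int_mult of_int_of_nat_eq)
    moreover have "\<bar>int t - int u\<bar> < int p" using assms by auto
    ultimately show False using that
      by (metis dvd_imp_le_int dvd_triv_right eq_iff_diff_eq_0 abs_of_nat linorder_not_le of_nat_eq_iff)
  qed
  then show ?thesis using zp unfolding zn by (auto simp: sum_gp_strict z_def)
qed

text \<open>Parseval: the sum of |gauss p n|^2 over n is (p-1) |gauss p 1|^2 by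
  \<open>gauss_eq\<close>, and p (p-1) by orthogonality of the exponentials.\<close>

lemma norm_gauss:
  assumes "prime p" "p > 2"
  shows "cmod (gauss p 1) = sqrt (real p)"
proof -
  have p: "p > 0" using assms by simp
  have leg2: "(\<Sum>t<p. leg p t * leg p t) = real (p - 1)"
  proof -
    have "(\<Sum>t<p. leg p t * leg p t) = (\<Sum>t<p. if t = 0 then 0 else 1)"
      using leg_zero[OF p, of 0] by (intro sum.cong) (auto intro!: leg_square[OF p] dest: dvd_imp_le)
    also have "\<dots> = (\<Sum>t\<in>{..<p} - {0}. 1)" using p by (subst sum.remove[of _ 0]) auto
    also have "\<dots> = real (p - 1)" using p by (simp add: of_nat_diff)
    finally show ?thesis .
  qed
  have "(\<Sum>n<p. gauss p n * cnj (gauss p n)) = (\<Sum>n<p. of_real (leg p n * leg p n) * (gauss p 1 * cnj (gauss p 1)))"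
  proof (rule sum.cong)
    fix n
    show "gauss p n * cnj (gauss p n) = of_real (leg p n * leg p n) * (gauss p 1 * cnj (gauss p 1))"
      unfolding gauss_eq[OF assms, of n] by (simp add: mult_ac)
  qed simp
  also have "\<dots> = of_real (\<Sum>n<p. leg p n * leg p n) * (gauss p 1 * cnj (gauss p 1))"
    by (simp add: sum_distrib_right)
  finally have 1: "(\<Sum>n<p. gauss p n * cnj (gauss p n)) = of_nat (p - 1) * (gauss p 1 * cnj (gauss p 1))"
    unfolding leg2 by simp
  have "(\<Sum>n<p. gauss p n * cnj (gauss p n)) = (\<Sum>n<p. \<Sum>t<p. \<Sum>u<p. of_real (leg p t * leg p u) *
      (cis (2 * pi * real n * real t / real p) * cis (- (2 * pi * real n * real u / real p))))"
    by (simp add: gauss_def sum_product cis_cnj mult_ac)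
  also have "\<dots> = (\<Sum>t<p. \<Sum>u<p. of_real (leg p t * leg p u) *
      (\<Sum>n<p. cis (2 * pi * real n * real t / real p) * cis (- (2 * pi * real n * real u / real p))))"
    unfolding sum_distrib_left by (subst sum.swap, rule sum.cong[OF refl], rule sum.swap)
  also have "\<dots> = (\<Sum>t<p. \<Sum>u<p. if u = t then of_real (leg p t * leg p u) * of_nat p else 0)"
    using p by (intro sum.cong) (auto simp: sum_cis_diff)
  also have "\<dots> = of_real (\<Sum>t<p. leg p t * leg p t) * of_nat p"
    by (simp add: sum_distrib_right)
  finally have "of_nat (p - 1) * (gauss p 1 * cnj (gauss p 1)) = of_nat (p - 1) * of_nat p"
    unfolding 1 leg2 by simp
  moreover have "(of_nat (p - 1) :: complex) \<noteq> 0" using assms by simp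
  ultimately have "gauss p 1 * cnj (gauss p 1) = of_nat p" by (metis mult_cancel_left)
  then have "complex_of_real ((cmod (gauss p 1))\<^sup>2) = of_real (real p)"
    by (simp only: complex_norm_square of_real_of_nat_eq)
  then have "(cmod (gauss p 1))\<^sup>2 = real p" by (simp only: of_real_eq_iff)
  then show ?thesis by (metis norm_ge_zero real_sqrt_unique)
qed

text \<open>Conjugation replaces n = 1 by n = p - 1, that is, by -1 modulo p.\<close>

lemma gauss_cnj:
  assumes "prime p" "p > 2"
  shows "cnj (gauss p 1) = of_real ((-1) ^ ((p - 1) div 2)) * gauss p 1"
proof -
  have "gauss p (p - 1) = cnj (gauss p 1)"
    unfolding gauss_def cnj_sum
  proof (rule sum.cong)
    fix t
    have "2 * pi * real (p - 1) * real t / real p = 2 * pi * real t + - (2 * pi * real t / real p)"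
      using assms by (simp add: field_simps of_nat_diff)
    then have "cis (2 * pi * real (p - 1) * real t / real p) = cis (2 * pi * real t) * cis (- (2 * pi * real t / real p))"
      by (simp only: cis_mult)
    moreover have "cis (2 * pi * real t) = 1" by (metis cis_multiple_2pi Ints_of_nat)
    ultimately show "of_real (leg p t) * cis (2 * pi * real (p - 1) * real t / real p) =
      cnj (of_real (leg p t) * cis (2 * pi * real 1 * real t / real p))" by (simp add: cis_cnj)
  qed simp
  then show ?thesis
    using gauss_eq[OF assms, of "p - 1"] leg_reflect[OF assms, of 1] leg_one[of p] assms by simp
qed

text \<open>The Gauss sum is real here, so g is plus or minus sqrt p; the sign is absorbed by the
  absolute value around the interval sum.\<close>

lemma leg_cos_sum:
  assumes "prime p" "p > 2" "[p = 1] (mod 4)"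
  obtains g where "\<bar>g\<bar> = sqrt (real p)" "\<And>n. (\<Sum>t<p. leg p t * cos (2 * pi * real n * real t / real p)) = g * leg p n"
proof
  have "even ((p - 1) div 2)" using assms(2,3) by (auto simp: Cong.cong_def) presburger
  then have "cnj (gauss p 1) = gauss p 1" using gauss_cnj[OF assms(1,2)] by simp
  then have "Im (gauss p 1) = 0" by (metis cnj.simps(2) equal_neg_zero)
  then show "\<bar>Re (gauss p 1)\<bar> = sqrt (real p)" using norm_gauss[OF assms(1,2)] by (simp add: cmod_def)
  show "(\<Sum>t<p. leg p t * cos (2 * pi * real n * real t / real p)) = Re (gauss p 1) * leg p n" for n
  proof -
    have "Re (gauss p n) = Re (gauss p 1) * leg p n" using gauss_eq[OF assms(1,2), of n] by simp
    then show ?thesis by (simp add: gauss_def[of p n])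
  qed
qed

lemma leg_sin_sum:
  assumes "prime p" "p > 2" "[p = 3] (mod 4)"
  obtains g where "\<bar>g\<bar> = sqrt (real p)" "\<And>n. (\<Sum>t<p. leg p t * sin (2 * pi * real n * real t / real p)) = g * leg p n"
proof
  have "odd ((p - 1) div 2)" using assms(2,3) by (auto simp: Cong.cong_def) presburger
  then have "cnj (gauss p 1) = - gauss p 1" using gauss_cnj[OF assms(1,2)] by simp
  then have "Re (gauss p 1) = 0" by (metis cnj.simps(1) equal_neg_zero uminus_complex.simps(1))
  then show "\<bar>Im (gauss p 1)\<bar> = sqrt (real p)" using norm_gauss[OF assms(1,2)] by (simp add: cmod_def)
  show "(\<Sum>t<p. leg p t * sin (2 * pi * real n * real t / real p)) = Im (gauss p 1) * leg p n" for n
  proof -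
    have "Im (gauss p n) = Im (gauss p 1) * leg p n" using gauss_eq[OF assms(1,2), of n] by simp
    then show ?thesis by (simp add: gauss_def[of p n])
  qed
qed

section \<open>Character sums over intervals and the value at 1\<close>

text \<open>Keeps the argument of Ln off its branch cut for all r up to and including 1, which gives
  continuity at r = 1.\<close>

lemma one_minus_cis_not_nonpos:
  assumes "0 \<le> r" "r \<le> 1" "\<theta> \<notin> \<int>"
  shows "1 - of_real r * cis (2 * pi * \<theta>) \<notin> \<real>\<^sub>\<le>\<^sub>0"
proof
  assume "1 - of_real r * cis (2 * pi * \<theta>) \<in> \<real>\<^sub>\<le>\<^sub>0"
  then have "1 \<le> r * cos (2 * pi * \<theta>)" by (simp add: complex_nonpos_Reals_iff)
  moreover have "r * cos (2 * pi * \<theta>) \<le> 1 * cos (2 * pi * \<theta>)" if "cos (2 * pi * \<theta>) \<ge> 0"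
    using that assms by (intro mult_right_mono) auto
  moreover have "r * cos (2 * pi * \<theta>) \<le> 0" if "cos (2 * pi * \<theta>) < 0"
    using that assms by (intro mult_nonneg_nonpos) auto
  ultimately have "cos (2 * pi * \<theta>) = 1" using cos_le_one[of "2 * pi * \<theta>"] by linarith
  then obtain k :: int where "2 * pi * \<theta> = of_int k * 2 * pi" by (auto simp: cos_one_2pi_int)
  then have "\<theta> = of_int k" by simp
  then show False using assms by simp
qed

text \<open>With a = frac \<theta>, 1 - e^(2 \<pi> i a) = 2 sin(\<pi> a) e^(i (\<pi> a - \<pi>/2)),
  and this angle is principal as 0 < a < 1. This is the origin of the sawtooth.\<close>

lemma Im_Ln_one_minus_cis:
  assumes "\<theta> \<notin> \<int>"
  shows "Im (Ln (1 - cis (2 * pi * \<theta>))) = pi * (frac \<theta> - 1/2)"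
proof -
  define a where "a = frac \<theta>"
  have a: "0 < a" "a < 1" using assms by (auto simp: a_def frac_lt_1 frac_gt_0_iff)
  have "2 * pi * \<theta> = 2 * pi * a + 2 * pi * of_int \<lfloor>\<theta>\<rfloor>"
    unfolding a_def frac_def by (simp add: algebra_simps)
  then have "cis (2 * pi * \<theta>) = cis (2 * pi * a) * cis (2 * pi * of_int \<lfloor>\<theta>\<rfloor>)"
    by (simp only: cis_mult)
  moreover have "cis (2 * pi * of_int \<lfloor>\<theta>\<rfloor>) = 1" by (metis cis_multiple_2pi Ints_of_int)
  ultimately have c: "cis (2 * pi * \<theta>) = cis (2 * (pi * a))" by (simp add: mult.assoc)
  have s: "sin (pi * a) > 0" using a by (intro sin_gt_zero) auto
  define w where "w = Complex (ln (2 * sin (pi * a))) (pi * a - pi / 2)"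
  have "exp w = of_real (2 * sin (pi * a)) * cis (pi * a - pi / 2)"
    using s by (simp add: exp_eq_polar w_def)
  also have "\<dots> = 1 - cis (2 * (pi * a))"
    by (rule complex_eqI) (simp_all add: cos_diff sin_diff cos_double_sin sin_double power2_eq_square)
  finally have "1 - cis (2 * pi * \<theta>) = exp w" by (simp add: c)
  moreover have "Ln (exp w) = w"
  proof (rule Ln_exp)
    have "pi * a > 0" "pi * a < pi" using a by auto
    then show "- pi < Im w" "Im w \<le> pi" unfolding w_def complex.sel using pi_gt_zero by linarith+
  qed
  ultimately have "Ln (1 - cis (2 * pi * \<theta>)) = w" by simp
  then show ?thesis by (simp add: w_def a_def algebra_simps)
qed

lemma sine_series:
  assumes "0 \<le> r" "r < 1"
  shows "(\<lambda>n. sin (2 * pi * real (Suc n) * \<theta>) * (r ^ Suc n / real (Suc n)))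
           sums (- Im (Ln (1 - of_real r * cis (2 * pi * \<theta>))))"
proof -
  define z where "z = of_real r * cis (2 * pi * \<theta>)"
  have z: "norm z < 1" using assms by (simp add: z_def norm_mult)
  have "(\<lambda>k. z ^ k / of_nat k) sums - Ln (1 - z)"
    using sums_minus[OF Ln_series[of "-z"]] z by (simp add: power_minus')
  then have "(\<lambda>k. Im (z ^ k / of_nat k)) sums Im (- Ln (1 - z))" by (rule sums_Im)
  moreover have "Im (z ^ k / of_nat k) = sin (2 * pi * real k * \<theta>) * (r ^ k / real k)" for k
    by (simp add: z_def power_mult_distrib Complex.DeMoivre Im_divide_of_nat mult_ac flip: of_real_power)
  ultimately have "(\<lambda>k. sin (2 * pi * real k * \<theta>) * (r ^ k / real k)) sums (- Im (Ln (1 - z)))"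
    by (simp only: uminus_complex.simps)
  then show ?thesis unfolding z_def by (subst sums_Suc_iff) simp
qed

text \<open>Abel summation: the identity holds for the power series at \<open>r < 1\<close>, where the sine series is
  \<open>- Im (Ln (1 - r cis (2 \<pi> \<theta>)))\<close>, and both sides are continuous at \<open>r = 1\<close>.\<close>
lemma Lser_one_sine_formula:
  assumes rc: "real_char q \<chi>" and J: "finite J"
    and eq: "\<And>n. n > 0 \<Longrightarrow> g * \<chi> n = (\<Sum>j\<in>J. c j * sin (2 * pi * real n * \<theta> j))"
    and \<theta>: "\<And>j. j \<in> J \<Longrightarrow> \<theta> j \<notin> \<int>"
  shows "g * Lser 1 \<chi> = (\<Sum>j\<in>J. c j * (pi * (1/2 - frac (\<theta> j))))"
proof -
  define V where "V = (\<lambda>r::real. pos_series (\<lambda>n. \<chi> n * (r ^ n / real n)))"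
  define W where "W = (\<lambda>r::real. \<Sum>j\<in>J. c j * (- Im (Ln (1 - of_real r * cis (2 * pi * \<theta> j)))))"
  have dec: "r ^ Suc i / real (Suc i) \<le> r ^ i / real i" if "r \<in> {0..1}" "i > 0" for r i
    using that by (intro frac_le power_decreasing) auto
  have V: "continuous_on {0..1} V"
    unfolding V_def
  proof (rule char_series_continuous[where g = "\<lambda>r n. r ^ n / real n" and h = "\<lambda>i. 1 / real i", OF rc])
    show "r ^ Suc i / real (Suc i) \<le> r ^ i / real i" if "r \<in> {0..1}" "i > 0" for r i
      using dec that .
    show "r ^ i / real i \<le> 1 / real i" if "r \<in> {0..1}" for r i
      using that by (intro divide_right_mono power_le_one) auto
    show "(\<lambda>i. 1 / real i) \<longlonglongrightarrow> 0" by (rule lim_1_over_n)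
  qed (auto intro!: continuous_intros)
  have W: "continuous_on {0..1} W"
    unfolding W_def using \<theta> by (intro continuous_intros one_minus_cis_not_nonpos) auto
  have VW: "g * V r = W r" if "0 \<le> r" "r < 1" for r
  proof -
    have lim: "(\<lambda>i. r ^ i / real i) \<longlonglongrightarrow> 0"
    proof (rule tendsto_sandwich[OF _ _ tendsto_const lim_1_over_n])
      show "\<forall>\<^sub>F n in sequentially. r ^ n / real n \<le> 1 / real n"
        using that by (intro always_eventually allI divide_right_mono power_le_one) auto
    qed (use that in auto)
    have "(\<lambda>n. \<chi> (Suc n) * (r ^ Suc n / real (Suc n))) sums V r"
      unfolding V_def using that by (intro char_series_tail(1)[OF rc _ _ lim] dec) auto
    then have "(\<lambda>n. g * (\<chi> (Suc n) * (r ^ Suc n / real (Suc n)))) sums (g * V r)"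
      by (rule sums_mult)
    moreover have "(\<lambda>n. \<Sum>j\<in>J. c j * (sin (2 * pi * real (Suc n) * \<theta> j) * (r ^ Suc n / real (Suc n)))) sums W r"
      unfolding W_def by (intro sums_sum sums_mult sine_series that)
    moreover have "(\<Sum>j\<in>J. c j * (sin (2 * pi * real (Suc n) * \<theta> j) * (r ^ Suc n / real (Suc n)))) =
      g * (\<chi> (Suc n) * (r ^ Suc n / real (Suc n)))" for n
      using eq[of "Suc n"] by (simp only: mult.assoc[symmetric] sum_distrib_right[symmetric])
    ultimately show ?thesis by (metis (no_types, lifting) sums_cong sums_unique2)
  qed
  define r where "r = (\<lambda>k::nat. 1 - inverse (real (Suc k)))"
  have r01: "r k \<in> {0..1}" "r k < 1" for k by (auto simp: r_def field_simps)
  have "(\<lambda>k. 1 - inverse (real (Suc k))) \<longlonglongrightarrow> 1 - 0"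
    by (intro tendsto_intros LIMSEQ_inverse_real_of_nat)
  then have r: "r \<longlonglongrightarrow> 1" by (simp add: r_def)
  have lims: "(\<lambda>k. V (r k)) \<longlonglongrightarrow> V 1" "(\<lambda>k. W (r k)) \<longlonglongrightarrow> W 1"
    using continuous_on_tendsto_compose[OF V r] continuous_on_tendsto_compose[OF W r] r01 by auto
  have "(\<lambda>k. g * V (r k)) = (\<lambda>k. W (r k))" using VW r01 by auto
  with tendsto_mult_left[OF lims(1), of g] have "(\<lambda>k. W (r k)) \<longlonglongrightarrow> g * V 1" by (simp only:)
  then have "g * V 1 = W 1" using lims(2) by (rule LIMSEQ_unique)
  also have "W 1 = (\<Sum>j\<in>J. c j * (pi * (1/2 - frac (\<theta> j))))"
    unfolding W_def
  proof (rule sum.cong)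
    fix j assume "j \<in> J"
    note Im_Ln_one_minus_cis[OF \<theta>[OF this]]
    then show "c j * - Im (Ln (1 - of_real 1 * cis (2 * pi * \<theta> j))) = c j * (pi * (1/2 - frac (\<theta> j)))"
      by (simp only: of_real_1 mult_1) (simp add: algebra_simps)
  qed simp
  also have "V 1 = Lser 1 \<chi>"
    unfolding V_def Lser_def pos_series_def by (simp add: powr_minus_divide)
  finally show ?thesis .
qed

text \<open>Unlike \<open>real_char\<close> this admits principal characters and is therefore closed
  under products, such as a Legendre symbol times the square of \<kappa>.\<close>

definition per_char :: "nat \<Rightarrow> (nat \<Rightarrow> real) \<Rightarrow> bool" where
  "per_char m \<kappa> \<longleftrightarrow> m > 0 \<and> \<kappa> 1 = 1 \<and> (\<forall>a b. \<kappa> (a * b) = \<kappa> a * \<kappa> b) \<and>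
     (\<forall>n. \<kappa> n \<in> {-1, 0, 1}) \<and> (\<forall>n. \<kappa> (n mod m) = \<kappa> n)"

lemma per_char_mult:
  assumes "per_char m \<kappa>" "per_char m' \<kappa>'"
  shows "per_char (m * m') (\<lambda>n. \<kappa> n * \<kappa>' n)"
proof -
  have "\<kappa> (n mod (m * m')) = \<kappa> n" "\<kappa>' (n mod (m * m')) = \<kappa>' n" for n
    using assms mod_mod_cancel[of m "m * m'" n] mod_mod_cancel[of m' "m * m'" n]
    unfolding per_char_def by (metis dvd_triv_left, metis dvd_triv_right)
  moreover have "\<kappa> n * \<kappa>' n \<in> {-1, 0, 1}" for n
  proof -
    have "\<kappa> n \<in> {-1, 0, 1}" "\<kappa>' n \<in> {-1, 0, 1}" using assms unfolding per_char_def by blast+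
    then show ?thesis by auto
  qed
  ultimately show ?thesis using assms unfolding per_char_def by simp
qed

lemma per_char_leg: "prime p \<Longrightarrow> p > 2 \<Longrightarrow> per_char p (leg p)"
  by (simp add: per_char_def leg_mod leg_mult leg_one) (simp add: leg_def Legendre_def)

text \<open>The Chinese remainder theorem in summed form.\<close>

lemma sum_coprime_mod:
  fixes f g :: "nat \<Rightarrow> real"
  assumes "coprime a b" "a > 0" "b > 0"
  shows "(\<Sum>n<a * b. f (n mod a) * g (n mod b)) = (\<Sum>i<a. f i) * (\<Sum>j<b. g j)"
proof -
  have inj: "inj_on (\<lambda>n. (n mod a, n mod b)) {..<a * b}"
  proof (rule inj_onI)
    fix x y assume xy: "x \<in> {..<a * b}" "y \<in> {..<a * b}" "(x mod a, x mod b) = (y mod a, y mod b)"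
    then have "[x = y] (mod a * b)"
      using assms(1) by (intro coprime_cong_mult_nat) (auto simp: Cong.cong_def)
    then show "x = y" using xy by (simp add: Cong.cong_def)
  qed
  have "(\<lambda>n. (n mod a, n mod b)) ` {..<a * b} = {..<a} \<times> {..<b}"
  proof (rule card_subset_eq)
    show "card ((\<lambda>n. (n mod a, n mod b)) ` {..<a * b}) = card ({..<a} \<times> {..<b})"
      using inj by (simp add: card_image)
  qed (use assms in auto)
  with inj have "bij_betw (\<lambda>n. (n mod a, n mod b)) {..<a * b} ({..<a} \<times> {..<b})"
    by (simp add: bij_betw_def)
  from sum.reindex_bij_betw[OF this, of "\<lambda>(i, j). f i * g j"]
  show ?thesis by (simp add: sum_product sum.cartesian_product)
qed

text \<open>The vanishing sum over a period is inherited from the Legendre symbol: by coprimality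
  the sum is a product with the factor \<open>sum_leg\<close>.\<close>

lemma real_char_leg_mult:
  assumes p: "prime p" "p > 2" and \<kappa>: "per_char m \<kappa>" and cop: "coprime p m"
  shows "real_char (p * m) (\<lambda>n. leg p n * \<kappa> n)"
proof -
  note pc = per_char_mult[OF per_char_leg[OF p] \<kappa>]
  have "(\<Sum>n<p * m. leg p (n mod p) * \<kappa> (n mod m)) = 0"
    using sum_coprime_mod[OF cop, of "leg p" \<kappa>] sum_leg[OF p] p \<kappa> by (auto simp: per_char_def)
  then have "(\<Sum>n<p * m. leg p n * \<kappa> n) = 0" using \<kappa> by (simp add: leg_mod per_char_def)
  moreover have "leg p (n + p * m) * \<kappa> (n + p * m) = leg p n * \<kappa> n" for n
    using pc unfolding per_char_def by (metis mod_add_self2)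
  ultimately show ?thesis using pc unfolding real_char_def per_char_def by blast
qed

text \<open>The family is indexed by p, with modulus p m; the fixed power of m goes into the
  constant.\<close>

lemma siegel_leg_mult:
  assumes \<kappa>: "per_char m \<kappa>" and P: "\<And>p. p \<in> P \<Longrightarrow> prime p \<and> p > 2 \<and> coprime p m" and "\<epsilon> > 0"
  shows "\<exists>c>0. \<forall>p\<in>P. Lser 1 (\<lambda>n. leg p n * \<kappa> n) \<ge> c * real p powr - \<epsilon>"
proof -
  have m: "m > 0" using \<kappa> by (simp add: per_char_def)
  have "\<exists>c>0. \<forall>p\<in>P. Lser 1 (\<lambda>n. leg p n * \<kappa> n) \<ge> c * real (p * m) powr - \<epsilon>"
  proof (rule siegel[OF _ _ \<open>\<epsilon> > 0\<close>])
    fix p assume "p \<in> P"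
    then show "real_char (p * m) (\<lambda>n. leg p n * \<kappa> n)" using P \<kappa> real_char_leg_mult by blast
  next
    fix p p' assume pp: "p \<in> P" "p' \<in> P" "p \<noteq> p'"
    \<comment> \<open>Two members multiply to the symbol for p times a factor of period m p' m,
      which is coprime to p because the primes differ.\<close>
    have "per_char (m * (p' * m)) (\<lambda>n. \<kappa> n * (leg p' n * \<kappa> n))"
      using pp P \<kappa> by (intro per_char_mult per_char_leg) auto
    moreover have "coprime p (m * (p' * m))" using pp P by (simp add: primes_coprime)
    ultimately have "real_char (p * (m * (p' * m))) (\<lambda>n. leg p n * (\<kappa> n * (leg p' n * \<kappa> n)))"
      using pp P by (intro real_char_leg_mult) auto
    then show "real_char (p * m * (p' * m)) (\<lambda>n. leg p n * \<kappa> n * (leg p' n * \<kappa> n))"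
      by (simp add: mult.assoc)
  qed
  then obtain c where c: "c > 0" "\<And>p. p \<in> P \<Longrightarrow> Lser 1 (\<lambda>n. leg p n * \<kappa> n) \<ge> c * real (p * m) powr - \<epsilon>" by blast
  have "real (p * m) powr - \<epsilon> = real m powr - \<epsilon> * real p powr - \<epsilon>" for p
    by (simp add: powr_mult mult.commute)
  then have "\<forall>p\<in>P. Lser 1 (\<lambda>n. leg p n * \<kappa> n) \<ge> (c * real m powr - \<epsilon>) * real p powr - \<epsilon>"
    using c(2) by (simp add: mult.assoc)
  then show ?thesis using c(1) m by (intro exI[of _ "c * real m powr - \<epsilon>"]) auto
qed

section \<open>The auxiliary characters modulo 3 and 8\<close>

definition chi3 :: "nat \<Rightarrow> real" where
  "chi3 n = (if n mod 3 = 0 then 0 else if n mod 3 = 1 then 1 else -1)"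

text \<open>For odd n this is the Jacobi symbol (2/n); it is even, since 7 is -1 modulo 8.\<close>

definition chi8 :: "nat \<Rightarrow> real" where
  "chi8 n = (if even n then 0 else if n mod 8 = 1 \<or> n mod 8 = 7 then 1 else -1)"

lemma per_char_chi3: "per_char 3 chi3"
proof -
  have per: "chi3 (n mod 3) = chi3 n" for n by (simp add: chi3_def)
  have "chi3 (a * b) = chi3 a * chi3 b" for a b
  proof -
    have "chi3 (a * b) = chi3 ((a mod 3) * (b mod 3))" by (simp add: chi3_def mod_mult_eq)
    also have "\<dots> = chi3 (a mod 3) * chi3 (b mod 3)"
    proof -
      have "a mod 3 \<in> {0, 1, 2}" "b mod 3 \<in> {0, 1, 2}" by auto
      then show ?thesis by (elim insertE emptyE) (simp_all add: chi3_def)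
    qed
    finally show ?thesis by (simp only: per)
  qed
  then show ?thesis by (auto simp: per_char_def chi3_def)
qed

lemma per_char_chi8: "per_char 8 chi8"
proof -
  have chi8: "chi8 n = (if n mod 8 \<in> {0, 2, 4, 6} then 0 else if n mod 8 \<in> {1, 7} then 1 else -1)" for n
  proof -
    have "even n \<longleftrightarrow> even (n mod 8)" by presburger
    moreover have "n mod 8 \<in> {0, 1, 2, 3, 4, 5, 6, 7}" by auto
    ultimately show ?thesis unfolding chi8_def by auto
  qed
  have per: "chi8 (n mod 8) = chi8 n" for n by (simp add: chi8)
  have "chi8 (a * b) = chi8 a * chi8 b" for a b
  proof -
    have "chi8 (a * b) = chi8 ((a mod 8) * (b mod 8))" by (simp add: chi8 mod_mult_eq)
    also have "\<dots> = chi8 (a mod 8) * chi8 (b mod 8)"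
    proof -
      have "a mod 8 \<in> {0, 1, 2, 3, 4, 5, 6, 7}" "b mod 8 \<in> {0, 1, 2, 3, 4, 5, 6, 7}" by auto
      then show ?thesis by (elim insertE emptyE) (simp_all add: chi8)
    qed
    finally show ?thesis by (simp only: per)
  qed
  then show ?thesis by (auto simp: per_char_def chi8)
qed


lemma sin_chi3: "sin (2 * pi * real n / 3) = sqrt 3 / 2 * chi3 n"
proof -
  have "sin (2 * pi * real n / 3) = sin (2 * pi * real (n mod 3) / 3)"
    using arg_cong[OF cis_mod[of 3 n], of Im] by simp
  moreover have "sin (4 * pi / 3) = - (sqrt 3 / 2)"
    using sin_60 sin_periodic_pi[of "pi / 3"] by (simp add: field_simps)
  moreover have "n mod 3 \<in> {0, 1, 2}" by auto
  ultimately show ?thesis by (auto simp: chi3_def sin_120)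
qed

text \<open>Finite Fourier expansion of \<open>chi8\<close>: in the sum of chi8(a) cos(2 \<pi> a n /
  8) the terms for a and 8 - a agree, which leaves a = 1 and a = 3.\<close>

lemma cos_chi8: "cos (2 * pi * real n / 8) - cos (2 * pi * real (3 * n) / 8) = sqrt 2 * chi8 n"
proof -
  define C where "C = (\<lambda>k::nat. cos (2 * pi * real k / 8))"
  have C_mod: "C n = C (n mod 8)" for n
    using arg_cong[OF cis_mod[of 8 n], of Re] by (simp add: C_def)
  \<comment> \<open>A half turn changes the sign, so a table of four cosines is enough.\<close>
  have C4: "C (k + 4) = - C k" for k
  proof -
    have "2 * pi * real (k + 4) / 8 = 2 * pi * real k / 8 + pi" by (simp add: field_simps)
    then show ?thesis unfolding C_def by (simp only: cos_periodic_pi)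
  qed
  have C0: "C 0 = 1" "C 1 = sqrt 2 / 2" "C 2 = 0" "C 3 = - (sqrt 2 / 2)"
  proof -
    have e: "2 * pi * real 3 / 8 = pi - pi / 4" by simp
    show "C 3 = - (sqrt 2 / 2)" unfolding C_def e cos_pi_minus by (simp add: cos_45)
  qed (simp_all add: C_def cos_45)
  have "C (3 * n) = C (3 * (n mod 8))"
    using C_mod[of "3 * n"] C_mod[of "3 * (n mod 8)"] by (simp add: mod_mult_right_eq)
  then have "C n - C (3 * n) = C (n mod 8) - C (3 * (n mod 8))" using C_mod[of n] by simp
  also have "\<dots> = sqrt 2 * chi8 (n mod 8)"
  proof -
    have "n mod 8 \<in> {0, 1, 2, 3, 4, 5, 6, 7}" by auto
    then show ?thesis
      using C0 C4[of 0] C4[of 1] C4[of 2] C4[of 3] C_mod[of 9] C_mod[of 12] C_mod[of 15] C_mod[of 18] C_mod[of 21]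
      by (elim insertE emptyE) (simp_all add: chi8_def)
  qed
  also have "chi8 (n mod 8) = chi8 n" using per_char_chi8 by (simp add: per_char_def)
  finally show ?thesis unfolding C_def .
qed

text \<open>An integral value would make m divide j p and hence p. This keeps the arguments away
  from the jumps of the sawtooth.\<close>

lemma not_Ints_shift:
  assumes "prime p" "m > 0" "\<not> m dvd p" "coprime (int m) j"
  shows "real t / real p + of_int j / real m \<notin> \<int>"
proof
  assume "real t / real p + of_int j / real m \<in> \<int>"
  then obtain k :: int where k: "real t / real p + of_int j / real m = of_int k" by (auto elim: Ints_cases)
  have p: "p > 0" using assms(1) prime_gt_0_nat by blast
  have "real m * real t + of_int j * real p = of_int k * real p * real m"
    using k p assms(2) by (simp add: field_simps)
  then have "of_int (int m * int t + j * int p) = (of_int (k * int p * int m) :: real)" by simp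
  then have "int m * int t + j * int p = k * int p * int m" by (simp only: of_int_eq_iff)
  then have "j * int p = int m * (k * int p - int t)" by (simp add: algebra_simps)
  then have "int m dvd j * int p" by simp
  then have "int m dvd int p" using coprime_dvd_mult_right_iff[OF assms(4)] by blast
  then show False using assms(3) by simp
qed

lemma frac_eqI: "x - r = of_int k \<Longrightarrow> 0 \<le> r \<Longrightarrow> r < 1 \<Longrightarrow> frac x = r"
  by (metis Ints_of_int frac_unique_iff)

text \<open>A frequency of the product is t/p from the Gauss sum plus a from the expansion of
  \<kappa>, so the sine formula is indexed by the pairs (t, a).\<close>

lemma Lser_leg_formula:
  assumes rc: "real_char q (\<lambda>n. leg p n * \<kappa> n)" and S: "finite S"
    and eq: "\<And>n. g * (leg p n * \<kappa> n) =
      (\<Sum>t<p. leg p t * (\<Sum>a\<in>S. w a * sin (2 * pi * real n * (real t / real p + a))))"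
    and nonint: "\<And>t a. t < p \<Longrightarrow> a \<in> S \<Longrightarrow> real t / real p + a \<notin> \<int>"
  shows "g * Lser 1 (\<lambda>n. leg p n * \<kappa> n) =
           pi * (\<Sum>t<p. leg p t * (\<Sum>a\<in>S. w a * (1/2 - frac (real t / real p + a))))"
proof -
  have "g * Lser 1 (\<lambda>n. leg p n * \<kappa> n) =
    (\<Sum>j\<in>{..<p} \<times> S. (leg p (fst j) * w (snd j)) * (pi * (1/2 - frac (real (fst j) / real p + snd j))))"
  proof (rule Lser_one_sine_formula[OF rc])
    fix n
    show "g * (leg p n * \<kappa> n) =
      (\<Sum>j\<in>{..<p} \<times> S. (leg p (fst j) * w (snd j)) * sin (2 * pi * real n * (real (fst j) / real p + snd j)))"
      by (simp add: eq sum_distrib_left sum.cartesian_product case_prod_unfold mult.assoc)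
  qed (use S nonint in auto)
  also have "\<dots> = pi * (\<Sum>t<p. leg p t * (\<Sum>a\<in>S. w a * (1/2 - frac (real t / real p + a))))"
    by (simp add: sum_distrib_left sum.cartesian_product case_prod_unfold mult_ac)
  finally show ?thesis .
qed

text \<open>cos times sin becomes a difference of sines at t/p + 1/3 and t/p - 1/3, and the two
  sawtooths differ by 1/3 minus the indicator of the middle third. The constant 1/3 disappears
  because the symbol sums to 0.\<close>

lemma Lser_chi3_formula:
  assumes p: "prime p" "[p = 1] (mod 4)"
  shows "sqrt (3 * real p) * Lser 1 (\<lambda>n. leg p n * chi3 n) =
           pi * \<bar>\<Sum>t | p < 3 * t \<and> 3 * t < 2 * p. leg p t\<bar>"
proof -
  have p2: "p > 2" and p3: "p \<noteq> 3"
  proof -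
    have "p mod 4 = 1" using p(2) by (simp add: Cong.cong_def)
    then show "p > 2" "p \<noteq> 3" using prime_gt_1_nat[OF p(1)] by presburger+
  qed
  have n3: "\<not> 3 dvd p" using p3 p(1) primes_dvd_imp_eq[of 3 p] by auto
  have cop: "coprime p 3" using n3 prime_imp_coprime[of 3 p] by (simp add: coprime_commute)
  obtain g where g: "\<bar>g\<bar> = sqrt (real p)"
    "\<And>n. (\<Sum>t<p. leg p t * cos (2 * pi * real n * real t / real p)) = g * leg p n"
    using leg_cos_sum[OF p(1) p2 p(2)] by blast
  define w where "w = (\<lambda>a::real. if a > 0 then 1 else -1 :: real)"
  have wS: "(\<Sum>a\<in>{1/3, -1/3}. w a * f a) = f (1/3) - f (-1/3)" for f
    by (simp add: w_def)
  define M where "M = {t. p < 3 * t \<and> 3 * t < 2 * p}"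
  have M: "M \<subseteq> {..<p}" by (auto simp: M_def)
  have rc: "real_char (p * 3) (\<lambda>n. leg p n * chi3 n)"
    by (rule real_char_leg_mult[OF p(1) p2 per_char_chi3 cop])
  have "(sqrt 3 * g) * Lser 1 (\<lambda>n. leg p n * chi3 n) =
    pi * (\<Sum>t<p. leg p t * (\<Sum>a\<in>{1/3, -1/3}. w a * (1/2 - frac (real t / real p + a))))"
  proof (rule Lser_leg_formula[OF rc])
    fix n :: nat
    have "(\<Sum>a\<in>{1/3, -1/3}. w a * sin (2 * pi * real n * (real t / real p + a))) =
      cos (2 * pi * real n * real t / real p) * (2 * sin (2 * pi * real n / 3))" for t
    proof -
      have "2 * pi * real n * (real t / real p + 1/3) = 2 * pi * real n * real t / real p + 2 * pi * real n / 3"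
        "2 * pi * real n * (real t / real p + -1/3) = 2 * pi * real n * real t / real p - 2 * pi * real n / 3"
        by (simp_all add: ring_distribs)
      then show ?thesis unfolding wS by (simp only: sin_add sin_diff)
    qed
    then have "(\<Sum>t<p. leg p t * (\<Sum>a\<in>{1/3, -1/3}. w a * sin (2 * pi * real n * (real t / real p + a)))) =
      (\<Sum>t<p. leg p t * cos (2 * pi * real n * real t / real p)) * (2 * sin (2 * pi * real n / 3))"
      by (simp only: sum_distrib_right mult.assoc)
    then show "sqrt 3 * g * (leg p n * chi3 n) =
      (\<Sum>t<p. leg p t * (\<Sum>a\<in>{1/3, -1/3}. w a * sin (2 * pi * real n * (real t / real p + a))))"
      unfolding g(2) by (simp add: sin_chi3)
  next
    fix t and a :: real assume "a \<in> {1/3, -1/3}"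
    then show "real t / real p + a \<notin> \<int>"
      by (elim insertE emptyE; hypsubst)
        (use not_Ints_shift[OF p(1), of 3 1 t] not_Ints_shift[OF p(1), of 3 "-1" t] n3 in simp_all)
  qed simp
  also have "(\<Sum>t<p. leg p t * (\<Sum>a\<in>{1/3, -1/3}. w a * (1/2 - frac (real t / real p + a)))) =
    (\<Sum>t<p. leg p t * (1/3) - (if t \<in> M then leg p t else 0))"
  proof (rule sum.cong)
    fix t assume t: "t \<in> {..<p}"
    define u where "u = real t / real p"
    have u: "0 \<le> u" "u < 1" using t by (auto simp: u_def)
    \<comment> \<open>As 3 does not divide p, no t sits on an endpoint of the interval.\<close>
    have ne: "3 * t \<noteq> p" "3 * t \<noteq> 2 * p" using n3 by presburger+
    have ul: "u < 1/3 \<longleftrightarrow> 3 * t < p" "u < 2/3 \<longleftrightarrow> 3 * t < 2 * p"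
      using t by (auto simp: u_def field_simps)
    consider "3 * t < p" | "p < 3 * t" "3 * t < 2 * p" | "2 * p < 3 * t" using ne by linarith
    then have "frac (u + -1/3) - frac (u + 1/3) = 1/3 - (if t \<in> M then 1 else 0)"
    proof cases
      case 1
      have "frac (u + -1/3) = u + 2/3" using 1 u ul by (intro frac_eqI[of _ _ "-1"]) auto
      moreover have "frac (u + 1/3) = u + 1/3" using 1 u ul by (intro frac_eqI[of _ _ 0]) auto
      ultimately show ?thesis using 1 by (simp add: M_def)
    next
      case 2
      have "frac (u + -1/3) = u - 1/3" using 2 u ul by (intro frac_eqI[of _ _ 0]) auto
      moreover have "frac (u + 1/3) = u + 1/3" using 2 u ul by (intro frac_eqI[of _ _ 0]) auto
      ultimately show ?thesis using 2 by (simp add: M_def)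
    next
      case 3
      have "frac (u + -1/3) = u - 1/3" using 3 u ul by (intro frac_eqI[of _ _ 0]) auto
      moreover have "frac (u + 1/3) = u - 2/3" using 3 u ul by (intro frac_eqI[of _ _ 1]) auto
      ultimately show ?thesis using 3 by (simp add: M_def)
    qed
    moreover have "(\<Sum>a\<in>{1/3, -1/3}. w a * (1/2 - frac (u + a))) = frac (u + -1/3) - frac (u + 1/3)"
      by (simp add: w_def)
    ultimately have "(\<Sum>a\<in>{1/3, -1/3}. w a * (1/2 - frac (u + a))) = 1/3 - (if t \<in> M then 1 else 0)"
      by (simp only:)
    then show "leg p t * (\<Sum>a\<in>{1/3, -1/3}. w a * (1/2 - frac (real t / real p + a))) =
      leg p t * (1/3) - (if t \<in> M then leg p t else 0)"
      unfolding u_def[symmetric] by (simp only:) (simp add: algebra_simps)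
  qed simp
  also have "\<dots> = (\<Sum>t<p. leg p t) * (1/3) - (\<Sum>t\<in>M. leg p t)"
    using M by (simp only: sum_subtractf sum_distrib_right) (simp add: sum.If_cases Int_absorb1)
  also have "\<dots> = - (\<Sum>t\<in>M. leg p t)" using sum_leg[OF p(1) p2] by simp
  finally have "\<bar>(sqrt 3 * g) * Lser 1 (\<lambda>n. leg p n * chi3 n)\<bar> = \<bar>pi * - (\<Sum>t\<in>M. leg p t)\<bar>" by simp
  then show ?thesis using g(1) Lser_one_pos[OF rc]
    by (simp add: abs_mult real_sqrt_mult M_def)
qed

text \<open>sin times cos gives sines at four shifts, weighted by \<open>chi8\<close> of the
  numerators modulo 8. The sawtooths combine to the indicator of (p/8, 3p/8) minus that of its
  mirror image, and oddness of the symbol makes the two contribute equally.\<close>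

lemma Lser_chi8_formula:
  assumes p: "prime p" "[p = 3] (mod 4)"
  shows "sqrt (2 * real p) * Lser 1 (\<lambda>n. leg p n * chi8 n) =
           pi * \<bar>\<Sum>t | p < 8 * t \<and> 8 * t < 3 * p. leg p t\<bar>"
proof -
  have p4: "p mod 4 = 3" using p(2) by (simp add: Cong.cong_def)
  have p2: "p > 2" and odd: "odd p"
    using p4 prime_gt_1_nat[OF p(1)] by presburger+
  have cop: "coprime p 8"
  proof -
    have "coprime p (2 ^ 3)" using odd by (simp only: coprime_power_right_iff coprime_right_2_iff_odd) simp
    then show ?thesis by simp
  qed
  obtain g where g: "\<bar>g\<bar> = sqrt (real p)"
    "\<And>n. (\<Sum>t<p. leg p t * sin (2 * pi * real n * real t / real p)) = g * leg p n"
    using leg_sin_sum[OF p(1) p2 p(2)] by blast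
  define S where "S = {1/8, -1/8, 3/8, -3/8 :: real}"
  define w where "w = (\<lambda>a::real. if \<bar>a\<bar> < 1/4 then 1 else -1 :: real)"
  have wS: "(\<Sum>a\<in>S. w a * f a) = f (1/8) + f (-1/8) - f (3/8) - f (-3/8)" for f
    by (simp add: S_def w_def)
  define M where "M = {t. p < 8 * t \<and> 8 * t < 3 * p}"
  define N where "N = {t. 5 * p < 8 * t \<and> 8 * t < 7 * p}"
  have MN: "M \<subseteq> {..<p}" "N \<subseteq> {..<p}" by (auto simp: M_def N_def)
  have rc: "real_char (p * 8) (\<lambda>n. leg p n * chi8 n)"
    by (rule real_char_leg_mult[OF p(1) p2 per_char_chi8 cop])
  have "(2 * sqrt 2 * g) * Lser 1 (\<lambda>n. leg p n * chi8 n) =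
    pi * (\<Sum>t<p. leg p t * (\<Sum>a\<in>S. w a * (1/2 - frac (real t / real p + a))))"
  proof (rule Lser_leg_formula[OF rc])
    fix n :: nat
    have "(\<Sum>a\<in>S. w a * sin (2 * pi * real n * (real t / real p + a))) =
      sin (2 * pi * real n * real t / real p) * (2 * (sqrt 2 * chi8 n))" for t
    proof -
      have "2 * pi * real n * (real t / real p + 1/8) = 2 * pi * real n * real t / real p + 2 * pi * real n / 8"
        "2 * pi * real n * (real t / real p + -1/8) = 2 * pi * real n * real t / real p - 2 * pi * real n / 8"
        "2 * pi * real n * (real t / real p + 3/8) = 2 * pi * real n * real t / real p + 2 * pi * real (3 * n) / 8"
        "2 * pi * real n * (real t / real p + -3/8) = 2 * pi * real n * real t / real p - 2 * pi * real (3 * n) / 8"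
        by (simp_all add: ring_distribs)
      then show ?thesis unfolding wS cos_chi8[symmetric] by (simp only: sin_add sin_diff) (simp add: ring_distribs)
    qed
    then have "(\<Sum>t<p. leg p t * (\<Sum>a\<in>S. w a * sin (2 * pi * real n * (real t / real p + a)))) =
      (\<Sum>t<p. leg p t * sin (2 * pi * real n * real t / real p)) * (2 * (sqrt 2 * chi8 n))"
      by (simp only: sum_distrib_right mult.assoc)
    then show "2 * sqrt 2 * g * (leg p n * chi8 n) =
      (\<Sum>t<p. leg p t * (\<Sum>a\<in>S. w a * sin (2 * pi * real n * (real t / real p + a))))"
      unfolding g(2) by simp
  next
    fix t and a :: real assume "a \<in> S"
    have "\<not> 8 dvd p" using odd by presburger
    moreover have "coprime (int 8) 1" "coprime (int 8) (-1)" "coprime (int 8) 3" "coprime (int 8) (-3)"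
      by (simp_all add: coprime_iff_gcd_eq_1 gcd_non_0_int)
    ultimately have "real t / real p + 1/8 \<notin> \<int>" "real t / real p - 1/8 \<notin> \<int>"
        "real t / real p + 3/8 \<notin> \<int>" "real t / real p - 3/8 \<notin> \<int>"
      using not_Ints_shift[OF p(1), of 8 1 t] not_Ints_shift[OF p(1), of 8 "-1" t]
        not_Ints_shift[OF p(1), of 8 3 t] not_Ints_shift[OF p(1), of 8 "-3" t] by auto
    with \<open>a \<in> S\<close>[unfolded S_def] show "real t / real p + a \<notin> \<int>"
      by (elim insertE emptyE; hypsubst) simp_all
  qed (simp add: S_def)
  also have "(\<Sum>t<p. leg p t * (\<Sum>a\<in>S. w a * (1/2 - frac (real t / real p + a)))) =
    (\<Sum>t<p. (if t \<in> M then leg p t else 0) - (if t \<in> N then leg p t else 0))"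
  proof (rule sum.cong)
    fix t assume t: "t \<in> {..<p}"
    define u where "u = real t / real p"
    have u: "0 \<le> u" "u < 1" using t by (auto simp: u_def)
    have ne: "8 * t \<noteq> p" "8 * t \<noteq> 3 * p" "8 * t \<noteq> 5 * p" "8 * t \<noteq> 7 * p" using odd by presburger+
    have ul: "u < 1/8 \<longleftrightarrow> 8 * t < p" "u < 3/8 \<longleftrightarrow> 8 * t < 3 * p" "u < 5/8 \<longleftrightarrow> 8 * t < 5 * p" "u < 7/8 \<longleftrightarrow> 8 * t < 7 * p"
      using t by (auto simp: u_def field_simps)
    have "t \<in> M \<longleftrightarrow> \<not> u < 1/8 \<and> u < 3/8" "t \<in> N \<longleftrightarrow> \<not> u < 5/8 \<and> u < 7/8"
      unfolding ul M_def N_def using ne by auto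
    moreover have "frac (u + 1/8) = (if u < 7/8 then u + 1/8 else u - 7/8)"
      using u frac_eqI[of "u + 1/8" "u + 1/8" 0] frac_eqI[of "u + 1/8" "u - 7/8" 1] by auto
    moreover have "frac (u + -1/8) = (if u < 1/8 then u + 7/8 else u - 1/8)"
      using u frac_eqI[of "u + -1/8" "u - 1/8" 0] frac_eqI[of "u + -1/8" "u + 7/8" "-1"] by auto
    moreover have "frac (u + 3/8) = (if u < 5/8 then u + 3/8 else u - 5/8)"
      using u frac_eqI[of "u + 3/8" "u + 3/8" 0] frac_eqI[of "u + 3/8" "u - 5/8" 1] by auto
    moreover have "frac (u + -3/8) = (if u < 3/8 then u + 5/8 else u - 3/8)"
      using u frac_eqI[of "u + -3/8" "u - 3/8" 0] frac_eqI[of "u + -3/8" "u + 5/8" "-1"] by auto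
    ultimately have "(\<Sum>a\<in>S. w a * (1/2 - frac (u + a))) = (if t \<in> M then 1 else 0) - (if t \<in> N then 1 else 0)"
      unfolding wS using u by (simp only:) auto
    then show "leg p t * (\<Sum>a\<in>S. w a * (1/2 - frac (real t / real p + a))) =
      (if t \<in> M then leg p t else 0) - (if t \<in> N then leg p t else 0)"
      unfolding u_def[symmetric] by (simp only:) (simp add: algebra_simps)
  qed simp
  also have "\<dots> = (\<Sum>t\<in>M. leg p t) - (\<Sum>t\<in>N. leg p t)"
    using MN by (simp only: sum_subtractf) (simp add: sum.If_cases Int_absorb1)
  also have "(\<Sum>t\<in>N. leg p t) = (\<Sum>t\<in>M. leg p (p - t))"
    by (rule sum.reindex_bij_witness[of _ "\<lambda>t. p - t" "\<lambda>t. p - t"]) (auto simp: M_def N_def)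
  also have "\<dots> = (\<Sum>t\<in>M. - leg p t)"
  proof (rule sum.cong)
    fix t assume "t \<in> M"
    then have "t \<le> p" using MN by auto
    moreover have "odd ((p - 1) div 2)" using p4 by presburger
    ultimately show "leg p (p - t) = - leg p t" using leg_reflect[OF p(1) p2, of t] by simp
  qed simp
  finally have "2 * (sqrt 2 * g * Lser 1 (\<lambda>n. leg p n * chi8 n)) = 2 * (pi * (\<Sum>t\<in>M. leg p t))"
    by (simp add: sum_negf algebra_simps)
  then have "\<bar>sqrt 2 * g * Lser 1 (\<lambda>n. leg p n * chi8 n)\<bar> = \<bar>pi * (\<Sum>t\<in>M. leg p t)\<bar>" by simp
  then show ?thesis using g(1) Lser_one_pos[OF rc]
    by (simp add: abs_mult real_sqrt_mult M_def)
qed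

section \<open>Averaging over dilates\<close>

text \<open>The factor sqrt p of the formula and the loss p^(-\<epsilon>) of Siegel's theorem
  combine to the exponent 1/2 - \<epsilon>.\<close>

lemma siegel_interval_sum:
  assumes \<kappa>: "per_char m \<kappa>" and P: "\<And>p. p \<in> P \<Longrightarrow> prime p \<and> p > 2 \<and> coprime p m"
    and formula: "\<And>p. p \<in> P \<Longrightarrow> sqrt (real k * real p) * Lser 1 (\<lambda>n. leg p n * \<kappa> n) = pi * \<bar>T p\<bar>"
    and "k > 0" "\<epsilon> > 0"
  shows "\<exists>c>0. \<forall>p\<in>P. \<bar>T p\<bar> \<ge> c * real p powr (1/2 - \<epsilon>)"
proof -
  obtain c where c: "c > 0" "\<And>p. p \<in> P \<Longrightarrow> Lser 1 (\<lambda>n. leg p n * \<kappa> n) \<ge> c * real p powr - \<epsilon>"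
    using siegel_leg_mult[OF \<kappa> P \<open>\<epsilon> > 0\<close>] by blast
  have "\<bar>T p\<bar> \<ge> c / pi * real p powr (1/2 - \<epsilon>)" if "p \<in> P" for p
  proof -
    have "real p powr (1/2 - \<epsilon>) = sqrt (real p) * real p powr - \<epsilon>"
      using P[OF that] by (simp add: powr_half_sqrt[symmetric] powr_add[symmetric])
    then have "c * real p powr (1/2 - \<epsilon>) = sqrt (real p) * (c * real p powr - \<epsilon>)" by simp
    also have "\<dots> \<le> sqrt (real k * real p) * Lser 1 (\<lambda>n. leg p n * \<kappa> n)"
    proof (rule mult_mono)
      show "sqrt (real p) \<le> sqrt (real k * real p)"
        using mult_right_mono[of 1 "real k" "real p"] \<open>k > 0\<close> by simp
    qed (use c(2)[OF that] c(1) in auto)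
    also have "\<dots> = pi * \<bar>T p\<bar>" by (rule formula[OF that])
    finally show ?thesis by (simp add: field_simps)
  qed
  then show ?thesis using c(1) by (intro exI[of _ "c / pi"]) auto
qed

lemma dilate_mod_bij:
  fixes p :: nat and x :: int
  assumes "prime p" "x \<in> {1..int p - 1}"
  shows "bij_betw (\<lambda>l. l * x mod int p) {1..int p - 1} {1..int p - 1}"
proof -
  have p: "int p > 0" using prime_gt_0_nat[OF assms(1)] by simp
  have nd: "\<not> int p dvd y" if "y \<in> {1..int p - 1}" for y using that by (auto dest: zdvd_imp_le)
  have prm: "prime (int p)" using assms(1) by simp
  have inj: "inj_on (\<lambda>l. l * x mod int p) {1..int p - 1}"
  proof (rule inj_onI)
    fix a b assume ab: "a \<in> {1..int p - 1}" "b \<in> {1..int p - 1}" "a * x mod int p = b * x mod int p"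
    then have "int p dvd (a - b) * x" by (simp add: mod_eq_dvd_iff left_diff_distrib)
    then have "int p dvd a - b" using nd[OF assms(2)] prm by (simp add: prime_dvd_mult_iff)
    moreover have "\<bar>a - b\<bar> < int p" using ab by auto
    ultimately show "a = b" using dvd_imp_le_int[of "a - b" "int p"] by fastforce
  qed
  have "(\<lambda>l. l * x mod int p) ` {1..int p - 1} \<subseteq> {1..int p - 1}"
  proof
    fix y assume "y \<in> (\<lambda>l. l * x mod int p) ` {1..int p - 1}"
    then obtain l where l: "l \<in> {1..int p - 1}" "y = l * x mod int p" by blast
    have "\<not> int p dvd l * x" using nd[OF l(1)] nd[OF assms(2)] prm by (simp add: prime_dvd_mult_iff)
    then have "y \<noteq> 0" using l(2) by (simp add: mod_eq_0_iff_dvd)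
    moreover have "0 \<le> y" "y < int p" using l(2) p by auto
    ultimately show "y \<in> {1..int p - 1}" by auto
  qed
  then have "(\<lambda>l. l * x mod int p) ` {1..int p - 1} = {1..int p - 1}"
    using inj by (intro card_subset_eq) (simp_all add: card_image)
  then show ?thesis using inj by (simp add: bij_betw_def)
qed

text \<open>Averaging over the dilates of a set \<open>I\<close> against the nonnegative weights \<open>1 + s (l/p)\<close>,
  for both signs \<open>s\<close>, isolates the two Legendre sums.\<close>
lemma dilate_average:
  fixes p N :: nat and A I :: "int set"
  assumes p: "prime p" "p > 2" and A: "A \<subseteq> {1..int p - 1}" and I: "I \<subseteq> {1..int p - 1}"
    and N: "\<And>l. l \<in> {1..int p - 1} \<Longrightarrow> card {x \<in> A. l * x mod int p \<in> I} \<le> N"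
  shows "real (card A) * real (card I) +
      \<bar>\<Sum>x\<in>A. real_of_int (Legendre x (int p))\<bar> * \<bar>\<Sum>t\<in>I. real_of_int (Legendre t (int p))\<bar>
      \<le> real N * (real p - 1)"
proof -
  define J where "J = {1..int p - 1}"
  define \<chi> where "\<chi> = (\<lambda>x. real_of_int (Legendre x (int p)))"
  have finA: "finite A" and finI: "finite I" using A I by (auto intro: finite_subset)
  have \<chi>1: "\<chi> x * \<chi> x = 1" if "x \<in> J" for x
    using that by (auto simp: \<chi>_def J_def Legendre_def cong_0_iff dest: zdvd_imp_le)
  have \<chi>_sum: "(\<Sum>l\<in>J. \<chi> l) = 0"
  proof -
    have "(\<Sum>l\<in>J. \<chi> l) = (\<Sum>n\<in>{1..<p}. leg p n)"
      by (rule sum.reindex_bij_witness[of _ int nat]) (auto simp: J_def \<chi>_def leg_def)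
    also have "\<dots> = (\<Sum>n<p. leg p n)"
      using p leg_zero[of p 0] by (intro sum.mono_neutral_left) (auto simp: Suc_le_eq)
    finally show ?thesis using sum_leg[OF p] by simp
  qed
  have bound: "real (card A) * real (card I) + s * (\<Sum>x\<in>A. \<chi> x) * (\<Sum>t\<in>I. \<chi> t) \<le> real N * (real p - 1)"
    if s: "s \<in> {1, -1}" for s :: real
  proof -
    have inner: "(\<Sum>l\<in>J. (1 + s * \<chi> l) * of_bool (l * x mod int p \<in> I)) = real (card I) + s * \<chi> x * (\<Sum>t\<in>I. \<chi> t)"
      if x: "x \<in> A" for x
    proof -
      have xJ: "x \<in> J" using x A by (auto simp: J_def)
      \<comment> \<open>Since \<chi>(x)^2 = 1, the weight can be written in terms of t = l x mod p,
        and the sum over l becomes a sum over t in I.\<close>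
      have \<chi>l: "\<chi> (l * x mod int p) * \<chi> x = \<chi> l" for l
      proof -
        have "\<chi> (l * x mod int p) = \<chi> (l * x)"
          unfolding \<chi>_def by (rule arg_cong[OF Legendre_cong]) (simp add: Cong.cong_def)
        also have "\<dots> = \<chi> l * \<chi> x" using p by (simp add: \<chi>_def Legendre_mult)
        finally show ?thesis using \<chi>1[OF xJ] by (simp add: mult.assoc)
      qed
      then have "(\<Sum>l\<in>J. (1 + s * \<chi> l) * of_bool (l * x mod int p \<in> I)) =
        (\<Sum>l\<in>J. (1 + s * (\<chi> (l * x mod int p) * \<chi> x)) * of_bool (l * x mod int p \<in> I))"
        by (simp only: \<chi>l)
      also have "\<dots> = (\<Sum>t\<in>J. (1 + s * (\<chi> t * \<chi> x)) * of_bool (t \<in> I))"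
        using sum.reindex_bij_betw[OF dilate_mod_bij[OF p(1), of x],
          of "\<lambda>t. (1 + s * (\<chi> t * \<chi> x)) * of_bool (t \<in> I)"] xJ by (simp add: J_def)
      also have "\<dots> = (\<Sum>t\<in>I. 1 + s * (\<chi> t * \<chi> x))"
        using I by (intro sum.mono_neutral_cong_right) (auto simp: J_def)
      also have "\<dots> = real (card I) + s * \<chi> x * (\<Sum>t\<in>I. \<chi> t)"
        by (simp add: sum.distrib sum_distrib_left mult_ac)
      finally show ?thesis .
    qed
    have "real (card A) * real (card I) + s * (\<Sum>x\<in>A. \<chi> x) * (\<Sum>t\<in>I. \<chi> t) =
      (\<Sum>x\<in>A. real (card I) + s * \<chi> x * (\<Sum>t\<in>I. \<chi> t))"
    proof -
      have "real (card A) * k + s * (\<Sum>x\<in>A. \<chi> x) * T = (\<Sum>x\<in>A. k + s * \<chi> x * T)" for k T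
        by (simp add: sum.distrib sum_distrib_left sum_distrib_right)
      then show ?thesis .
    qed
    also have "\<dots> = (\<Sum>x\<in>A. \<Sum>l\<in>J. (1 + s * \<chi> l) * of_bool (l * x mod int p \<in> I))"
      using inner by simp
    also have "\<dots> = (\<Sum>l\<in>J. (1 + s * \<chi> l) * (\<Sum>x\<in>A. of_bool (l * x mod int p \<in> I)))"
      unfolding sum_distrib_left by (rule sum.swap)
    also have "\<dots> = (\<Sum>l\<in>J. (1 + s * \<chi> l) * real (card {x \<in> A. l * x mod int p \<in> I}))"
    proof -
      have "real (card {x \<in> A. Q x}) = (\<Sum>x\<in>{x \<in> A. Q x}. 1)" for Q by simp
      then have "real (card {x \<in> A. Q x}) = (\<Sum>x\<in>A. of_bool (Q x))" for Q
        by (simp only: sum.inter_filter[OF finA] of_bool_def)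
      then show ?thesis by (simp only:)
    qed
    also have "\<dots> \<le> (\<Sum>l\<in>J. (1 + s * \<chi> l) * real N)"
    proof (intro sum_mono mult_left_mono)
      fix l assume l: "l \<in> J"
      show "real (card {x \<in> A. l * x mod int p \<in> I}) \<le> real N" using N l by (simp add: J_def)
      \<comment> \<open>Nonnegative weights preserve the bound N; as the symbol sums to 0, their
        total is still p - 1.\<close>
      show "0 \<le> 1 + s * \<chi> l" using s by (auto simp: \<chi>_def Legendre_def)
    qed
    also have "\<dots> = (real (card J) + s * (\<Sum>l\<in>J. \<chi> l)) * real N"
      by (simp add: sum_distrib_right[symmetric] sum.distrib sum_distrib_left)
    also have "\<dots> = real N * (real p - 1)" using p unfolding \<chi>_sum by (simp add: J_def)
    finally show ?thesis .
  qed
  have "\<bar>\<Sum>x\<in>A. \<chi> x\<bar> * \<bar>\<Sum>t\<in>I. \<chi> t\<bar> = \<bar>(\<Sum>x\<in>A. \<chi> x) * (\<Sum>t\<in>I. \<chi> t)\<bar>" by (simp add: abs_mult)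
  then show ?thesis using bound[of 1] bound[of "-1"] unfolding \<chi>_def by (simp add: abs_if split: if_splits)
qed

text \<open>I fills at least the proportion 1/d of the units, so |A|/d cancels and \<psi> alone has
  to pay for the product of the two Legendre sums. Dividing by the lower bound c p^(1/2-\<epsilon>)
  turns p into p^(1/2+\<epsilon>).\<close>

lemma legendre_sum_bound:
  fixes p N :: nat and A I :: "int set"
  assumes p: "prime p" "p > 2" and A: "A \<subseteq> {1..int p - 1}" and I: "I \<subseteq> {1..int p - 1}"
    and N: "\<And>l. l \<in> {1..int p - 1} \<Longrightarrow> card {x \<in> A. l * x mod int p \<in> I} \<le> N"
    and d: "d > 0" "real p - 1 \<le> d * real (card I)"
    and c: "c > 0" "c * real p powr (1/2 - \<epsilon>) \<le> \<bar>\<Sum>t\<in>I. real_of_int (Legendre t (int p))\<bar>"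
    and \<psi>: "real N = real (card A) / d + \<psi>"
  shows "\<bar>real_of_int (\<Sum>x\<in>A. Legendre x (int p))\<bar> \<le> (1 / c) * (\<psi> * real p powr (1/2 + \<epsilon>))"
proof -
  define X where "X = \<bar>real_of_int (\<Sum>x\<in>A. Legendre x (int p))\<bar>"
  define T where "T = \<bar>\<Sum>t\<in>I. real_of_int (Legendre t (int p))\<bar>"
  have X0: "X \<ge> 0" and T0: "T \<ge> 0" by (auto simp: X_def T_def)
  have "real (card A) * real (card I) + X * T \<le> (real (card A) / d + \<psi>) * (real p - 1)"
    using dilate_average[OF p A I N] by (simp add: X_def T_def \<psi>[symmetric])
  moreover have "real (card A) / d * (real p - 1) \<le> real (card A) / d * (d * real (card I))"
    using d by (intro mult_left_mono) auto
  ultimately have XT: "X * T \<le> \<psi> * (real p - 1)" using d(1) by (simp add: algebra_simps)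
  have p1: "real p - 1 > 0" using p by simp
  \<comment> \<open>Nonnegativity of \<psi> falls out of the inequality itself and lets p - 1 be
    enlarged to p.\<close>
  have "0 \<le> \<psi> * (real p - 1)" using XT X0 T0 by (meson mult_nonneg_nonneg order_trans)
  then have \<psi>0: "\<psi> \<ge> 0" using p1 by (simp add: zero_le_mult_iff)
  have "X * (c * real p powr (1/2 - \<epsilon>)) \<le> X * T" using c(2) X0 by (intro mult_left_mono) (auto simp: T_def)
  also have "\<dots> \<le> \<psi> * real p" using XT \<psi>0 by (simp add: algebra_simps)
  also have "\<dots> = (\<psi> * real p powr (1/2 + \<epsilon>)) * real p powr (1/2 - \<epsilon>)"
    using p by (simp add: mult.assoc powr_add[symmetric])
  finally have "(X * c) * real p powr (1/2 - \<epsilon>) \<le> (\<psi> * real p powr (1/2 + \<epsilon>)) * real p powr (1/2 - \<epsilon>)"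
    by (simp only: mult.assoc)
  then have "X * c \<le> \<psi> * real p powr (1/2 + \<epsilon>)" using p by (simp add: mult_le_cancel_right)
  then show ?thesis using c(1) by (simp add: X_def field_simps)
qed

section \<open>Sum-free dilates of intervals in \<open>Fp p\<close>\<close>

lemma Fp_add: "x \<oplus>\<^bsub>Fp p\<^esub> y = (x + y) mod int p"
  by (simp add: residue_ring_def)

lemma Units_Fp: "prime p \<Longrightarrow> Units (Fp p) = {1..int p - 1}"
  using residues_prime.res_prime_units_eq[of p] prime_ge_1_nat[of p]
  by (simp add: residues_prime_def of_nat_diff)

lemma card_le_sf:
  assumes "finite A" "S \<subseteq> A" "sum_free R S"
  shows "card S \<le> sf R A"
  unfolding sf_def using assms by (intro Max_ge) auto

lemma card_le_sf3:
  assumes "finite A" "S \<subseteq> A" "sum_free3 R S"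
  shows "card S \<le> sf3 R A"
  unfolding sf3_def using assms by (intro Max_ge) auto

text \<open>Dilation is additive modulo p, so only the interval matters: a + b lies strictly between
  2p/3 and 4p/3, hence modulo p outside the open middle third.\<close>

lemma sum_free_dilate:
  "sum_free (Fp p) {x \<in> A. l * x mod int p \<in> {t. int p < 3 * t \<and> 3 * t < 2 * int p}}"
  unfolding sum_free_def
proof (rule notI, elim exE conjE)
  fix x y z
  assume x: "x \<in> {x \<in> A. l * x mod int p \<in> {t. int p < 3 * t \<and> 3 * t < 2 * int p}}"
    and y: "y \<in> {x \<in> A. l * x mod int p \<in> {t. int p < 3 * t \<and> 3 * t < 2 * int p}}"
    and z: "z \<in> {x \<in> A. l * x mod int p \<in> {t. int p < 3 * t \<and> 3 * t < 2 * int p}}"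
    and xyz: "x \<oplus>\<^bsub>Fp p\<^esub> y = z"
  define a b where "a = l * x mod int p" and "b = l * y mod int p"
  have "l * z mod int p = (a + b) mod int p"
    using xyz[symmetric] by (simp add: Fp_add a_def b_def mod_simps distrib_left)
  then have m: "int p < 3 * ((a + b) mod int p)" "3 * ((a + b) mod int p) < 2 * int p" using z by auto
  have ab: "int p < 3 * a" "3 * a < 2 * int p" "int p < 3 * b" "3 * b < 2 * int p"
    using x y by (auto simp: a_def b_def)
  show False
  proof (cases "a + b < int p")
    case True
    then show ?thesis using m ab by (simp add: mod_pos_pos_trivial)
  next
    case False
    have "(a + b) mod int p = a + b - int p"
      using False ab minus_mod_self2[of "a + b" "int p"] mod_pos_pos_trivial[of "a + b - int p" "int p"] by linarith
    then show ?thesis using m ab by linarith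
  qed
qed

text \<open>Here a + b + c lies strictly between 3p/8 and 9p/8, hence modulo p above 3p/8 or below
  p/8: the interval ends exactly where its threefold sums begin.\<close>

lemma sum_free3_dilate:
  "sum_free3 (Fp p) {x \<in> A. l * x mod int p \<in> {t. int p < 8 * t \<and> 8 * t < 3 * int p}}"
  unfolding sum_free3_def
proof (rule notI, elim exE conjE)
  fix x y z w
  assume x: "x \<in> {x \<in> A. l * x mod int p \<in> {t. int p < 8 * t \<and> 8 * t < 3 * int p}}"
    and y: "y \<in> {x \<in> A. l * x mod int p \<in> {t. int p < 8 * t \<and> 8 * t < 3 * int p}}"
    and z: "z \<in> {x \<in> A. l * x mod int p \<in> {t. int p < 8 * t \<and> 8 * t < 3 * int p}}"
    and w: "w \<in> {x \<in> A. l * x mod int p \<in> {t. int p < 8 * t \<and> 8 * t < 3 * int p}}"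
    and xyz: "x \<oplus>\<^bsub>Fp p\<^esub> y \<oplus>\<^bsub>Fp p\<^esub> z = w"
  define a b c where "a = l * x mod int p" and "b = l * y mod int p" and "c = l * z mod int p"
  have "l * w mod int p = (a + b + c) mod int p"
  proof -
    have "[a + b + c = l * x + l * y + l * z] (mod int p)"
      unfolding a_def b_def c_def by (intro cong_add) (simp_all add: Cong.cong_def)
    moreover have "w = (x + y + z) mod int p" using xyz by (simp add: Fp_add mod_simps)
    ultimately show ?thesis by (simp add: Cong.cong_def mod_simps distrib_left)
  qed
  then have m: "int p < 8 * ((a + b + c) mod int p)" "8 * ((a + b + c) mod int p) < 3 * int p" using w by auto
  have ab: "int p < 8 * a" "8 * a < 3 * int p" "int p < 8 * b" "8 * b < 3 * int p" "int p < 8 * c" "8 * c < 3 * int p"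
    using x y z by (auto simp: a_def b_def c_def)
  show False
  proof (cases "a + b + c < int p")
    case True
    then show ?thesis using m ab by (simp add: mod_pos_pos_trivial)
  next
    case False
    have "(a + b + c) mod int p = a + b + c - int p"
      using False ab minus_mod_self2[of "a + b + c" "int p"] mod_pos_pos_trivial[of "a + b + c - int p" "int p"] by linarith
    then show ?thesis using m ab by linarith
  qed
qed

text \<open>For p = 3k + 1 the count is k and the bound is attained; the lost 1 matches the p - 1
  dilates of the average.\<close>

lemma card_middle_third:
  fixes p :: nat assumes "\<not> 3 dvd p"
  shows "real p - 1 \<le> 3 * real (card {t. int p < 3 * t \<and> 3 * t < 2 * int p})"
proof -
  have eq: "{t. int p < 3 * t \<and> 3 * t < 2 * int p} = {int p div 3 + 1..(2 * int p - 1) div 3}"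
    by (rule Set.set_eqI) (simp, linarith)
  have "\<not> 3 dvd P \<Longrightarrow> P - 1 \<le> 3 * ((2 * P - 1) div 3 - P div 3)" for P :: int by presburger
  moreover have "\<not> 3 dvd int p" using assms by presburger
  ultimately have "int p - 1 \<le> 3 * ((2 * int p - 1) div 3 - int p div 3)" by blast
  then have "int p - 1 \<le> 3 * int (card {t. int p < 3 * t \<and> 3 * t < 2 * int p})" unfolding eq by simp
  then show ?thesis by linarith
qed

text \<open>The count is 2k + 1 for p = 8k + 3 and 2k + 2 for p = 8k + 7.\<close>

lemma card_eighths:
  fixes p :: nat assumes "p mod 4 = 3"
  shows "real p - 1 \<le> 4 * real (card {t. int p < 8 * t \<and> 8 * t < 3 * int p})"
proof -
  have eq: "{t. int p < 8 * t \<and> 8 * t < 3 * int p} = {int p div 8 + 1..(3 * int p - 1) div 8}"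
    by (rule Set.set_eqI) (simp, linarith)
  have "P mod 4 = 3 \<Longrightarrow> P - 1 \<le> 4 * ((3 * P - 1) div 8 - P div 8)" for P :: int by presburger
  moreover have "int p mod 4 = 3" using assms by presburger
  ultimately have "int p - 1 \<le> 4 * ((3 * int p - 1) div 8 - int p div 8)" by blast
  then have "int p - 1 \<le> 4 * int (card {t. int p < 8 * t \<and> 8 * t < 3 * int p})" unfolding eq by simp
  then show ?thesis by linarith
qed

lemma sum_leg_eq_sum_Legendre:
  "(\<Sum>t | a * p < m * t \<and> m * t < b * p. leg p t) =
    (\<Sum>t | int (a * p) < int m * t \<and> int m * t < int (b * p). real_of_int (Legendre t (int p)))"
proof (rule sum.reindex_bij_witness[of _ nat int])
  fix t assume "t \<in> {t. int (a * p) < int m * t \<and> int m * t < int (b * p)}"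
  then have "int (a * p) < int m * t" by blast
  moreover have "0 \<le> int (a * p)" by simp
  ultimately have "0 < int m * t" by linarith
  then have "t > 0" by (simp add: zero_less_mult_iff)
  then obtain n where "t = int n" by (metis nat_0_le order_less_imp_le)
  with \<open>t \<in> _\<close> show "int (nat t) = t" "nat t \<in> {t. a * p < m * t \<and> m * t < b * p}"
    by (auto simp flip: of_nat_mult)
qed (auto simp: leg_def simp flip: of_nat_mult)

lemma sum_Legendre_eq_card_diff:
  assumes "prime p" "A \<subseteq> Units (Fp p)"
  shows "real_of_int (\<Sum>x\<in>A. Legendre x (int p)) =
    real (card (A \<inter> residues_set p)) - real (card (A \<inter> nonresidues_set p))"
proof -
  have A: "A \<subseteq> {1..int p - 1}" using assms Units_Fp by auto
  then have fin: "finite A" by (rule finite_subset) simp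
  have "(\<Sum>x\<in>A. Legendre x (int p)) = (\<Sum>x\<in>A. if QuadRes (int p) x then 1 else -1)"
  proof (rule sum.cong)
    fix x assume "x \<in> A"
    then have "\<not> int p dvd x" using A by (intro zdvd_not_zless) auto
    then show "Legendre x (int p) = (if QuadRes (int p) x then 1 else - 1)"
      by (simp add: Legendre_def cong_0_iff)
  qed simp
  also have "\<dots> = int (card (A \<inter> {x. QuadRes (int p) x})) - int (card (A \<inter> - {x. QuadRes (int p) x}))"
    using fin by (simp add: sum.If_cases)
  also have "A \<inter> {x. QuadRes (int p) x} = A \<inter> residues_set p"
    using assms(2) by (auto simp: residues_set_def)
  also have "A \<inter> - {x. QuadRes (int p) x} = A \<inter> nonresidues_set p"
    using assms(2) by (auto simp: nonresidues_set_def)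
  finally show ?thesis by simp
qed

theorem theorem3:
  fixes \<epsilon> :: real
  assumes "\<epsilon> > 0"
  shows "(\<exists>C::real. C > 0 \<and>
           (\<forall>(p::nat) (A::int set) (\<psi>::real).
              prime p \<longrightarrow> [p = 1] (mod 4) \<longrightarrow> A \<subseteq> Units (Fp p) \<longrightarrow>
              real (sf (Fp p) A) = real (card A) / 3 + \<psi> \<longrightarrow>
                \<bar>real_of_int (\<Sum>x\<in>A. Legendre x (int p))\<bar> \<le> C * (\<psi> * real p powr (1/2 + \<epsilon>)) \<and>
                \<bar>real (card (A \<inter> residues_set p)) - real (card (A \<inter> nonresidues_set p))\<bar>
                  \<le> C * (\<psi> * real p powr (1/2 + \<epsilon>)))) \<and>
         (\<exists>C::real. C > 0 \<and>
           (\<forall>(p::nat) (A::int set) (\<psi>::real).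
              prime p \<longrightarrow> [p = 3] (mod 4) \<longrightarrow> A \<subseteq> Units (Fp p) \<longrightarrow>
              real (sf3 (Fp p) A) = real (card A) / 4 + \<psi> \<longrightarrow>
                \<bar>real_of_int (\<Sum>x\<in>A. Legendre x (int p))\<bar> \<le> C * (\<psi> * real p powr (1/2 + \<epsilon>))))"
proof
  \<comment> \<open>Siegel's theorem is applied once to the whole family P, so c, and with it the
    constant 1/c, is independent of p, A and \<psi>.\<close>
  define P where "P = {p::nat. prime p \<and> [p = 1] (mod 4)}"
  have P: "p > 2 \<and> \<not> 3 dvd p \<and> coprime p 3 \<and> prime p" if "p \<in> P" for p
  proof -
    have pr: "prime p" and "p mod 4 = 1" using that by (auto simp: P_def Cong.cong_def)
    then have "p > 2" "p \<noteq> 3" using prime_gt_1_nat[OF pr] by presburger+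
    moreover from this have "\<not> 3 dvd p" using pr primes_dvd_imp_eq[of 3 p] by auto
    ultimately show ?thesis using pr prime_imp_coprime[of 3 p] by (simp add: coprime_commute)
  qed
  have "\<exists>c>0. \<forall>p\<in>P. \<bar>\<Sum>t | p < 3 * t \<and> 3 * t < 2 * p. leg p t\<bar> \<ge> c * real p powr (1/2 - \<epsilon>)"
  proof (rule siegel_interval_sum[OF per_char_chi3 _ _ _ assms, where k = 3])
    show "sqrt (real 3 * real p) * Lser 1 (\<lambda>n. leg p n * chi3 n) = pi * \<bar>\<Sum>t | p < 3 * t \<and> 3 * t < 2 * p. leg p t\<bar>" if "p \<in> P" for p
      unfolding of_nat_numeral by (rule Lser_chi3_formula) (use that in \<open>auto simp: P_def\<close>)
  qed (use P in auto)
  then obtain c where c: "c > 0" "\<And>p. p \<in> P \<Longrightarrow>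
      c * real p powr (1/2 - \<epsilon>) \<le> \<bar>\<Sum>t | p < 3 * t \<and> 3 * t < 2 * p. leg p t\<bar>"
    by blast
  show "\<exists>C::real. C > 0 \<and>
           (\<forall>(p::nat) (A::int set) (\<psi>::real).
              prime p \<longrightarrow> [p = 1] (mod 4) \<longrightarrow> A \<subseteq> Units (Fp p) \<longrightarrow>
              real (sf (Fp p) A) = real (card A) / 3 + \<psi> \<longrightarrow>
                \<bar>real_of_int (\<Sum>x\<in>A. Legendre x (int p))\<bar> \<le> C * (\<psi> * real p powr (1/2 + \<epsilon>)) \<and>
                \<bar>real (card (A \<inter> residues_set p)) - real (card (A \<inter> nonresidues_set p))\<bar>
                  \<le> C * (\<psi> * real p powr (1/2 + \<epsilon>)))"
  proof (intro exI[of _ "1 / c"] conjI allI impI)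
    fix p :: nat and A :: "int set" and \<psi> :: real
    assume p: "prime p" "[p = 1] (mod 4)" and A: "A \<subseteq> Units (Fp p)"
      and \<psi>: "real (sf (Fp p) A) = real (card A) / 3 + \<psi>"
    have pP: "p \<in> P" using p by (simp add: P_def)
    have A': "A \<subseteq> {1..int p - 1}" using A p Units_Fp by auto
    then have fin: "finite A" by (rule finite_subset) simp
    define I where "I = {t. int p < 3 * t \<and> 3 * t < 2 * int p}"
    have T: "(\<Sum>t | p < 3 * t \<and> 3 * t < 2 * p. leg p t) = (\<Sum>t\<in>I. real_of_int (Legendre t (int p)))"
      using sum_leg_eq_sum_Legendre[where a = 1 and b = 2 and m = 3] by (simp add: I_def)
    show *: "\<bar>real_of_int (\<Sum>x\<in>A. Legendre x (int p))\<bar> \<le> (1 / c) * (\<psi> * real p powr (1/2 + \<epsilon>))"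
    proof (rule legendre_sum_bound[OF p(1) _ A' _ _ _ _ c(1) _ \<psi>])
      show "I \<subseteq> {1..int p - 1}" by (auto simp: I_def)
      show "card {x \<in> A. l * x mod int p \<in> I} \<le> sf (Fp p) A" for l
        unfolding I_def by (rule card_le_sf[OF fin _ sum_free_dilate]) auto
      show "real p - 1 \<le> 3 * real (card I)" unfolding I_def using P[OF pP] card_middle_third by blast
      show "c * real p powr (1/2 - \<epsilon>) \<le> \<bar>\<Sum>t\<in>I. real_of_int (Legendre t (int p))\<bar>"
        using c(2)[OF pP] unfolding T .
    qed (use P[OF pP] in auto)
    then show "\<bar>real (card (A \<inter> residues_set p)) - real (card (A \<inter> nonresidues_set p))\<bar>
      \<le> (1 / c) * (\<psi> * real p powr (1/2 + \<epsilon>))"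
      unfolding sum_Legendre_eq_card_diff[OF p(1) A] .
  qed (use c(1) in auto)
next
  define P where "P = {p::nat. prime p \<and> [p = 3] (mod 4)}"
  have P: "p > 2 \<and> p mod 4 = 3 \<and> coprime p 8 \<and> prime p" if "p \<in> P" for p
  proof -
    have pr: "prime p" and p4: "p mod 4 = 3" using that by (auto simp: P_def Cong.cong_def)
    then have "p > 2" "odd p" using prime_gt_1_nat[OF pr] by presburger+
    moreover have "coprime p (2 ^ 3)" using \<open>odd p\<close> by (simp only: coprime_power_right_iff coprime_right_2_iff_odd) simp
    ultimately show ?thesis using pr p4 by simp
  qed
  have "\<exists>c>0. \<forall>p\<in>P. \<bar>\<Sum>t | p < 8 * t \<and> 8 * t < 3 * p. leg p t\<bar> \<ge> c * real p powr (1/2 - \<epsilon>)"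
  proof (rule siegel_interval_sum[OF per_char_chi8 _ _ _ assms, where k = 2])
    show "sqrt (real 2 * real p) * Lser 1 (\<lambda>n. leg p n * chi8 n) = pi * \<bar>\<Sum>t | p < 8 * t \<and> 8 * t < 3 * p. leg p t\<bar>" if "p \<in> P" for p
      unfolding of_nat_numeral by (rule Lser_chi8_formula) (use that in \<open>auto simp: P_def\<close>)
  qed (use P in auto)
  then obtain c where c: "c > 0" "\<And>p. p \<in> P \<Longrightarrow>
      c * real p powr (1/2 - \<epsilon>) \<le> \<bar>\<Sum>t | p < 8 * t \<and> 8 * t < 3 * p. leg p t\<bar>"
    by blast
  show "\<exists>C::real. C > 0 \<and>
           (\<forall>(p::nat) (A::int set) (\<psi>::real).
              prime p \<longrightarrow> [p = 3] (mod 4) \<longrightarrow> A \<subseteq> Units (Fp p) \<longrightarrow>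
              real (sf3 (Fp p) A) = real (card A) / 4 + \<psi> \<longrightarrow>
                \<bar>real_of_int (\<Sum>x\<in>A. Legendre x (int p))\<bar> \<le> C * (\<psi> * real p powr (1/2 + \<epsilon>)))"
  proof (intro exI[of _ "1 / c"] conjI allI impI)
    fix p :: nat and A :: "int set" and \<psi> :: real
    assume p: "prime p" "[p = 3] (mod 4)" and A: "A \<subseteq> Units (Fp p)"
      and \<psi>: "real (sf3 (Fp p) A) = real (card A) / 4 + \<psi>"
    have pP: "p \<in> P" using p by (simp add: P_def)
    have A': "A \<subseteq> {1..int p - 1}" using A p Units_Fp by auto
    then have fin: "finite A" by (rule finite_subset) simp
    define I where "I = {t. int p < 8 * t \<and> 8 * t < 3 * int p}"
    have T: "(\<Sum>t | p < 8 * t \<and> 8 * t < 3 * p. leg p t) = (\<Sum>t\<in>I. real_of_int (Legendre t (int p)))"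
      using sum_leg_eq_sum_Legendre[where a = 1 and b = 3 and m = 8] by (simp add: I_def)
    show "\<bar>real_of_int (\<Sum>x\<in>A. Legendre x (int p))\<bar> \<le> (1 / c) * (\<psi> * real p powr (1/2 + \<epsilon>))"
    proof (rule legendre_sum_bound[OF p(1) _ A' _ _ _ _ c(1) _ \<psi>])
      show "I \<subseteq> {1..int p - 1}" by (auto simp: I_def)
      show "card {x \<in> A. l * x mod int p \<in> I} \<le> sf3 (Fp p) A" for l
        unfolding I_def by (rule card_le_sf3[OF fin _ sum_free3_dilate]) auto
      show "real p - 1 \<le> 4 * real (card I)" unfolding I_def using P[OF pP] card_eighths by blast
      show "c * real p powr (1/2 - \<epsilon>) \<le> \<bar>\<Sum>t\<in>I. real_of_int (Legendre t (int p))\<bar>"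
        using c(2)[OF pP] unfolding T .
    qed (use P[OF pP] in auto)
  qed (use c(1) in auto)
qed

end
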